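(* Assume that the support projection $\hat\rho_1^0$ of $\hat\rho_1$ belongs to $\mathcal A_1$ (i.e. $\operatorname{supp}\rho_1$ is $G$-invariant) and that $\operatorname{supp}\rho_0\le\operatorname{supp}\rho_1$. Then for every $\varepsilon\in(0,1)$, $$-\psi'_+(1)\le\underline s_{G,\varepsilon}(\rho_0\,\|\,\rho_1)\le\overline s_{G,\varepsilon}(\rho_0\,\|\,\rho_1)\le-\psi'_-(1),$$ where $\psi'_+(1)$ and $\psi'_-(1)$ denote the right and left derivatives of $\psi$ at $1$.
   Context: Let $\mathcal H$ be a finite-dimensional complex Hilbert space, $G$ a compact group and $g\mapsto u_g$ a continuous unitary representation of $G$ on $\mathcal H$. For $n\in\mathbb N$ let $\mathcal A_n=\{A\in\mathcal B(\mathcal H^{\otimes n}):Au_g^{\otimes n}=u_g^{\otimes n}A\ \forall g\in G\}$ and $E_{\mathcal A_n}(X)=\int_G u_g^{\otimes n}Xu_g^{*\otimes n}\,dg$ (normalized Haar measure). Let $\rho_0,\rho_1$ be states on $\mathcal B(\mathcal H)$ with density matrices $\hat\rho_0,\hat\rho_1$, and $\hat\rho_{k,n}:=E_{\mathcal A_n}(\hat\rho_k^{\otimes n})$, $k=0,1$. Powers of positive semidefinite operators use the convention $0^s=0$ for all real $s$. Let $\psi_n(s)=\log\operatorname{Tr}\hat\rho_{0,n}^s\hat\rho_{1,n}^{1-s}$ and $\psi(s)=\lim_n\frac1n\psi_n(s)$; under the hypotheses of the claim this limit exists and is finite for all $s\in[0,2]$, and $\psi$ is convex there. For $T_n\in\mathcal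 A_n$, $0\le T_n\le I$, put $\beta_{0,n}(T_n)=\operatorname{Tr}\hat\rho_0^{\otimes n}(I-T_n)$, $\beta_{1,n}(T_n)=\operatorname{Tr}\hat\rho_1^{\otimes n}T_n$. For $\varepsilon\in(0,1)$, $\underline s_{G,\varepsilon}(\rho_0\|\rho_1)$ (resp. $\overline s_{G,\varepsilon}(\rho_0\|\rho_1)$) is the infimum of $\liminf_n\frac1n\log\beta_{1,n}(T_n)$ (resp. $\limsup_n\frac1n\log\beta_{1,n}(T_n)$) over all sequences $T_n\in\mathcal A_n$, $0\le T_n\le I$, with $\beta_{0,n}(T_n)\le\varepsilon$ for all $n$. *)

theory Defs
  imports "HOL-Probability.Probability_Measure" "Jordan_Normal_Form.Schur_Decomposition"
begin

text \<open>The Hilbert space H is modelled as C^d; operators on H^(tensor n) as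
  complex matrices of dimension d^n.\<close>

definition mtrace :: "complex mat \<Rightarrow> complex" where
  "mtrace A = (\<Sum>i<dim_row A. A $$ (i,i))"

definition hermitian :: "complex mat \<Rightarrow> bool" where
  "hermitian A \<longleftrightarrow> A = mat_adjoint A"

definition psd :: "nat \<Rightarrow> complex mat \<Rightarrow> bool" where
  "psd N A \<longleftrightarrow> A \<in> carrier_mat N N \<and> hermitian A \<and>
     (\<forall>v\<in>carrier_vec N. 0 \<le> Re (conjugate v \<bullet> (A *\<^sub>v v)))"

definition unitary :: "nat \<Rightarrow> complex mat \<Rightarrow> bool" where
  "unitary N U \<longleftrightarrow> U \<in> carrier_mat N N \<and> U * mat_adjoint U = 1\<^sub>m N \<and> mat_adjoint U * U = 1\<^sub>m N"

definition state_mat :: "nat \<Rightarrow> complex mat \<Rightarrow> bool" where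
  "state_mat N A \<longleftrightarrow> psd N A \<and> mtrace A = 1"

text \<open>Real powers of positive semidefinite matrices via the spectral decomposition,
  with the convention 0^s = 0 for all real s (note that 0 powr s = 0 in Isabelle,
  and x powr 0 = 1 for x > 0, so A^0 is the support projection).\<close>
definition mpow :: "complex mat \<Rightarrow> real \<Rightarrow> complex mat" where
  "mpow A s = (SOME B. \<exists>U ev. unitary (dim_row A) U \<and> (\<forall>i. 0 \<le> ev i) \<and>
      A = U * mat_diag (dim_row A) (\<lambda>i. complex_of_real (ev i)) * mat_adjoint U \<and>
      B = U * mat_diag (dim_row A) (\<lambda>i. complex_of_real (ev i powr s)) * mat_adjoint U)"

definition kron :: "complex mat \<Rightarrow> complex mat \<Rightarrow> complex mat" where
  "kron A B = mat (dim_row A * dim_row B) (dim_col A * dim_col B)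
     (\<lambda>(i,j). A $$ (i div dim_row B, j div dim_col B) * B $$ (i mod dim_row B, j mod dim_col B))"

fun tpow :: "complex mat \<Rightarrow> nat \<Rightarrow> complex mat" where
  "tpow A 0 = 1\<^sub>m 1"
| "tpow A (Suc n) = kron (tpow A n) A"

text \<open>A compact (Hausdorff) topological group G (written additively as a type class
  group, not necessarily commutative) with a normalized left-invariant Borel
  (Haar) probability measure mu.\<close>
definition haar_prob :: "'g::{topological_group_add,t2_space} measure \<Rightarrow> bool" where
  "haar_prob \<mu> \<longleftrightarrow> sets \<mu> = sets borel \<and> prob_space \<mu> \<and>
     (\<forall>g A. A \<in> sets borel \<longrightarrow> emeasure \<mu> ((\<lambda>x. g + x) ` A) = emeasure \<mu> A)"

definition unitary_rep :: "nat \<Rightarrow> ('g::{topological_group_add} \<Rightarrow> complex mat) \<Rightarrow> bool" where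
  "unitary_rep d u \<longleftrightarrow> (\<forall>g. unitary d (u g)) \<and> u 0 = 1\<^sub>m d \<and>
     (\<forall>g h. u (g + h) = u g * u h) \<and>
     (\<forall>i<d. \<forall>j<d. continuous_on UNIV (\<lambda>g. u g $$ (i,j)))"

definition commutant :: "nat \<Rightarrow> ('g \<Rightarrow> complex mat) \<Rightarrow> nat \<Rightarrow> complex mat set" where
  "commutant d u n = {A \<in> carrier_mat (d^n) (d^n). \<forall>g. A * tpow (u g) n = tpow (u g) n * A}"

definition twirl :: "nat \<Rightarrow> 'g measure \<Rightarrow> ('g \<Rightarrow> complex mat) \<Rightarrow> nat \<Rightarrow> complex mat \<Rightarrow> complex mat" where
  "twirl d \<mu> u n X = mat (d^n) (d^n)
     (\<lambda>(i,j). \<integral>g. (tpow (u g) n * X * mat_adjoint (tpow (u g) n)) $$ (i,j) \<partial>\<mu>)"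

definition psi_n :: "nat \<Rightarrow> 'g measure \<Rightarrow> ('g \<Rightarrow> complex mat) \<Rightarrow> complex mat \<Rightarrow> complex mat
    \<Rightarrow> nat \<Rightarrow> real \<Rightarrow> real" where
  "psi_n d \<mu> u r0 r1 n s = ln (Re (mtrace (mpow (twirl d \<mu> u n (tpow r0 n)) s
                                       * mpow (twirl d \<mu> u n (tpow r1 n)) (1 - s))))"

definition psi :: "nat \<Rightarrow> 'g measure \<Rightarrow> ('g \<Rightarrow> complex mat) \<Rightarrow> complex mat \<Rightarrow> complex mat
    \<Rightarrow> real \<Rightarrow> real" where
  "psi d \<mu> u r0 r1 s = lim (\<lambda>n. psi_n d \<mu> u r0 r1 n s / real n)"

definition beta0 :: "nat \<Rightarrow> complex mat \<Rightarrow> nat \<Rightarrow> complex mat \<Rightarrow> real" where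
  "beta0 d r0 n T = Re (mtrace (tpow r0 n * (1\<^sub>m (d^n) - T)))"

definition beta1 :: "complex mat \<Rightarrow> nat \<Rightarrow> complex mat \<Rightarrow> real" where
  "beta1 r1 n T = Re (mtrace (tpow r1 n * T))"

definition elog :: "real \<Rightarrow> ereal" where
  "elog x = (if x = 0 then -\<infinity> else ereal (ln x))"

definition admissible :: "nat \<Rightarrow> ('g \<Rightarrow> complex mat) \<Rightarrow> complex mat \<Rightarrow> real \<Rightarrow> (nat \<Rightarrow> complex mat) \<Rightarrow> bool" where
  "admissible d u r0 \<epsilon> T \<longleftrightarrow> (\<forall>n. T n \<in> commutant d u n \<and> psd (d^n) (T n) \<and>
      psd (d^n) (1\<^sub>m (d^n) - T n) \<and> beta0 d r0 n (T n) \<le> \<epsilon>)"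

definition s_lower :: "nat \<Rightarrow> ('g \<Rightarrow> complex mat) \<Rightarrow> complex mat \<Rightarrow> complex mat \<Rightarrow> real \<Rightarrow> ereal" where
  "s_lower d u r0 r1 \<epsilon> = (INF T \<in> {T. admissible d u r0 \<epsilon> T}.
      liminf (\<lambda>n. elog (beta1 r1 n (T n)) / ereal (real n)))"

definition s_upper :: "nat \<Rightarrow> ('g \<Rightarrow> complex mat) \<Rightarrow> complex mat \<Rightarrow> complex mat \<Rightarrow> real \<Rightarrow> ereal" where
  "s_upper d u r0 r1 \<epsilon> = (INF T \<in> {T. admissible d u r0 \<epsilon> T}.
      limsup (\<lambda>n. elog (beta1 r1 n (T n)) / ereal (real n)))"

end

theory Submission
  imports Defs "Jordan_Normal_Form.Spectral_Radius"
begin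

text \<open>
  All comparisons of the quantities \<open>Tr A\<^sup>s B\<^sup>1\<^sup>-\<^sup>s\<close> are reduced to the functional
  \<open>F\<^sub>t(A,B) = inf\<^sub>X (Tr A X X\<^sup>* + t Tr B (1 - X)\<^sup>* (1 - X))\<close>. In the eigenbases of \<open>A\<close> and \<open>B\<close>, with
  eigenvalues \<open>p\<close>, \<open>q\<close> and squared overlaps \<open>w\<close>, it equals \<open>\<Sum> w t p q / (p + t q)\<close>, and an integral over
  \<open>t\<close> recovers \<open>Tr A\<^sup>s B\<^sup>1\<^sup>-\<^sup>s\<close> for \<open>0 < s < 1\<close>; for \<open>1 < s < 2\<close> the same holds for \<open>Tr A - F\<^sub>t(A,B)\<close>.

  As an infimum of functionals that are linear in \<open>(A,B)\<close>, \<open>F\<^sub>t\<close> is monotone (which yields the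
  Loewner--Heinz inequality), and it increases under group averages, because the minimiser for the
  averaged pair commutes with the group and sees no difference between a state and its average.
  Hence \<open>\<psi>\<^sub>n(s)\<close> is subadditive in \<open>n\<close> for \<open>s < 1\<close> and superadditive for \<open>s > 1\<close>, so \<open>\<psi>\<close> exists on \<open>(0,2)\<close>
  and is convex there.

  The upper bound comes from the Neyman--Pearson tests \<open>{\<rho>\<^sub>n - e\<^sup>n\<^sup>a \<sigma>\<^sub>n > 0}\<close> and the inequality of Audenaert
  et al., the lower bound from inserting an arbitrary test \<open>T\<close> as \<open>X = 1 - x T\<close> into \<open>F\<^sub>t\<close>.
\<close>


subsection \<open>Adjoints, traces and matrix products\<close>

text \<open>The averaged states are no longer tensor powers, so psi_n is not additive in n, and the
  existence of its limit rests on monotonicity under coarse graining. The functional of the overview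
  makes this a matter of inserting a competitor into an infimum. For s > 1 the power 1 - s of B is
  singular off the support of B. The support condition is therefore carried as
  \<open>dominated\<close>, a trace identity. It descends to the averaged pair because its defect
  there is bounded by a constant times a negative power of t, with t arbitrary. Both sides of s = 1
  enter even into the existence of psi: below 1, Fekete's argument wants a linear lower bound on
  psi_n, which comes from the upper bound at 2 - s, convexity and psi_n(1) = 0. Since also psi(1) =
  0, the quotients psi(s) / (s - 1) in the final bounds are difference quotients at 1, and s tends
  to 1 from the right for the lower bound and from the left for the upper one.\<close>

lemma index_mult_mat_sum:
  assumes "A \<in> carrier_mat a b" "B \<in> carrier_mat b c" "i < a" "j < c"
  shows "(A * B) $$ (i,j) = (\<Sum>k<b. A $$ (i,k) * B $$ (k,j))"
  using assms by (auto simp: scalar_prod_def lessThan_atLeast0)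

text \<open>The conclusion of \<open>assoc_mult_mat\<close> does not determine its carrier sizes.
  Premises on dimensions can be discharged by simp, so this rule serves to nest all products to the
  right.\<close>

lemma mult_mat_assoc_dim:
  fixes A B C :: "complex mat"
  assumes "dim_col A = dim_row B" "dim_col B = dim_row C"
  shows "A * B * C = A * (B * C)"
  by (rule assoc_mult_mat) (use assms in auto)

lemma dim_mat_adjoint [simp]:
  "dim_row (mat_adjoint A) = dim_col A" "dim_col (mat_adjoint A) = dim_row A"
  by (auto simp: mat_adjoint_def)

lemma mat_adjoint_carrier [simp]:
  "A \<in> carrier_mat a b \<Longrightarrow> mat_adjoint A \<in> carrier_mat b a"
  by (intro carrier_matI) auto

lemma mat_adjoint_index [simp]:
  fixes A :: "complex mat"
  assumes "i < dim_col A" "j < dim_row A"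
  shows "mat_adjoint A $$ (i,j) = cnj (A $$ (j,i))"
  using assms by (simp add: mat_adjoint_def mat_of_rows_index conjugate_complex_def)

lemma mat_adjoint_adjoint [simp]:
  fixes A :: "complex mat"
  shows "mat_adjoint (mat_adjoint A) = A"
  by (rule eq_matI) auto

lemma mat_adjoint_mult:
  fixes A B :: "complex mat"
  assumes "dim_col A = dim_row B"
  shows "mat_adjoint (A * B) = mat_adjoint B * mat_adjoint A"
  by (rule eq_matI) (use assms in \<open>auto simp: scalar_prod_def mult.commute\<close>)

lemma mat_adjoint_add:
  fixes A B :: "complex mat"
  assumes "A \<in> carrier_mat a b" "B \<in> carrier_mat a b"
  shows "mat_adjoint (A + B) = mat_adjoint A + mat_adjoint B"
  by (rule eq_matI) (use assms in auto)

lemma mat_adjoint_minus: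
  fixes A B :: "complex mat"
  assumes "A \<in> carrier_mat a b" "B \<in> carrier_mat a b"
  shows "mat_adjoint (A - B) = mat_adjoint A - mat_adjoint B"
  by (rule eq_matI) (use assms in auto)

lemma mat_adjoint_one [simp]: "mat_adjoint (1\<^sub>m n) = (1\<^sub>m n :: complex mat)"
  by (rule eq_matI) auto

lemma mat_adjoint_diag [simp]:
  "mat_adjoint (mat_diag n (\<lambda>i. complex_of_real (f i))) = mat_diag n (\<lambda>i. complex_of_real (f i))"
  by (rule eq_matI) (auto simp: mat_diag_def)

lemma mat_diag_dims [simp]: "dim_row (mat_diag n f) = n" "dim_col (mat_diag n f) = n"
  by (auto simp: mat_diag_def)

lemma mtrace_mult_commute:
  assumes "A \<in> carrier_mat a b" "B \<in> carrier_mat b a"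
  shows "mtrace (A * B) = mtrace (B * A)"
proof -
  have "mtrace (A * B) = (\<Sum>i<a. \<Sum>k<b. A $$ (i,k) * B $$ (k,i))"
    using assms by (auto simp: mtrace_def index_mult_mat_sum simp del: index_mult_mat(1))
  also have "\<dots> = (\<Sum>k<b. \<Sum>i<a. B $$ (k,i) * A $$ (i,k))"
    by (subst sum.swap) (simp add: mult.commute)
  also have "\<dots> = mtrace (B * A)"
    using assms by (auto simp: mtrace_def index_mult_mat_sum simp del: index_mult_mat(1))
  finally show ?thesis .
qed

lemma mtrace_add:
  assumes "A \<in> carrier_mat n n" "B \<in> carrier_mat n n"
  shows "mtrace (A + B) = mtrace A + mtrace B"
  using assms by (auto simp: mtrace_def sum.distrib)

lemma mtrace_minus:
  assumes "A \<in> carrier_mat n n" "B \<in> carrier_mat n n"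
  shows "mtrace (A - B) = mtrace A - mtrace B"
  using assms by (auto simp: mtrace_def sum_subtractf)

lemma mtrace_smult: "mtrace (c \<cdot>\<^sub>m A) = c * mtrace A" if "A \<in> carrier_mat n n"
  using that by (auto simp: mtrace_def sum_distrib_left)

lemma mtrace_mult_index:
  assumes "A \<in> carrier_mat n n" "B \<in> carrier_mat n n"
  shows "mtrace (A * B) = (\<Sum>i<n. \<Sum>k<n. A $$ (i,k) * B $$ (k,i))"
  using assms by (auto simp: mtrace_def index_mult_mat_sum simp del: index_mult_mat(1))

lemma unitaryD:
  assumes "unitary n U"
  shows "U \<in> carrier_mat n n" "dim_row U = n" "dim_col U = n"
    "U * mat_adjoint U = 1\<^sub>m n" "mat_adjoint U * U = 1\<^sub>m n"
  using assms by (auto simp: unitary_def)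

text \<open>Shaped for right-nested products, where U and its adjoint are followed by a remainder
  X.\<close>

lemma unitary_cancel:
  assumes "unitary n U" "X \<in> carrier_mat n m"
  shows "U * (mat_adjoint U * X) = X" "mat_adjoint U * (U * X) = X"
proof -
  note u = unitaryD[OF assms(1)]
  have "U * (mat_adjoint U * X) = (U * mat_adjoint U) * X"
    using u assms(2) by (subst mult_mat_assoc_dim) auto
  then show "U * (mat_adjoint U * X) = X" using u assms(2) by simp
  have "mat_adjoint U * (U * X) = (mat_adjoint U * U) * X"
    using u assms(2) by (subst mult_mat_assoc_dim) auto
  then show "mat_adjoint U * (U * X) = X" using u assms(2) by simp
qed

lemma unitary_one [simp]: "unitary n (1\<^sub>m n)"
  by (auto simp: unitary_def)

lemma unitary_mult:
  assumes "unitary n U" "unitary n V"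
  shows "unitary n (U * V)"
proof -
  note u = unitaryD[OF assms(1)] and v = unitaryD[OF assms(2)]
  have adj: "mat_adjoint (U * V) = mat_adjoint V * mat_adjoint U"
    using u v by (simp add: mat_adjoint_mult)
  have "U * V * (mat_adjoint V * mat_adjoint U) = U * (V * (mat_adjoint V * mat_adjoint U))"
    using u v by (subst mult_mat_assoc_dim) auto
  also have "\<dots> = 1\<^sub>m n" using u v by (subst unitary_cancel[OF assms(2), of _ n]) auto
  finally have 1: "U * V * mat_adjoint (U * V) = 1\<^sub>m n" by (simp add: adj)
  have "mat_adjoint V * mat_adjoint U * (U * V) = mat_adjoint V * (mat_adjoint U * (U * V))"
    using u v by (subst mult_mat_assoc_dim) auto
  also have "\<dots> = 1\<^sub>m n" using u v by (subst unitary_cancel[OF assms(1), of _ n]) auto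
  finally have 2: "mat_adjoint (U * V) * (U * V) = 1\<^sub>m n" by (simp add: adj)
  show ?thesis using 1 2 u v by (auto simp: unitary_def)
qed

subsection \<open>The spectral theorem\<close>

text \<open>Completing an eigenvector to a basis, orthogonalising and normalising gives a unitary
  whose first column is an eigenvector; orthonormality of the columns then fixes the first column of
  the conjugated matrix.\<close>

lemma unitary_with_eigenvector_column:
  fixes A :: "complex mat"
  assumes A: "A \<in> carrier_mat n n" and n: "n \<noteq> 0"
  shows "\<exists>U e. unitary n U \<and> (\<forall>i<n. (mat_adjoint U * A * U) $$ (i,0) = (if i = 0 then e else 0))"
proof -
  from spectrum_non_empty[OF A] n obtain e where "e \<in> spectrum A" by auto
  then have e: "eigenvalue A e" by (simp add: spectrum_def)
  define v where "v = find_eigenvector A e"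
  have ev: "eigenvector A v e" unfolding v_def by (rule find_eigenvector[OF A e])
  then have v: "v \<in> carrier_vec n" and v0: "v \<noteq> 0\<^sub>v n" and Av: "A *\<^sub>v v = e \<cdot>\<^sub>v v"
    using A by (auto simp: eigenvector_def)
  interpret cof_vec_space n "TYPE(complex)" .
  define b where "b = basis_completion v"
  from basis_completion[OF v v0, folded b_def]
  have dist_b: "distinct b" and indep: "\<not> lin_dep (set b)" and b: "set b \<subseteq> carrier_vec n"
    and hdb: "hd b = v" and len_b: "length b = n" by auto
  from hdb len_b n obtain vs where bv: "b = v # vs" by (cases b, auto)
  define ws where "ws = gram_schmidt n b"
  from gram_schmidt_result[OF b dist_b indep refl, folded ws_def]
  have ws: "set ws \<subseteq> carrier_vec n" "corthogonal ws" "length ws = n" by (auto simp: len_b)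
  have "ws \<noteq> []" using ws(3) n by auto
  then have hdws: "ws ! 0 = v"
    using gram_schmidt_hd[OF v, of vs, folded bv] hd_conv_nth[of ws] by (simp add: ws_def)
  \<comment> \<open>\<open>gram_schmidt\<close> yields orthogonal vectors that are not normalised;
    \<open>r j\<close> is the length of the j-th one.\<close>
  define r where "r j = sqrt (Re (ws ! j \<bullet>c ws ! j))" for j
  have wsc: "ws ! j \<in> carrier_vec n" if "j < n" for j
    using ws that by auto
  have orth: "ws ! j \<bullet>c ws ! i = (if i = j then complex_of_real ((r j)^2) else 0)"
    and rpos: "r j > 0" if "i < n" "j < n" for i j
  proof -
    have nz: "ws ! j \<bullet>c ws ! j \<noteq> 0" using corthogonalD[OF ws(2), of j j] that ws(3) by auto
    have "ws ! j \<bullet>c ws ! j = complex_of_real (\<Sum>k<n. (cmod ((ws ! j) $ k))\<^sup>2)"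
      using wsc[of j] that
      by (simp add: scalar_prod_def lessThan_atLeast0 conjugate_complex_def complex_norm_square del: of_real_power)
    moreover have "(\<Sum>k<n. (cmod ((ws ! j) $ k))\<^sup>2) \<ge> 0" by (simp add: sum_nonneg)
    ultimately have "Re (ws ! j \<bullet>c ws ! j) \<ge> 0" "Im (ws ! j \<bullet>c ws ! j) = 0"
      by auto
    with nz have "Re (ws ! j \<bullet>c ws ! j) > 0" by (metis complex_eq_iff less_eq_real_def zero_complex.simps)
    then show "r j > 0" by (simp add: r_def)
    have "ws ! j \<bullet>c ws ! j = complex_of_real ((r j)^2)"
      using \<open>Re _ \<ge> 0\<close> \<open>Im _ = 0\<close> by (simp add: r_def complex_eq_iff)
    then show "ws ! j \<bullet>c ws ! i = (if i = j then complex_of_real ((r j)^2) else 0)"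
      using corthogonalD[OF ws(2), of j i] that ws(3) by auto
  qed
  define U where "U = mat n n (\<lambda>(i,j). (ws ! j) $ i / complex_of_real (r j))"
  have U: "U \<in> carrier_mat n n" by (simp add: U_def)
  have Ui: "U $$ (i,j) = (ws ! j) $ i / complex_of_real (r j)" if "i < n" "j < n" for i j
    using that by (simp add: U_def)
  have UU: "mat_adjoint U * U = 1\<^sub>m n"
  proof (rule eq_matI)
    fix i j assume "i < dim_row (1\<^sub>m n)" "j < dim_col (1\<^sub>m n)"
    then have ij: "i < n" "j < n" by auto
    have "(mat_adjoint U * U) $$ (i,j) = (\<Sum>k<n. cnj (U $$ (k,i)) * U $$ (k,j))"
      using U ij by (subst index_mult_mat_sum[of _ n n _ n]) auto
    also have "\<dots> = (\<Sum>k<n. (ws ! j) $ k * cnj ((ws ! i) $ k)) / complex_of_real (r i * r j)"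
      using ij by (simp add: Ui sum_divide_distrib mult.commute)
    also have "(\<Sum>k<n. (ws ! j) $ k * cnj ((ws ! i) $ k)) = ws ! j \<bullet>c ws ! i"
      using wsc[of i] wsc[of j] ij by (auto simp: scalar_prod_def lessThan_atLeast0 conjugate_complex_def)
    also have "\<dots> / complex_of_real (r i * r j) = (if i = j then 1 else 0)"
      using ij orth[of i j] rpos[of i j] rpos[of j i] by (simp add: power2_eq_square)
    finally show "(mat_adjoint U * U) $$ (i,j) = 1\<^sub>m n $$ (i,j)" using ij by simp
  qed (use U in auto)
  have UU': "U * mat_adjoint U = 1\<^sub>m n"
    by (rule mat_mult_left_right_inverse[OF _ _ UU]) (use U in auto)
  have uni: "unitary n U" using U UU UU' by (simp add: unitary_def)
  have AU: "(A * U) $$ (k,0) = e * U $$ (k,0)" if "k < n" for k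
  proof -
    have "(A * U) $$ (k,0) = (\<Sum>l<n. A $$ (k,l) * U $$ (l,0))"
      using A U that n by (subst index_mult_mat_sum[of _ n n _ n]) auto
    also have "\<dots> = (\<Sum>l<n. A $$ (k,l) * v $ l) / complex_of_real (r 0)"
      using n by (simp add: Ui hdws sum_divide_distrib)
    also have "(\<Sum>l<n. A $$ (k,l) * v $ l) = (A *\<^sub>v v) $ k"
      using A v that by (auto simp: scalar_prod_def lessThan_atLeast0)
    also have "\<dots> = e * v $ k" using Av v that by simp
    finally show ?thesis using n that by (simp add: Ui hdws)
  qed
  have "(mat_adjoint U * A * U) $$ (i,0) = (if i = 0 then e else 0)" if i: "i < n" for i
  proof -
    have "mat_adjoint U * A * U = mat_adjoint U * (A * U)"
      using A U by (subst mult_mat_assoc_dim) auto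
    then have "(mat_adjoint U * A * U) $$ (i,0) = (\<Sum>k<n. mat_adjoint U $$ (i,k) * (A * U) $$ (k,0))"
      using A U i n by (simp only:) (subst index_mult_mat_sum[of _ n n _ n], auto)
    also have "\<dots> = e * (\<Sum>k<n. mat_adjoint U $$ (i,k) * U $$ (k,0))"
      unfolding sum_distrib_left by (rule sum.cong) (auto simp: AU simp del: index_mult_mat(1))
    also have "(\<Sum>k<n. mat_adjoint U $$ (i,k) * U $$ (k,0)) = (mat_adjoint U * U) $$ (i,0)"
      using U i n by (subst index_mult_mat_sum[of _ n n _ n]) auto
    finally show ?thesis using i n by (simp add: UU)
  qed
  with uni show ?thesis by blast
qed

text \<open>Induction on the size by deflation. Hermiticity carries the zeros of the first column
  over to the first row, so the remaining block is again hermitian, and it makes the eigenvalue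
  real.\<close>

lemma hermitian_unitary_diagonalization:
  fixes A :: "complex mat"
  assumes "A \<in> carrier_mat n n" "hermitian A"
  shows "\<exists>U ev. unitary n U \<and> A = U * mat_diag n (\<lambda>i. complex_of_real (ev i)) * mat_adjoint U"
proof -
  have "\<exists>U ev. unitary n U \<and> mat_adjoint U * A * U = mat_diag n (\<lambda>i. complex_of_real (ev i))"
    using assms
  proof (induction n arbitrary: A)
    case 0
    have "unitary 0 (1\<^sub>m 0)" by simp
    moreover have "mat_adjoint (1\<^sub>m 0) * A * 1\<^sub>m 0 = mat_diag 0 (\<lambda>i. complex_of_real 0)"
      by (rule eq_matI) auto
    ultimately show ?case by (intro exI[of _ "1\<^sub>m 0"] exI[of _ "\<lambda>_. 0"]) auto
  next
    case (Suc m A)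
    let ?n = "Suc m"
    from unitary_with_eigenvector_column[OF Suc.prems(1)] obtain U e where
      U: "unitary ?n U" and
      col: "\<And>i. i < ?n \<Longrightarrow> (mat_adjoint U * A * U) $$ (i,0) = (if i = 0 then e else 0)" by auto
    define B where "B = mat_adjoint U * A * U"
    note u = unitaryD[OF U]
    have B: "B \<in> carrier_mat ?n ?n" using u Suc.prems(1) by (auto simp: B_def)
    have hA: "mat_adjoint A = A" using Suc.prems(2) by (simp add: hermitian_def)
    have "mat_adjoint B = B" using u Suc.prems(1)
      by (simp add: B_def mat_adjoint_mult hA mult_mat_assoc_dim)
    then have hB: "cnj (B $$ (j,i)) = B $$ (i,j)" if "i < ?n" "j < ?n" for i j
      using B that by (metis mat_adjoint_index carrier_matD)
    have B0: "B $$ (i,0) = (if i = 0 then e else 0)" "B $$ (0,i) = (if i = 0 then e else 0)" if "i < ?n" for i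
      using col[OF that] hB[OF that, of 0] hB[of 0, OF _ that] that
      by (auto simp: B_def[symmetric])
    have e: "e = complex_of_real (Re e)" using hB[of 0 0] B0[of 0] by (simp add: complex_eq_iff)
    define C where "C = mat m m (\<lambda>(i,j). B $$ (Suc i, Suc j))"
    have C: "C \<in> carrier_mat m m" by (simp add: C_def)
    have "hermitian C" unfolding hermitian_def
      by (rule eq_matI) (auto simp: C_def hB)
    from Suc.IH[OF C this] obtain V ev where V: "unitary m V"
      and D: "mat_adjoint V * C * V = mat_diag m (\<lambda>i. complex_of_real (ev i))" by auto
    note vv = unitaryD[OF V]
    \<comment> \<open>The block diagonal sum of the scalar 1 and V.\<close>
    define W where "W = mat ?n ?n (\<lambda>(i,j). if i = 0 \<and> j = 0 then 1 else if i = 0 \<or> j = 0 then 0 else V $$ (i-1,j-1))"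
    have W: "W \<in> carrier_mat ?n ?n" by (simp add: W_def)
    have Wi: "W $$ (0,0) = 1" "\<And>i. i < m \<Longrightarrow> W $$ (0,Suc i) = 0" "\<And>i. i < m \<Longrightarrow> W $$ (Suc i,0) = 0"
      "\<And>i j. i < m \<Longrightarrow> j < m \<Longrightarrow> W $$ (Suc i,Suc j) = V $$ (i,j)"
      by (auto simp: W_def)
    have VV: "(\<Sum>k<m. cnj (V $$ (k,i)) * V $$ (k,j)) = (if i = j then 1 else 0)" if "i < m" "j < m" for i j
    proof -
      have "(mat_adjoint V * V) $$ (i,j) = (\<Sum>k<m. cnj (V $$ (k,i)) * V $$ (k,j))"
        using vv that by (subst index_mult_mat_sum[of _ m m _ m]) auto
      then show ?thesis using vv that by simp
    qed
    have WW: "mat_adjoint W * W = 1\<^sub>m ?n"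
    proof (rule eq_matI)
      fix i j assume "i < dim_row (1\<^sub>m ?n)" "j < dim_col (1\<^sub>m ?n)"
      then have ij: "i < ?n" "j < ?n" by auto
      have "(mat_adjoint W * W) $$ (i,j) = (\<Sum>k<?n. cnj (W $$ (k,i)) * W $$ (k,j))"
        using W ij by (subst index_mult_mat_sum[of _ ?n ?n _ ?n]) auto
      also have "\<dots> = (if i = j then 1 else 0)"
        using ij by (cases i; cases j) (auto simp: sum.lessThan_Suc_shift Wi VV simp del: sum.lessThan_Suc)
      finally show "(mat_adjoint W * W) $$ (i,j) = 1\<^sub>m ?n $$ (i,j)" using ij by simp
    qed (use W in auto)
    have WW': "W * mat_adjoint W = 1\<^sub>m ?n"
      by (rule mat_mult_left_right_inverse[OF _ _ WW]) (use W in auto)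
    have uW: "unitary ?n W" using W WW WW' by (simp add: unitary_def)
    define ev' where "ev' i = (case i of 0 \<Rightarrow> Re e | Suc j \<Rightarrow> ev j)" for i
    have BW: "(B * W) $$ (i,j) = (if i = 0 \<and> j = 0 then e else if i = 0 \<or> j = 0 then 0 else (C * V) $$ (i-1,j-1))"
      if "i < ?n" "j < ?n" for i j
    proof -
      have "(B * W) $$ (i,j) = (\<Sum>k<?n. B $$ (i,k) * W $$ (k,j))"
        using B W that by (subst index_mult_mat_sum[of _ ?n ?n _ ?n]) auto
      also have "\<dots> = (if i = 0 \<and> j = 0 then e else if i = 0 \<or> j = 0 then 0 else (C * V) $$ (i-1,j-1))"
        using that vv C
        by (cases i; cases j)
          (auto simp: sum.lessThan_Suc_shift Wi B0 index_mult_mat_sum[of _ m m _ m] C_def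
             simp del: sum.lessThan_Suc index_mult_mat(1) intro!: sum.cong)
      finally show ?thesis .
    qed
    have "mat_adjoint W * (B * W) = mat_diag ?n (\<lambda>i. complex_of_real (ev' i))"
    proof (rule eq_matI)
      fix i j assume "i < dim_row (mat_diag ?n (\<lambda>i. complex_of_real (ev' i)))"
        "j < dim_col (mat_diag ?n (\<lambda>i. complex_of_real (ev' i)))"
      then have ij: "i < ?n" "j < ?n" by auto
      have DD: "(\<Sum>k<m. cnj (V $$ (k,i)) * (C * V) $$ (k,j)) = (if i = j then complex_of_real (ev i) else 0)"
        if "i < m" "j < m" for i j
      proof -
        have "(mat_adjoint V * (C * V)) $$ (i,j) = (\<Sum>k<m. cnj (V $$ (k,i)) * (C * V) $$ (k,j))"
          using vv that C by (subst index_mult_mat_sum[of _ m m _ m]) auto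
        moreover have "mat_adjoint V * (C * V) = mat_diag m (\<lambda>i. complex_of_real (ev i))"
          using D vv C by (simp add: mult_mat_assoc_dim)
        ultimately show ?thesis using that by (auto simp: mat_diag_def split: if_splits)
      qed
      have "(mat_adjoint W * (B * W)) $$ (i,j) = (\<Sum>k<?n. cnj (W $$ (k,i)) * (B * W) $$ (k,j))"
        using W B ij by (subst index_mult_mat_sum[of _ ?n ?n _ ?n]) auto
      also have "\<dots> = (if i = j then complex_of_real (ev' i) else 0)"
        using ij e by (cases i; cases j)
          (auto simp: sum.lessThan_Suc_shift Wi BW DD ev'_def simp del: sum.lessThan_Suc index_mult_mat(1))
      finally show "(mat_adjoint W * (B * W)) $$ (i,j) = mat_diag ?n (\<lambda>i. complex_of_real (ev' i)) $$ (i,j)"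
        using ij by (simp add: mat_diag_def)
    qed (use W B in auto)
    moreover have "mat_adjoint W * (B * W) = mat_adjoint (U * W) * A * (U * W)"
      using u W Suc.prems(1) by (simp add: B_def mat_adjoint_mult mult_mat_assoc_dim)
    moreover have "unitary ?n (U * W)" by (rule unitary_mult[OF U uW])
    ultimately show ?case by metis
  qed
  then obtain U ev where U: "unitary n U"
    and D: "mat_adjoint U * A * U = mat_diag n (\<lambda>i. complex_of_real (ev i))" by auto
  note u = unitaryD[OF U]
  have "U * (mat_adjoint U * A * U) * mat_adjoint U = U * (mat_adjoint U * (A * (U * mat_adjoint U)))"
    using u(1-3) assms(1) by (simp add: mult_mat_assoc_dim)
  also have "\<dots> = A" using u assms(1) unitary_cancel[OF U, of A n] by simp
  finally show ?thesis using U unfolding D by (intro exI[of _ U] exI[of _ ev]) simp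
qed


subsection \<open>Functional calculus\<close>

lemma mult_carrier_iff [simp]:
  fixes A B :: "complex mat"
  shows "A * B \<in> carrier_mat a b \<longleftrightarrow> dim_row A = a \<and> dim_col B = b"
  using carrier_matD[of "A * B" a b] by (auto intro: carrier_matI)

lemma mat_adjoint_carrier_iff [simp]:
  fixes A :: "complex mat"
  shows "mat_adjoint A \<in> carrier_mat b a \<longleftrightarrow> A \<in> carrier_mat a b"
  by (metis mat_adjoint_adjoint mat_adjoint_carrier)

text \<open>\<open>f\<close> is indexed by the position of an eigenvector, not by the eigenvalue:
  for \<open>A = cdiag N U p\<close>, a function g of A is
  \<open>cdiag N U (\<lambda>i. g (p i))\<close>. With U explicit, several functions of A share one
  basis.\<close>

definition cdiag :: "nat \<Rightarrow> complex mat \<Rightarrow> (nat \<Rightarrow> real) \<Rightarrow> complex mat" where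
  "cdiag N U f = U * mat_diag N (\<lambda>i. complex_of_real (f i)) * mat_adjoint U"

lemma cdiag_carrier: "unitary N U \<Longrightarrow> cdiag N U f \<in> carrier_mat N N"
  using unitaryD by (auto simp: cdiag_def)

lemma cdiag_dims [simp]:
  "dim_row U = N \<Longrightarrow> dim_row (cdiag N U f) = N" "dim_row U = N \<Longrightarrow> dim_col (cdiag N U f) = N"
  by (auto simp: cdiag_def)

lemma cdiag_adjoint: "unitary N U \<Longrightarrow> mat_adjoint (cdiag N U f) = cdiag N U f"
  using unitaryD[of N U] by (simp add: cdiag_def mat_adjoint_mult mult_mat_assoc_dim)

lemma cdiag_cong: "(\<And>i. i < N \<Longrightarrow> f i = g i) \<Longrightarrow> cdiag N U f = cdiag N U g"
  unfolding cdiag_def by (intro arg_cong2[where f="(*)"] refl eq_matI) (auto simp: mat_diag_def)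

lemma cdiag_mult:
  assumes "unitary N U"
  shows "cdiag N U f * cdiag N U g = cdiag N U (\<lambda>i. f i * g i)"
proof -
  note u = unitaryD[OF assms]
  let ?D = "\<lambda>f. mat_diag N (\<lambda>i. complex_of_real (f i))"
  have "cdiag N U f * cdiag N U g = U * (?D f * (mat_adjoint U * (U * (?D g * mat_adjoint U))))"
    using u by (simp add: cdiag_def mult_mat_assoc_dim)
  also have "\<dots> = U * (?D f * (?D g * mat_adjoint U))"
    using u by (subst unitary_cancel[OF assms, of _ N]) auto
  also have "\<dots> = U * ((?D f * ?D g) * mat_adjoint U)"
    using u by (subst mult_mat_assoc_dim[of "?D f"]) auto
  also have "\<dots> = cdiag N U (\<lambda>i. f i * g i)"
    using u by (simp add: cdiag_def mult_mat_assoc_dim)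
  finally show ?thesis .
qed

lemma cdiag_one: "unitary N U \<Longrightarrow> cdiag N U (\<lambda>_. 1) = 1\<^sub>m N"
  using unitaryD[of N U] by (simp add: cdiag_def)

lemma cdiag_minus:
  assumes "unitary N U"
  shows "cdiag N U f - cdiag N U g = cdiag N U (\<lambda>i. f i - g i)"
proof -
  note u = unitaryD[OF assms]
  let ?D = "\<lambda>f. mat_diag N (\<lambda>i. complex_of_real (f i))"
  have "?D (\<lambda>i. f i - g i) = ?D f - ?D g" by (rule eq_matI) (auto simp: mat_diag_def)
  then show ?thesis unfolding cdiag_def
    using u by (simp add: mult_minus_distrib_mat[where nr=N and n=N and nc=N] minus_mult_distrib_mat[where nr=N and n=N and nc=N])
qed

lemma cdiag_conj:
  assumes "unitary N U"
  shows "mat_adjoint U * cdiag N U f = mat_diag N (\<lambda>i. complex_of_real (f i)) * mat_adjoint U"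
    "cdiag N U f * U = U * mat_diag N (\<lambda>i. complex_of_real (f i))"
proof -
  note u = unitaryD[OF assms]
  show "mat_adjoint U * cdiag N U f = mat_diag N (\<lambda>i. complex_of_real (f i)) * mat_adjoint U"
    using u unitary_cancel(2)[OF assms, of "mat_diag N (\<lambda>i. complex_of_real (f i)) * mat_adjoint U" N]
    by (simp add: cdiag_def mult_mat_assoc_dim)
  show "cdiag N U f * U = U * mat_diag N (\<lambda>i. complex_of_real (f i))"
    using u by (simp add: cdiag_def mult_mat_assoc_dim)
qed

text \<open>If an intertwiner connects two diagonal matrices, its entries vanish off the coinciding
  eigenvalues, so it intertwines any Schur multiplier depending only on the eigenvalues.\<close>

lemma schur_multiplier_commute:
  fixes \<phi> :: "real \<Rightarrow> real \<Rightarrow> real"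
  assumes U: "unitary N U" and V: "unitary N V" and M: "M \<in> carrier_mat N N"
    and MA: "M * cdiag N U p = cdiag N U p * M" and MB: "M * cdiag N V q = cdiag N V q * M"
  defines "K \<equiv> mat_adjoint U * V"
  defines "X \<equiv> U * mat N N (\<lambda>(i,j). complex_of_real (\<phi> (p i) (q j)) * K $$ (i,j)) * mat_adjoint V"
  shows "M * X = X * M"
proof -
  note u = unitaryD[OF U] and v = unitaryD[OF V]
  define Y where "Y = mat N N (\<lambda>(i,j). complex_of_real (\<phi> (p i) (q j)) * K $$ (i,j))"
  have Y: "Y \<in> carrier_mat N N" by (simp add: Y_def)
  have K: "K \<in> carrier_mat N N" using u v by (simp add: K_def)
  \<comment> \<open>M expressed in the two eigenbases. Each of the two matrices commutes with the
    diagonal matrix of its own basis, and K intertwines them.\<close>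
  define S where "S = mat_adjoint U * M * U"
  define R where "R = mat_adjoint V * M * V"
  have S: "S \<in> carrier_mat N N" and R: "R \<in> carrier_mat N N" using u v M by (auto simp: S_def R_def)
  have diag_comm: "(p' i = p' j \<or> Z $$ (i,j) = 0)"
    if W: "unitary N W" and Z: "Z = mat_adjoint W * M * W" and c: "M * cdiag N W p' = cdiag N W p' * M"
      and ij: "i < N" "j < N" for W Z p' i j
  proof -
    note w = unitaryD[OF W]
    let ?D = "mat_diag N (\<lambda>i. complex_of_real (p' i))"
    have Zc: "Z \<in> carrier_mat N N" using w M Z by auto
    have "Z * ?D = mat_adjoint W * (M * (W * ?D))" using w M by (simp add: Z mult_mat_assoc_dim)
    also have "\<dots> = mat_adjoint W * (M * cdiag N W p') * W"
      using w M by (simp add: cdiag_conj(2)[OF W, symmetric] mult_mat_assoc_dim)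
    also have "\<dots> = (mat_adjoint W * cdiag N W p') * M * W"
      unfolding c using w M by (simp add: mult_mat_assoc_dim)
    also have "\<dots> = ?D * Z" using w M by (simp add: cdiag_conj(1)[OF W] Z mult_mat_assoc_dim)
    finally have "(Z * ?D) $$ (i,j) = (?D * Z) $$ (i,j)" by simp
    then have "Z $$ (i,j) * p' j = p' i * Z $$ (i,j)"
      using Zc ij by (simp add: mat_diag_mult_left[of _ N N] mat_diag_mult_right[of _ N N] del: index_mult_mat(1))
    then have "Z $$ (i,j) * (complex_of_real (p' j) - complex_of_real (p' i)) = 0"
      by (simp add: algebra_simps)
    then show ?thesis by auto
  qed
  \<comment> \<open>Both sides equal M multiplied by the adjoint of U on the left and by V on the
    right.\<close>
  have SK: "S * K = K * R"
  proof -
    have "S * K = mat_adjoint U * (M * (U * (mat_adjoint U * V)))"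
      using u v M by (simp add: S_def K_def mult_mat_assoc_dim)
    also have "\<dots> = mat_adjoint U * (M * V)" using unitary_cancel(1)[OF U v(1)] by simp
    also have "\<dots> = mat_adjoint U * (V * (mat_adjoint V * (M * V)))"
      using unitary_cancel(1)[OF V, of "M * V" N] M v by simp
    also have "\<dots> = K * R" using u v M by (simp add: R_def K_def mult_mat_assoc_dim)
    finally show ?thesis .
  qed
  have SY: "S * Y = Y * R"
  proof (rule eq_matI)
    fix i j assume "i < dim_row (Y * R)" "j < dim_col (Y * R)"
    then have ij: "i < N" "j < N" using Y R by auto
    have "(S * Y) $$ (i,j) = (\<Sum>k<N. S $$ (i,k) * Y $$ (k,j))"
      using ij by (rule index_mult_mat_sum[OF S Y])
    also have "\<dots> = (\<Sum>k<N. \<phi> (p i) (q j) * (S $$ (i,k) * K $$ (k,j)))"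
    proof (rule sum.cong[OF refl])
      fix k assume "k \<in> {..<N}"
      then show "S $$ (i,k) * Y $$ (k,j) = \<phi> (p i) (q j) * (S $$ (i,k) * K $$ (k,j))"
        using diag_comm[OF U S_def MA, of i k] ij by (auto simp: Y_def)
    qed
    also have "\<dots> = \<phi> (p i) (q j) * (S * K) $$ (i,j)"
      unfolding index_mult_mat_sum[OF S K ij] by (simp add: sum_distrib_left)
    also have "\<dots> = \<phi> (p i) (q j) * (K * R) $$ (i,j)" by (simp add: SK)
    also have "\<dots> = (\<Sum>k<N. \<phi> (p i) (q j) * (K $$ (i,k) * R $$ (k,j)))"
      unfolding index_mult_mat_sum[OF K R ij] by (simp add: sum_distrib_left)
    also have "\<dots> = (\<Sum>k<N. Y $$ (i,k) * R $$ (k,j))"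
    proof (rule sum.cong[OF refl])
      fix k assume "k \<in> {..<N}"
      then show "\<phi> (p i) (q j) * (K $$ (i,k) * R $$ (k,j)) = Y $$ (i,k) * R $$ (k,j)"
        using diag_comm[OF V R_def MB, of k j] ij by (auto simp: Y_def)
    qed
    also have "\<dots> = (Y * R) $$ (i,j)" using ij by (rule index_mult_mat_sum[OF Y R, symmetric])
    finally show "(S * Y) $$ (i,j) = (Y * R) $$ (i,j)" .
  qed (use Y R S in auto)
  have "M * X = U * (mat_adjoint U * (M * (U * (Y * mat_adjoint V))))"
    using unitary_cancel(1)[OF U, of "M * (U * (Y * mat_adjoint V))" N] u v M Y
    by (simp add: X_def Y_def[symmetric] mult_mat_assoc_dim)
  also have "\<dots> = U * (S * Y) * mat_adjoint V"
    using u v M Y by (simp add: S_def mult_mat_assoc_dim)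
  also have "\<dots> = U * (Y * (mat_adjoint V * (M * (V * mat_adjoint V))))"
    unfolding SY using u(1-3) v(1-3) M Y by (simp add: R_def mult_mat_assoc_dim)
  also have "\<dots> = X * M"
    using u v M Y by (simp add: X_def Y_def[symmetric] mult_mat_assoc_dim)
  finally show ?thesis .
qed

text \<open>The preceding lemma with V = U: the overlap matrix is the identity, so the multiplier
  becomes diagonal.\<close>

lemma cdiag_commute:
  assumes U: "unitary N U" and M: "M \<in> carrier_mat N N"
    and MA: "M * cdiag N U p = cdiag N U p * M"
  shows "M * cdiag N U (\<lambda>i. f (p i)) = cdiag N U (\<lambda>i. f (p i)) * M"
proof -
  note u = unitaryD[OF U]
  have "mat N N (\<lambda>(i,j). complex_of_real (f (p i)) * (mat_adjoint U * U) $$ (i,j))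
      = mat_diag N (\<lambda>i. complex_of_real (f (p i)))"
    by (rule eq_matI) (auto simp: u(5) mat_diag_def)
  then show ?thesis
    using schur_multiplier_commute[OF U U M MA MA, of "\<lambda>a b. f a"] by (simp add: cdiag_def)
qed

text \<open>Independence of the diagonalisation, by which the choice in \<open>mpow\<close> can be
  evaluated. The overlap matrix K intertwines the diagonals of p and q, so its entry (i,j) vanishes
  unless p i = q j; it then intertwines the diagonals of f as well.\<close>

lemma cdiag_unique:
  assumes U: "unitary N U" and V: "unitary N V" and eq: "cdiag N U p = cdiag N V q"
  shows "cdiag N U (\<lambda>i. f (p i)) = cdiag N V (\<lambda>i. f (q i))"
proof -
  note u = unitaryD[OF U] and v = unitaryD[OF V]
  define K where "K = mat_adjoint U * V"
  have K: "K \<in> carrier_mat N N" using u v by (simp add: K_def)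
  let ?D = "\<lambda>f. mat_diag N (\<lambda>i. complex_of_real (f i))"
  have "?D p * K = (mat_adjoint U * cdiag N U p) * V"
    using u v by (simp add: cdiag_conj(1)[OF U] K_def mult_mat_assoc_dim)
  also have "\<dots> = mat_adjoint U * (cdiag N V q * V)" unfolding eq
    using u v by (simp add: mult_mat_assoc_dim)
  also have "\<dots> = K * ?D q"
    using u v by (simp add: cdiag_conj(2)[OF V] K_def mult_mat_assoc_dim)
  finally have e: "?D p * K = K * ?D q" .
  have fK: "?D (\<lambda>i. f (p i)) * K = K * ?D (\<lambda>i. f (q i))"
  proof (rule eq_matI)
    fix i j assume "i < dim_row (K * ?D (\<lambda>i. f (q i)))" "j < dim_col (K * ?D (\<lambda>i. f (q i)))"
    then have ij: "i < N" "j < N" using K by auto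
    have "(?D p * K) $$ (i,j) = (K * ?D q) $$ (i,j)" by (simp add: e)
    then have "p i * K $$ (i,j) = K $$ (i,j) * q j"
      using K ij by (simp add: mat_diag_mult_left[of _ N N] mat_diag_mult_right[of _ N N] del: index_mult_mat(1))
    then have "K $$ (i,j) * (complex_of_real (p i) - complex_of_real (q j)) = 0"
      by (simp add: algebra_simps)
    then have "K $$ (i,j) = 0 \<or> p i = q j" by auto
    then show "(?D (\<lambda>i. f (p i)) * K) $$ (i,j) = (K * ?D (\<lambda>i. f (q i))) $$ (i,j)"
      using K ij by (auto simp: mat_diag_mult_left[of _ N N] mat_diag_mult_right[of _ N N] simp del: index_mult_mat(1))
  qed (use K in auto)
  have "cdiag N U (\<lambda>i. f (p i)) = cdiag N U (\<lambda>i. f (p i)) * (V * mat_adjoint V)"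
    using u v cdiag_carrier[OF U] by simp
  also have "\<dots> = U * (?D (\<lambda>i. f (p i)) * K) * mat_adjoint V"
    using u(1-3) v(1-3) by (simp add: cdiag_def K_def mult_mat_assoc_dim)
  also have "\<dots> = U * (mat_adjoint U * (V * (?D (\<lambda>i. f (q i)) * mat_adjoint V)))"
    unfolding fK using u v K by (simp add: K_def mult_mat_assoc_dim)
  also have "\<dots> = cdiag N V (\<lambda>i. f (q i))"
    using u v unitary_cancel(1)[OF U, of "V * (?D (\<lambda>i. f (q i)) * mat_adjoint V)" N]
    by (simp add: cdiag_def mult_mat_assoc_dim)
  finally show ?thesis .
qed

text \<open>Cyclicity moves U to the right end; the overlap matrix and its adjoint then alternate
  with the two diagonals, which produces the squared moduli.\<close>

lemma mtrace_cdiag_mult: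
  assumes U: "unitary N U" and V: "unitary N V"
  shows "mtrace (cdiag N U f * cdiag N V g)
    = complex_of_real (\<Sum>i<N. \<Sum>j<N. (cmod ((mat_adjoint U * V) $$ (i,j)))\<^sup>2 * (f i * g j))"
proof -
  note u = unitaryD[OF U] and v = unitaryD[OF V]
  define K where "K = mat_adjoint U * V"
  have K: "K \<in> carrier_mat N N" using u v by (simp add: K_def)
  let ?D = "\<lambda>f. mat_diag N (\<lambda>i. complex_of_real (f i))"
  have "mtrace (cdiag N U f * cdiag N V g) = mtrace (U * (?D f * (mat_adjoint U * cdiag N V g)))"
    using u v by (simp add: cdiag_def mult_mat_assoc_dim)
  also have "\<dots> = mtrace ((?D f * (mat_adjoint U * cdiag N V g)) * U)"
    using u cdiag_carrier[OF V] by (intro mtrace_mult_commute[of _ N N]) auto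
  also have "(?D f * (mat_adjoint U * cdiag N V g)) * U = (?D f * K) * (?D g * mat_adjoint K)"
    using u v by (simp add: cdiag_def K_def mat_adjoint_mult mult_mat_assoc_dim)
  also have "mtrace \<dots> = (\<Sum>i<N. \<Sum>j<N. (f i * K $$ (i,j)) * (g j * cnj (K $$ (i,j))))"
    using K by (simp add: mtrace_mult_index[of _ N] mat_diag_mult_left[of _ N N] del: index_mult_mat(1))
  also have "\<dots> = (\<Sum>i<N. \<Sum>j<N. complex_of_real ((cmod (K $$ (i,j)))\<^sup>2 * (f i * g j)))"
    by (intro sum.cong refl) (simp add: complex_norm_square del: of_real_power)
  finally show ?thesis by (simp add: K_def)
qed

lemma mtrace_cdiag: "unitary N U \<Longrightarrow> mtrace (cdiag N U f) = complex_of_real (\<Sum>i<N. f i)"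
proof -
  assume U: "unitary N U"
  note u = unitaryD[OF U]
  let ?D = "mat_diag N (\<lambda>i. complex_of_real (f i))"
  have "mtrace (cdiag N U f) = mtrace (mat_adjoint U * (U * ?D))"
    unfolding cdiag_def using u by (intro mtrace_mult_commute[of _ N N]) auto
  also have "mat_adjoint U * (U * ?D) = ?D" using unitary_cancel(2)[OF U, of ?D N] by simp
  finally show ?thesis by (simp add: mtrace_def mat_diag_def)
qed

text \<open>V is arbitrary, since it cancels between X and its adjoint. Taking it to be the
  eigenbasis of the second matrix puts both terms of \<open>parquad\<close> in the same
  coordinates.\<close>

lemma mtrace_cdiag_gram:
  assumes U: "unitary N U" and V: "unitary N V" and X: "X \<in> carrier_mat N N"
  shows "mtrace (cdiag N U f * (X * mat_adjoint X))
    = complex_of_real (\<Sum>i<N. \<Sum>j<N. f i * (cmod ((mat_adjoint U * X * V) $$ (i,j)))\<^sup>2)"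
proof -
  note u = unitaryD[OF U] and v = unitaryD[OF V]
  define Y where "Y = mat_adjoint U * X * V"
  have Y: "Y \<in> carrier_mat N N" using u v X by (simp add: Y_def)
  let ?D = "\<lambda>f. mat_diag N (\<lambda>i. complex_of_real (f i))"
  have "mtrace (cdiag N U f * (X * mat_adjoint X)) = mtrace (U * (?D f * (mat_adjoint U * (X * mat_adjoint X))))"
    using u v X by (simp add: cdiag_def mult_mat_assoc_dim)
  also have "\<dots> = mtrace ((?D f * (mat_adjoint U * (X * mat_adjoint X))) * U)"
    using u X by (intro mtrace_mult_commute[of _ N N]) auto
  also have "(?D f * (mat_adjoint U * (X * mat_adjoint X))) * U
      = ?D f * (mat_adjoint U * (X * (V * (mat_adjoint V * (mat_adjoint X * U)))))"
    using u v X unitary_cancel(1)[OF V, of "mat_adjoint X * U" N] by (simp add: mult_mat_assoc_dim)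
  also have "\<dots> = (?D f * Y) * mat_adjoint Y"
    using u v X by (simp add: Y_def mat_adjoint_mult mult_mat_assoc_dim)
  also have "mtrace \<dots> = (\<Sum>i<N. \<Sum>j<N. (f i * Y $$ (i,j)) * cnj (Y $$ (i,j)))"
    using Y by (simp add: mtrace_mult_index[of _ N] mat_diag_mult_left[of _ N N] del: index_mult_mat(1))
  also have "\<dots> = (\<Sum>i<N. \<Sum>j<N. complex_of_real (f i * (cmod (Y $$ (i,j)))\<^sup>2))"
    by (intro sum.cong refl) (simp add: complex_norm_square del: of_real_power)
  finally show ?thesis by (simp add: Y_def)
qed


subsection \<open>Positive semidefinite matrices and their powers\<close>

lemma quadratic_form_eq_mtrace:
  fixes v :: "complex vec"
  assumes A: "A \<in> carrier_mat N N" and v: "v \<in> carrier_vec N"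
  shows "conjugate v \<bullet> (A *\<^sub>v v) = mtrace (A * mat N N (\<lambda>(i,j). v $ i * cnj (v $ j)))"
proof -
  have "conjugate v \<bullet> (A *\<^sub>v v) = (\<Sum>i<N. \<Sum>k<N. A $$ (i,k) * (v $ k * cnj (v $ i)))"
    using assms by (auto simp: scalar_prod_def lessThan_atLeast0 conjugate_complex_def sum_distrib_left
        ac_simps intro!: sum.cong)
  also have "\<dots> = mtrace (A * mat N N (\<lambda>(i,j). v $ i * cnj (v $ j)))"
    using A by (simp add: mtrace_mult_index[of _ N] del: index_mult_mat(1))
  finally show ?thesis .
qed

lemma psd_gram:
  assumes X: "X \<in> carrier_mat N M"
  shows "psd N (X * mat_adjoint X)"
  unfolding psd_def
proof (intro conjI ballI)
  show "X * mat_adjoint X \<in> carrier_mat N N" using X by simp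
  show "hermitian (X * mat_adjoint X)" using X by (simp add: hermitian_def mat_adjoint_mult)
  fix v :: "complex vec" assume v: "v \<in> carrier_vec N"
  define z where "z k = (\<Sum>i<N. cnj (v $ i) * X $$ (i,k))" for k
  have "conjugate v \<bullet> (X * mat_adjoint X *\<^sub>v v)
      = (\<Sum>i<N. \<Sum>j<N. (X * mat_adjoint X) $$ (i,j) * (v $ j * cnj (v $ i)))"
    using X v by (subst quadratic_form_eq_mtrace[of _ N]) (simp_all add: mtrace_mult_index[of _ N] del: index_mult_mat(1))
  also have "\<dots> = (\<Sum>i<N. \<Sum>j<N. (\<Sum>k<M. X $$ (i,k) * cnj (X $$ (j,k))) * (v $ j * cnj (v $ i)))"
    using X by (intro sum.cong refl) (simp add: index_mult_mat_sum[of _ N M _ N] del: index_mult_mat(1))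
  also have "\<dots> = (\<Sum>i<N. \<Sum>j<N. \<Sum>k<M. (cnj (v $ i) * X $$ (i,k)) * (cnj (X $$ (j,k)) * v $ j))"
    by (simp add: sum_distrib_left sum_distrib_right ac_simps)
  also have "\<dots> = (\<Sum>i<N. \<Sum>k<M. \<Sum>j<N. (cnj (v $ i) * X $$ (i,k)) * (cnj (X $$ (j,k)) * v $ j))"
    by (intro sum.cong refl sum.swap)
  also have "\<dots> = (\<Sum>k<M. \<Sum>i<N. \<Sum>j<N. (cnj (v $ i) * X $$ (i,k)) * (cnj (X $$ (j,k)) * v $ j))"
    by (rule sum.swap)
  also have "\<dots> = (\<Sum>k<M. z k * cnj (z k))"
    unfolding z_def cnj_sum sum_product by (intro sum.cong refl) (simp add: ac_simps)
  also have "\<dots> = complex_of_real (\<Sum>k<M. (cmod (z k))\<^sup>2)"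
    by (simp add: complex_norm_square del: of_real_power)
  finally show "0 \<le> Re (conjugate v \<bullet> (X * mat_adjoint X *\<^sub>v v))"
    by (simp add: sum_nonneg)
qed

lemma psd_outer:
  assumes v: "v \<in> carrier_vec N"
  shows "psd N (mat N N (\<lambda>(i,j). v $ i * cnj (v $ j)))"
proof -
  let ?X = "mat N 1 (\<lambda>(i,j). v $ i)"
  have "?X * mat_adjoint ?X = mat N N (\<lambda>(i,j). v $ i * cnj (v $ j))"
    by (rule eq_matI) (auto simp: scalar_prod_def)
  then show ?thesis using psd_gram[of ?X N 1] by simp
qed

lemma psd_carrier: "psd N A \<Longrightarrow> A \<in> carrier_mat N N"
  by (simp add: psd_def)

lemma psd_adjoint: "psd N A \<Longrightarrow> mat_adjoint A = A"
  by (simp add: psd_def hermitian_def)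

lemma psd_cdiag:
  assumes U: "unitary N U" and f: "\<And>i. i < N \<Longrightarrow> 0 \<le> f i"
  shows "psd N (cdiag N U f)"
proof -
  have "cdiag N U f = cdiag N U (\<lambda>i. sqrt (f i)) * mat_adjoint (cdiag N U (\<lambda>i. sqrt (f i)))"
    unfolding cdiag_adjoint[OF U] cdiag_mult[OF U] using f by (intro cdiag_cong) auto
  then show ?thesis using psd_gram[OF cdiag_carrier[OF U], of "\<lambda>i. sqrt (f i)"] by simp
qed

lemma hermitian_cdiagE:
  assumes "A \<in> carrier_mat N N" "mat_adjoint A = A"
  obtains U p where "unitary N U" "A = cdiag N U p"
  using hermitian_unitary_diagonalization[of A N] assms
  unfolding cdiag_def hermitian_def by metis

text \<open>The quadratic form at the k-th column of U is p k, because the projection onto this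
  column is \<open>cdiag\<close> of an indicator.\<close>

lemma psd_cdiag_eigenvalue_nonneg:
  assumes U: "unitary N U" and psd: "psd N (cdiag N U p)" and k: "k < N"
  shows "0 \<le> p k"
proof -
  note u = unitaryD[OF U]
  have c: "cdiag N U (\<lambda>i. if i = k then 1 else 0) = mat N N (\<lambda>(i,j). col U k $ i * cnj (col U k $ j))"
  proof (rule eq_matI)
    fix i j assume "i < dim_row (mat N N (\<lambda>(i,j). col U k $ i * cnj (col U k $ j)))"
      "j < dim_col (mat N N (\<lambda>(i,j). col U k $ i * cnj (col U k $ j)))"
    then have ij: "i < N" "j < N" by auto
    have "cdiag N U (\<lambda>i. if i = k then 1 else 0) $$ (i,j)
        = (\<Sum>l<N. (U $$ (i,l) * of_real (if l = k then 1 else 0)) * cnj (U $$ (j,l)))"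
      unfolding cdiag_def using u ij
      by (subst index_mult_mat_sum[of _ N N _ N]) (auto simp: mat_diag_mult_right[of _ N N])
    also have "\<dots> = U $$ (i,k) * cnj (U $$ (j,k))"
      using k by (subst sum.remove[of _ k]) auto
    finally show "cdiag N U (\<lambda>i. if i = k then 1 else 0) $$ (i,j)
        = mat N N (\<lambda>(i,j). col U k $ i * cnj (col U k $ j)) $$ (i,j)" using u ij k by simp
  qed (use u in auto)
  have v: "col U k \<in> carrier_vec N" using u by auto
  then have "0 \<le> Re (conjugate (col U k) \<bullet> (cdiag N U p *\<^sub>v col U k))"
    using psd by (simp add: psd_def)
  also have "conjugate (col U k) \<bullet> (cdiag N U p *\<^sub>v col U k)
      = mtrace (cdiag N U p * cdiag N U (\<lambda>i. if i = k then 1 else 0))"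
    unfolding c by (rule quadratic_form_eq_mtrace[OF cdiag_carrier[OF U] v])
  also have "\<dots> = complex_of_real (p k)"
    unfolding cdiag_mult[OF U] mtrace_cdiag[OF U] using k by (simp add: sum.remove[of _ k])
  finally show ?thesis by simp
qed

lemma psd_cdiagE:
  assumes "psd N A"
  obtains U p where "unitary N U" "\<forall>i. 0 \<le> p i" "A = cdiag N U p"
proof -
  obtain U p where U: "unitary N U" and A: "A = cdiag N U p"
    using hermitian_cdiagE[OF psd_carrier[OF assms] psd_adjoint[OF assms]] by blast
  \<comment> \<open>Zero from index N on, so that nonnegativity holds at every index, as the
    definition of \<open>mpow\<close> demands.\<close>
  have 1: "A = cdiag N U (\<lambda>i. if i < N then p i else 0)" unfolding A by (rule cdiag_cong) simp
  have 2: "0 \<le> (if i < N then p i else 0)" for i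
    using psd_cdiag_eigenvalue_nonneg[OF U, of p i] assms A by simp
  show ?thesis by (rule that[OF U _ 1]) (use 2 in blast)
qed

lemma mtrace_psd_mult_nonneg:
  assumes "psd N A" "psd N B"
  shows "0 \<le> Re (mtrace (A * B))"
proof -
  obtain U p where U: "unitary N U" "\<forall>i. 0 \<le> p i" "A = cdiag N U p" using psd_cdiagE[OF assms(1)] by blast
  obtain V q where V: "unitary N V" "\<forall>i. 0 \<le> q i" "B = cdiag N V q" using psd_cdiagE[OF assms(2)] by blast
  show ?thesis unfolding U(3) V(3) mtrace_cdiag_mult[OF U(1) V(1)]
    by (simp add: sum_nonneg U(2) V(2))
qed

text \<open>Self-duality of the positive cone, where rank-one matrices B already recover the
  quadratic form. It reduces operator inequalities to trace inequalities, the form in which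
  Loewner-Heinz and positivity of the group average are obtained.\<close>

lemma psdI_mtrace:
  assumes A: "A \<in> carrier_mat N N" "mat_adjoint A = A"
    and tr: "\<And>B. psd N B \<Longrightarrow> 0 \<le> Re (mtrace (A * B))"
  shows "psd N A"
  using A tr[OF psd_outer] by (auto simp: psd_def hermitian_def quadratic_form_eq_mtrace[OF A(1)])

lemma psd_add: "psd N A \<Longrightarrow> psd N B \<Longrightarrow> psd N (A + B)"
proof (rule psdI_mtrace)
  assume *: "psd N A" "psd N B"
  note c = *[THEN psd_carrier]
  show "A + B \<in> carrier_mat N N" using c by simp
  show "mat_adjoint (A + B) = A + B" using mat_adjoint_add[OF c] *[THEN psd_adjoint] by simp
  fix C assume C: "psd N C"
  have "mtrace ((A + B) * C) = mtrace (A * C) + mtrace (B * C)"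
    using c psd_carrier[OF C] by (simp add: add_mult_distrib_mat[of _ N N] mtrace_add[of _ N])
  then show "0 \<le> Re (mtrace ((A + B) * C))"
    using mtrace_psd_mult_nonneg[OF _ C] * by simp
qed

lemma mpow_cdiag:
  assumes U: "unitary N U" and p: "\<And>i. i < N \<Longrightarrow> 0 \<le> p i"
  shows "mpow (cdiag N U p) s = cdiag N U (\<lambda>i. p i powr s)"
proof -
  note u = unitaryD[OF U]
  let ?A = "cdiag N U p"
  let ?P = "\<lambda>B. \<exists>V ev. unitary (dim_row ?A) V \<and> (\<forall>i. 0 \<le> ev i) \<and>
      ?A = V * mat_diag (dim_row ?A) (\<lambda>i. complex_of_real (ev i)) * mat_adjoint V \<and>
      B = V * mat_diag (dim_row ?A) (\<lambda>i. complex_of_real (ev i powr s)) * mat_adjoint V"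
  have d: "dim_row ?A = N" using u by simp
  define p' where "p' i = (if i < N then p i else 0)" for i
  have p': "?A = cdiag N U p'" "\<forall>i. 0 \<le> p' i"
    by (auto simp: p'_def p intro: cdiag_cong)
  have "?P (cdiag N U (\<lambda>i. p' i powr s))"
    unfolding d cdiag_def[symmetric] using U p' by blast
  then have "?P (mpow ?A s)" unfolding mpow_def by (rule someI)
  then obtain V ev where V: "unitary N V" "?A = cdiag N V ev" "mpow ?A s = cdiag N V (\<lambda>i. ev i powr s)"
    unfolding d cdiag_def[symmetric] by blast
  show ?thesis unfolding V(3) using cdiag_unique[OF V(1) U, of ev p "\<lambda>x. x powr s"] V(2) by simp
qed

lemma psd_mpow: "psd N A \<Longrightarrow> psd N (mpow A s)"
proof -
  assume "psd N A"
  then obtain U p where U: "unitary N U" "\<forall>i. 0 \<le> p i" "A = cdiag N U p" using psd_cdiagE by blast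
  show ?thesis unfolding U(3) using U mpow_cdiag[OF U(1), of p s] by (simp add: psd_cdiag)
qed

lemma mpow_one: "psd N A \<Longrightarrow> mpow A 1 = A"
proof -
  assume "psd N A"
  then obtain U p where U: "unitary N U" "\<forall>i. 0 \<le> p i" "A = cdiag N U p" using psd_cdiagE by blast
  show ?thesis unfolding U(3) using U mpow_cdiag[OF U(1), of p 1] by simp
qed

lemma mpow_mult_mpow:
  assumes "psd N A" "s + t \<noteq> 0"
  shows "mpow A s * mpow A t = mpow A (s + t)"
proof -
  obtain U p where U: "unitary N U" "\<forall>i. 0 \<le> p i" "A = cdiag N U p" using psd_cdiagE[OF assms(1)] by blast
  show ?thesis unfolding U(3) using U mpow_cdiag[OF U(1), of p]
    by (simp add: cdiag_mult powr_add)
qed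


lemma add_minus_smult_carrier_iff [simp]:
  fixes A B :: "complex mat"
  shows "A - B \<in> carrier_mat a b \<longleftrightarrow> B \<in> carrier_mat a b"
    "A + B \<in> carrier_mat a b \<longleftrightarrow> B \<in> carrier_mat a b"
    "c \<cdot>\<^sub>m A \<in> carrier_mat a b \<longleftrightarrow> A \<in> carrier_mat a b"
  using carrier_matD[of "A - B" a b] carrier_matD[of "A + B" a b] carrier_matD[of "c \<cdot>\<^sub>m A" a b]
  by (auto intro: carrier_matI)

lemma smult_smult_mat: "a \<cdot>\<^sub>m (b \<cdot>\<^sub>m A) = (a * b) \<cdot>\<^sub>m A" for A :: "complex mat"
  by (rule eq_matI) auto

subsection \<open>A variational parallel sum\<close>

text \<open>The identity is split as X + (1 - X); in the Hilbert-Schmidt inner product the first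
  part is measured by left multiplication with A, the second by right multiplication with t B. These
  two positive maps commute even if A and B do not, and \<open>parsum\<close> is their parallel sum
  evaluated at the identity.\<close>

definition parquad :: "nat \<Rightarrow> real \<Rightarrow> complex mat \<Rightarrow> complex mat \<Rightarrow> complex mat \<Rightarrow> real" where
  "parquad N t A B X = Re (mtrace (A * (X * mat_adjoint X)))
     + t * Re (mtrace (B * (mat_adjoint (1\<^sub>m N - X) * (1\<^sub>m N - X))))"

definition parsum :: "nat \<Rightarrow> real \<Rightarrow> complex mat \<Rightarrow> complex mat \<Rightarrow> real" where
  "parsum N t A B = (INF X \<in> carrier_mat N N. parquad N t A B X)"

text \<open>With rows in the eigenbasis of one matrix and columns in that of the other there are no
  cross terms, so the minimisation splits into one scalar problem for each pair of
  eigenvectors.\<close>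

lemma parquad_coordinates:
  assumes U: "unitary N U" and V: "unitary N V" and X: "X \<in> carrier_mat N N"
  shows "parquad N t (cdiag N U p) (cdiag N V q) X = (\<Sum>i<N. \<Sum>j<N.
     p i * (cmod ((mat_adjoint U * X * V) $$ (i,j)))\<^sup>2
     + t * q j * (cmod ((mat_adjoint U * V) $$ (i,j) - (mat_adjoint U * X * V) $$ (i,j)))\<^sup>2)"
proof -
  note u = unitaryD[OF U] and v = unitaryD[OF V]
  define Z where "Z = 1\<^sub>m N - X"
  have Z: "Z \<in> carrier_mat N N" using X by (simp add: Z_def)
  have UZV: "mat_adjoint U * Z * V = mat_adjoint U * V - mat_adjoint U * X * V"
    using u v X by (simp add: Z_def mult_minus_distrib_mat[where nr=N and n=N and nc=N]
        minus_mult_distrib_mat[where nr=N and n=N and nc=N])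
  have "mat_adjoint V * mat_adjoint Z * U = mat_adjoint (mat_adjoint U * Z * V)"
    using u v Z by (simp add: mat_adjoint_mult mult_mat_assoc_dim)
  then have e: "(mat_adjoint V * mat_adjoint Z * U) $$ (j,i)
      = cnj ((mat_adjoint U * V) $$ (i,j) - (mat_adjoint U * X * V) $$ (i,j))" if "i < N" "j < N" for i j
    using that u v X Z unfolding UZV by (simp del: index_mult_mat(1))
  have "Re (mtrace (cdiag N V q * (mat_adjoint Z * Z)))
      = (\<Sum>j<N. \<Sum>i<N. q j * (cmod ((mat_adjoint V * mat_adjoint Z * U) $$ (j,i)))\<^sup>2)"
    using mtrace_cdiag_gram[OF V U, of "mat_adjoint Z" q] Z by simp
  also have "\<dots> = (\<Sum>i<N. \<Sum>j<N. q j * (cmod ((mat_adjoint V * mat_adjoint Z * U) $$ (j,i)))\<^sup>2)"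
    by (rule sum.swap)
  also have "\<dots> = (\<Sum>i<N. \<Sum>j<N. q j * (cmod ((mat_adjoint U * V) $$ (i,j) - (mat_adjoint U * X * V) $$ (i,j)))\<^sup>2)"
    by (intro sum.cong refl) (simp add: e del: index_mult_mat(1) complex_cnj_diff)
  finally show ?thesis
    unfolding parquad_def Z_def[symmetric] mtrace_cdiag_gram[OF U V X]
    by (simp add: sum.distrib sum_distrib_left mult.assoc del: index_mult_mat(1))
qed

text \<open>Completing the square, separately for real and imaginary parts. If p + c = 0, division
  by zero makes the left side 0.\<close>

lemma parallel_sum_le:
  fixes y k :: complex
  assumes "0 \<le> p" "0 \<le> c"
  shows "p * c / (p + c) * (cmod k)\<^sup>2 \<le> p * (cmod y)\<^sup>2 + c * (cmod (k - y))\<^sup>2"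
proof (cases "p + c = 0")
  case True
  then show ?thesis using assms by simp
next
  case False
  then have pos: "p + c > 0" using assms by auto
  have r: "p * c * b\<^sup>2 \<le> (p + c) * (p * a\<^sup>2 + c * (b - a)\<^sup>2)" for a b :: real
  proof -
    have "(p + c) * (p * a\<^sup>2 + c * (b - a)\<^sup>2) - p * c * b\<^sup>2 = ((p + c) * a - c * b)\<^sup>2"
      by (simp add: power2_eq_square algebra_simps)
    then show ?thesis using zero_le_power2[of "(p + c) * a - c * b"] by linarith
  qed
  have "p * c * (cmod k)\<^sup>2 \<le> (p + c) * (p * (cmod y)\<^sup>2 + c * (cmod (k - y))\<^sup>2)"
    using r[of "Re k" "Re y"] r[of "Im k" "Im y"] by (simp add: cmod_power2 algebra_simps)
  then show ?thesis using pos by (simp add: divide_le_eq mult.commute)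
qed

lemma parallel_sum_attained:
  fixes k :: complex
  assumes "0 \<le> p" "0 \<le> c"
  shows "p * (cmod (complex_of_real (c / (p + c)) * k))\<^sup>2 + c * (cmod (k - complex_of_real (c / (p + c)) * k))\<^sup>2
    = p * c / (p + c) * (cmod k)\<^sup>2"
proof (cases "p + c = 0")
  case True
  then show ?thesis using assms by simp
next
  case False
  have 1: "k - complex_of_real (c / (p + c)) * k = complex_of_real (p / (p + c)) * k"
  proof -
    have "complex_of_real (p / (p + c)) + complex_of_real (c / (p + c)) = complex_of_real 1"
      unfolding of_real_add[symmetric] using False by (simp add: add_divide_distrib[symmetric])
    then have "k = (complex_of_real (p / (p + c)) + complex_of_real (c / (p + c))) * k" by (simp only: of_real_1 mult_1)
    then show ?thesis by (simp only: distrib_right) (metis add_diff_cancel_right')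
  qed
  have 2: "p * (c / (p + c))\<^sup>2 + c * (p / (p + c))\<^sup>2 = p * c / (p + c)"
    using False by (simp add: power2_eq_square divide_simps) (simp add: algebra_simps)
  have n: "(cmod (complex_of_real a * k))\<^sup>2 = a\<^sup>2 * (cmod k)\<^sup>2" for a
    by (simp add: norm_mult power_mult_distrib)
  have "p * ((c / (p + c))\<^sup>2 * (cmod k)\<^sup>2) + c * ((p / (p + c))\<^sup>2 * (cmod k)\<^sup>2)
      = (p * (c / (p + c))\<^sup>2 + c * (p / (p + c))\<^sup>2) * (cmod k)\<^sup>2" by (simp only: distrib_right mult.assoc)
  then show ?thesis unfolding 1 n 2 .
qed

text \<open>The minimiser multiplies each entry of the overlap matrix by a function of the two
  eigenvalues. Such a Schur multiplier commutes with everything that commutes with both matrices,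
  which is what coarse graining will use.\<close>

lemma parsum_attained:
  assumes U: "unitary N U" and V: "unitary N V" and t: "0 < t"
    and p: "\<And>i. 0 \<le> p i" and q: "\<And>i. 0 \<le> q i"
  shows "\<exists>X\<in>carrier_mat N N. parsum N t (cdiag N U p) (cdiag N V q) = parquad N t (cdiag N U p) (cdiag N V q) X \<and>
      (\<forall>M\<in>carrier_mat N N. M * cdiag N U p = cdiag N U p * M \<longrightarrow> M * cdiag N V q = cdiag N V q * M \<longrightarrow> M * X = X * M)"
    "parsum N t (cdiag N U p) (cdiag N V q) =
       (\<Sum>i<N. \<Sum>j<N. (cmod ((mat_adjoint U * V) $$ (i,j)))\<^sup>2 * (t * (p i * q j / (p i + t * q j))))"
proof -
  note u = unitaryD[OF U] and v = unitaryD[OF V]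
  let ?A = "cdiag N U p" and ?B = "cdiag N V q"
  define K where "K = mat_adjoint U * V"
  \<comment> \<open>The scalar minimiser of \<open>parallel_sum_attained\<close> with c = t
    b.\<close>
  define \<phi> where "\<phi> a b = t * b / (a + t * b)" for a b :: real
  define Y where "Y = mat N N (\<lambda>(i,j). complex_of_real (\<phi> (p i) (q j)) * K $$ (i,j))"
  have Y: "Y \<in> carrier_mat N N" by (simp add: Y_def)
  define X where "X = U * Y * mat_adjoint V"
  have X: "X \<in> carrier_mat N N" using u v by (simp add: X_def)
  have comm: "M * X = X * M" if "M \<in> carrier_mat N N" "M * ?A = ?A * M" "M * ?B = ?B * M" for M
    unfolding X_def Y_def K_def by (rule schur_multiplier_commute[OF U V that])
  have UXV: "mat_adjoint U * X * V = Y"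
  proof -
    have "mat_adjoint U * X * V = mat_adjoint U * (U * (Y * (mat_adjoint V * V)))"
      using u(1-3) v(1-3) Y by (simp add: X_def mult_mat_assoc_dim)
    also have "\<dots> = Y" using Y v unitary_cancel(2)[OF U, of Y N] by simp
    finally show ?thesis .
  qed
  let ?S = "\<Sum>i<N. \<Sum>j<N. (cmod (K $$ (i,j)))\<^sup>2 * (t * (p i * q j / (p i + t * q j)))"
  have val: "parquad N t ?A ?B X = ?S"
    unfolding parquad_coordinates[OF U V X] UXV K_def[symmetric]
  proof (intro sum.cong refl)
    fix i j assume "i \<in> {..<N}" "j \<in> {..<N}"
    then have "Y $$ (i,j) = complex_of_real (\<phi> (p i) (q j)) * K $$ (i,j)" by (simp add: Y_def)
    then show "p i * (cmod (Y $$ (i,j)))\<^sup>2 + t * q j * (cmod (K $$ (i,j) - Y $$ (i,j)))\<^sup>2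
        = (cmod (K $$ (i,j)))\<^sup>2 * (t * (p i * q j / (p i + t * q j)))"
      using parallel_sum_attained[of "p i" "t * q j" "K $$ (i,j)"] p q t by (simp add: \<phi>_def ac_simps)
  qed
  have le: "?S \<le> parquad N t ?A ?B Z" if Z: "Z \<in> carrier_mat N N" for Z
    unfolding parquad_coordinates[OF U V Z] K_def[symmetric]
  proof (intro sum_mono)
    fix i j
    show "(cmod (K $$ (i,j)))\<^sup>2 * (t * (p i * q j / (p i + t * q j)))
      \<le> p i * (cmod ((mat_adjoint U * Z * V) $$ (i,j)))\<^sup>2 + t * q j * (cmod (K $$ (i,j) - (mat_adjoint U * Z * V) $$ (i,j)))\<^sup>2"
      using parallel_sum_le[of "p i" "t * q j" "K $$ (i,j)" "(mat_adjoint U * Z * V) $$ (i,j)"] p q t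
      by (simp add: ac_simps del: index_mult_mat(1))
  qed
  have eq: "parsum N t ?A ?B = ?S"
    unfolding parsum_def
  proof (rule cInf_eq_minimum)
    show "?S \<in> parquad N t ?A ?B ` carrier_mat N N" using val X by (metis image_eqI)
  qed (use le in auto)
  show "parsum N t ?A ?B =
      (\<Sum>i<N. \<Sum>j<N. (cmod ((mat_adjoint U * V) $$ (i,j)))\<^sup>2 * (t * (p i * q j / (p i + t * q j))))"
    using eq unfolding K_def .
  show "\<exists>X\<in>carrier_mat N N. parsum N t ?A ?B = parquad N t ?A ?B X \<and>
      (\<forall>M\<in>carrier_mat N N. M * ?A = ?A * M \<longrightarrow> M * ?B = ?B * M \<longrightarrow> M * X = X * M)"
    by (rule bexI[OF _ X]) (simp only: eq val, use comm in simp)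
qed

text \<open>The infimum is taken in the reals, so it is a lower bound only because the form is
  bounded below, here by 0.\<close>

lemma parsum_le_parquad:
  assumes A: "psd N A" and B: "psd N B" and t: "0 < t" and X: "X \<in> carrier_mat N N"
  shows "parsum N t A B \<le> parquad N t A B X"
  unfolding parsum_def
proof (rule cINF_lower[OF _ X])
  have "0 \<le> parquad N t A B Y" if Y: "Y \<in> carrier_mat N N" for Y
  proof -
    have 1: "psd N (Y * mat_adjoint Y)" using psd_gram[OF Y] .
    have "psd N (mat_adjoint (1\<^sub>m N - Y) * mat_adjoint (mat_adjoint (1\<^sub>m N - Y)))"
      by (rule psd_gram[of _ N N]) (use Y in simp)
    then show ?thesis
      using mtrace_psd_mult_nonneg[OF A 1] mtrace_psd_mult_nonneg[OF B, of "mat_adjoint (1\<^sub>m N - Y) * (1\<^sub>m N - Y)"] t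
      by (simp add: parquad_def)
  qed
  then show "bdd_below (parquad N t A B ` carrier_mat N N)" by (auto intro!: bdd_belowI[of _ 0])
qed

lemma parsum_minimizer:
  assumes A: "psd N A" and B: "psd N B" and t: "0 < t"
  shows "\<exists>X\<in>carrier_mat N N. parsum N t A B = parquad N t A B X \<and>
      (\<forall>M\<in>carrier_mat N N. M * A = A * M \<longrightarrow> M * B = B * M \<longrightarrow> M * X = X * M)"
proof -
  obtain U p where U: "unitary N U" "\<forall>i. 0 \<le> p i" "A = cdiag N U p" using psd_cdiagE[OF A] by blast
  obtain V q where V: "unitary N V" "\<forall>i. 0 \<le> q i" "B = cdiag N V q" using psd_cdiagE[OF B] by blast
  show ?thesis unfolding U(3) V(3)
    by (rule parsum_attained(1)[OF U(1) V(1) t U(2)[rule_format] V(2)[rule_format]])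
qed

lemma parsum_mono:
  assumes A: "psd N A" and B: "psd N B" and C: "psd N C" and CA: "psd N (C - A)" and t: "0 < t"
  shows "parsum N t A B \<le> parsum N t C B"
proof -
  obtain X where X: "X \<in> carrier_mat N N" "parsum N t C B = parquad N t C B X"
    using parsum_minimizer[OF C B t] by blast
  have "mtrace (C * (X * mat_adjoint X)) - mtrace (A * (X * mat_adjoint X)) = mtrace ((C - A) * (X * mat_adjoint X))"
    using psd_carrier[OF A] psd_carrier[OF C] X(1)
    by (simp add: minus_mult_distrib_mat[where nr=N and n=N and nc=N] mtrace_minus[of _ N])
  then have "Re (mtrace (A * (X * mat_adjoint X))) \<le> Re (mtrace (C * (X * mat_adjoint X)))"
    using mtrace_psd_mult_nonneg[OF CA psd_gram[OF X(1)]] by (metis diff_ge_0_iff_ge minus_complex.simps(1))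
  then show ?thesis using parsum_le_parquad[OF A B t X(1)] by (simp add: X(2) parquad_def)
qed

text \<open>The minimiser for the coarse pair lies in the fixed algebra of \<open>\<V>\<close>, where both pairs have the
  same expectations, so it competes in the minimisation for the fine pair.\<close>

lemma parsum_coarse_graining:
  assumes psd: "psd N A" "psd N B" "psd N A'" "psd N B'" and t: "0 < t"
    and \<V>: "\<V> \<subseteq> carrier_mat N N" "\<And>M. M \<in> \<V> \<Longrightarrow> mat_adjoint M \<in> \<V>"
    and comm: "\<And>M. M \<in> \<V> \<Longrightarrow> M * A' = A' * M" "\<And>M. M \<in> \<V> \<Longrightarrow> M * B' = B' * M"
    and tr: "\<And>S. S \<in> carrier_mat N N \<Longrightarrow> (\<And>M. M \<in> \<V> \<Longrightarrow> M * S = S * M) \<Longrightarrow> mtrace (A' * S) = mtrace (A * S)"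
      "\<And>S. S \<in> carrier_mat N N \<Longrightarrow> (\<And>M. M \<in> \<V> \<Longrightarrow> M * S = S * M) \<Longrightarrow> mtrace (B' * S) = mtrace (B * S)"
  shows "parsum N t A B \<le> parsum N t A' B'"
proof -
  obtain X where X: "X \<in> carrier_mat N N" "parsum N t A' B' = parquad N t A' B' X"
    and Xc: "\<forall>M\<in>carrier_mat N N. M * A' = A' * M \<longrightarrow> M * B' = B' * M \<longrightarrow> M * X = X * M"
    using parsum_minimizer[OF psd(3,4) t] by blast
  have XM: "M * X = X * M" if "M \<in> \<V>" for M using Xc comm that \<V>(1) by blast
  have adj: "M * mat_adjoint Y = mat_adjoint Y * M"
    if Y: "Y \<in> carrier_mat N N" and YM: "\<And>M. M \<in> \<V> \<Longrightarrow> M * Y = Y * M" and M: "M \<in> \<V>" for Y M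
  proof -
    have Mc: "M \<in> carrier_mat N N" using M \<V> by auto
    have "mat_adjoint (mat_adjoint M * Y) = mat_adjoint (Y * mat_adjoint M)" using YM[OF \<V>(2)[OF M]] by simp
    then show ?thesis using Y Mc by (simp add: mat_adjoint_mult)
  qed
  have prod: "M * (Y * Z) = (Y * Z) * M"
    if "Y \<in> carrier_mat N N" "Z \<in> carrier_mat N N" "M \<in> \<V>" "M * Y = Y * M" "M * Z = Z * M" for M Y Z
  proof -
    have Mc: "M \<in> carrier_mat N N" using that \<V> by auto
    have "M * (Y * Z) = (M * Y) * Z" using that(1,2) Mc by (simp add: mult_mat_assoc_dim)
    also have "\<dots> = Y * (M * Z)" unfolding that(4) using that(1,2) Mc by (simp add: mult_mat_assoc_dim)
    also have "\<dots> = (Y * Z) * M" unfolding that(5) using that(1,2) Mc by (simp add: mult_mat_assoc_dim)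
    finally show ?thesis .
  qed
  define Z where "Z = 1\<^sub>m N - X"
  have Z: "Z \<in> carrier_mat N N" using X by (simp add: Z_def)
  have ZM: "M * Z = Z * M" if "M \<in> \<V>" for M
  proof -
    have Mc: "M \<in> carrier_mat N N" using that \<V> by auto
    then show ?thesis using X XM[OF that] unfolding Z_def
      by (simp add: minus_mult_distrib_mat[where nr=N and n=N and nc=N] mult_minus_distrib_mat[where nr=N and n=N and nc=N])
  qed
  have "parquad N t A' B' X = parquad N t A B X"
    unfolding parquad_def Z_def[symmetric]
    using tr(1)[of "X * mat_adjoint X"] tr(2)[of "mat_adjoint Z * Z"] prod XM ZM adj X Z by simp
  then show ?thesis using parsum_le_parquad[OF psd(1,2) t X(1)] X(2) by simp
qed

text \<open>The eigenvalues of a test lie in [0,1], so T - T^2 is positive.\<close>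

lemma mtrace_test_square_le:
  assumes A: "psd N A" and T: "psd N T" "psd N (1\<^sub>m N - T)"
  shows "Re (mtrace (A * (T * T))) \<le> Re (mtrace (A * T))"
proof -
  obtain U p where U: "unitary N U" "\<forall>i. 0 \<le> p i" "T = cdiag N U p" using psd_cdiagE[OF T(1)] by blast
  have "1\<^sub>m N - T = cdiag N U (\<lambda>i. 1 - p i)" unfolding U(3) cdiag_one[OF U(1), symmetric] cdiag_minus[OF U(1)] ..
  then have le: "p i \<le> 1" if "i < N" for i
    using psd_cdiag_eigenvalue_nonneg[OF U(1), of "\<lambda>i. 1 - p i"] T(2) that by fastforce
  have "T - T * T = cdiag N U (\<lambda>i. p i - p i * p i)" unfolding U(3) cdiag_mult[OF U(1)] cdiag_minus[OF U(1)] ..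
  moreover have "0 \<le> p i - p i * p i" if "i < N" for i
    using le[OF that] U(2) mult_left_le[of "p i" "p i"] by simp
  ultimately have "psd N (T - T * T)" using psd_cdiag[OF U(1)] by simp
  from mtrace_psd_mult_nonneg[OF A this] show ?thesis
    using psd_carrier[OF A] psd_carrier[OF T(1)]
    by (simp add: mult_minus_distrib_mat[where nr=N and n=N and nc=N] mtrace_minus[of _ N])
qed

lemma parsum_le_test:
  assumes A: "psd N A" and B: "psd N B" and T: "psd N T" "psd N (1\<^sub>m N - T)" and t: "0 < t"
  defines "a \<equiv> Re (mtrace (A * T))" and "b \<equiv> Re (mtrace (B * T))"
  shows "parsum N t A B \<le> Re (mtrace A) - a\<^sup>2 / (a + t * b)"
proof -
  note c = psd_carrier[OF A] psd_carrier[OF B] psd_carrier[OF T(1)]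
  have a0: "0 \<le> a" and b0: "0 \<le> b" using mtrace_psd_mult_nonneg A B T by (auto simp: a_def b_def)
  \<comment> \<open>Minimises -2 x a + x^2 (a + t b), which bounds the variable part of the form
    once T^2 is replaced by T. If a + t b = 0, division by zero gives x = 0.\<close>
  define x where "x = a / (a + t * b)"
  define X where "X = 1\<^sub>m N - complex_of_real x \<cdot>\<^sub>m T"
  have X: "X \<in> carrier_mat N N" using c by (simp add: X_def)
  have Tadj: "mat_adjoint T = T" by (rule psd_adjoint[OF T(1)])
  have sadj: "mat_adjoint (complex_of_real x \<cdot>\<^sub>m T) = complex_of_real x \<cdot>\<^sub>m T"
  proof -
    have "mat_adjoint (complex_of_real x \<cdot>\<^sub>m T) = complex_of_real x \<cdot>\<^sub>m mat_adjoint T"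
      by (rule eq_matI) auto
    then show ?thesis by (simp add: Tadj)
  qed
  have Xadj: "mat_adjoint X = X" unfolding X_def using c
    by (subst mat_adjoint_minus[of _ N N]) (auto simp: sadj)
  have Z: "1\<^sub>m N - X = complex_of_real x \<cdot>\<^sub>m T" unfolding X_def using c by (intro eq_matI) auto
  have XX: "X * X = 1\<^sub>m N - complex_of_real (2 * x) \<cdot>\<^sub>m T + complex_of_real (x\<^sup>2) \<cdot>\<^sub>m (T * T)"
  proof -
    have "X * X = 1\<^sub>m N * X - complex_of_real x \<cdot>\<^sub>m T * X" using c X unfolding X_def
      by (subst minus_mult_distrib_mat[where nr=N and n=N and nc=N]) auto
    also have "complex_of_real x \<cdot>\<^sub>m T * X = complex_of_real x \<cdot>\<^sub>m T * 1\<^sub>m N - complex_of_real x \<cdot>\<^sub>m T * (complex_of_real x \<cdot>\<^sub>m T)"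
      using c unfolding X_def by (subst mult_minus_distrib_mat[where nr=N and n=N and nc=N]) auto
    also have "complex_of_real x \<cdot>\<^sub>m T * (complex_of_real x \<cdot>\<^sub>m T) = complex_of_real (x\<^sup>2) \<cdot>\<^sub>m (T * T)"
      using c by (simp add: mult_smult_distrib[of _ N N _ N] mult_smult_assoc_mat[of _ N N _ N] smult_smult_mat power2_eq_square)
    finally show ?thesis using c unfolding X_def by (intro eq_matI) (auto simp del: index_mult_mat(1))
  qed
  have ZZ: "(1\<^sub>m N - X) * (1\<^sub>m N - X) = complex_of_real (x\<^sup>2) \<cdot>\<^sub>m (T * T)"
    unfolding Z using c by (simp add: mult_smult_distrib[of _ N N _ N] mult_smult_assoc_mat[of _ N N _ N] smult_smult_mat power2_eq_square)
  have 1: "mtrace (A * (X * X)) = mtrace A - 2 * x * mtrace (A * T) + x\<^sup>2 * mtrace (A * (T * T))"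
  proof -
    have "A * (X * X) = A - complex_of_real (2 * x) \<cdot>\<^sub>m (A * T) + complex_of_real (x\<^sup>2) \<cdot>\<^sub>m (A * (T * T))"
      unfolding XX using c
      by (simp add: mult_add_distrib_mat[where nr=N and n=N and nc=N] mult_minus_distrib_mat[where nr=N and n=N and nc=N]
          mult_smult_distrib[of _ N N _ N])
    then show ?thesis using c by (simp add: mtrace_add[of _ N] mtrace_minus[of _ N] mtrace_smult[of _ N])
  qed
  have 2: "mtrace (B * ((1\<^sub>m N - X) * (1\<^sub>m N - X))) = x\<^sup>2 * mtrace (B * (T * T))"
    unfolding ZZ using c by (simp add: mult_smult_distrib[of _ N N _ N] mtrace_smult[of _ N])
  have "parsum N t A B \<le> parquad N t A B X" by (rule parsum_le_parquad[OF A B t X])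
  also have "\<dots> = Re (mtrace A) - 2 * x * a + x\<^sup>2 * Re (mtrace (A * (T * T))) + t * (x\<^sup>2 * Re (mtrace (B * (T * T))))"
  proof -
    have Zadj: "mat_adjoint (1\<^sub>m N - X) = 1\<^sub>m N - X" using sadj Z by simp
    show ?thesis unfolding parquad_def Xadj Zadj 1 2 a_def
      by (simp flip: of_real_power)
  qed
  also have "\<dots> \<le> Re (mtrace A) - 2 * x * a + x\<^sup>2 * a + t * (x\<^sup>2 * b)"
    using mtrace_test_square_le[OF A T] mtrace_test_square_le[OF B T] t
    unfolding a_def b_def by (intro add_mono mult_left_mono) auto
  also have "\<dots> = Re (mtrace A) - a\<^sup>2 / (a + t * b)"
  proof (cases "a + t * b = 0")
    case True
    then have "x = 0" by (simp add: x_def)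
    then show ?thesis using True by simp
  next
    case False
    have "x\<^sup>2 * a + t * (x\<^sup>2 * b) = x * (x * (a + t * b))" by (simp add: power2_eq_square algebra_simps)
    also have "x * (a + t * b) = a" using False by (simp add: x_def)
    finally have "- 2 * x * a + x\<^sup>2 * a + t * (x\<^sup>2 * b) = - (x * a)" by simp
    moreover have "x * a = a\<^sup>2 / (a + t * b)" by (simp add: x_def power2_eq_square)
    ultimately show ?thesis by simp
  qed
  finally show ?thesis .
qed


subsection \<open>An integral representation of powers\<close>

text \<open>With u = exp y this is the Beta integral pi / sin(pi s) for 0 < s < 1. It enters as a
  positive factor that cancels from comparisons.\<close>

definition pow_const :: "real \<Rightarrow> real" where
  "pow_const s = (\<integral>y. exp (s * y) / (1 + exp y) \<partial>lborel)"

lemma integrable_exp_atLeast: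
  fixes a :: real
  assumes "0 < a"
  shows "integrable lborel (\<lambda>y. exp (- (a * y)) * indicator {0..} y :: real)"
proof (rule integrableI_nonneg)
  have "((\<lambda>y. - exp (- (a * y)) / a) \<longlongrightarrow> - 0 / a) at_top"
  proof (intro tendsto_intros)
    have "filterlim (\<lambda>y. a * y) at_top at_top"
      using assms by (intro filterlim_tendsto_pos_mult_at_top[OF tendsto_const]) (auto simp: filterlim_ident)
    then have "filterlim (\<lambda>y. - (a * y)) at_bot at_top" by (simp add: filterlim_uminus_at_top)
    then show "((\<lambda>y. exp (- (a * y))) \<longlongrightarrow> 0) at_top"
      by (rule filterlim_compose[OF exp_at_bot])
  qed (use assms in auto)
  then have "(\<integral>\<^sup>+y. ennreal (exp (- (a * y))) * indicator {0..} y \<partial>lborel) = ennreal (- 0 / a - (- exp (- (a * 0)) / a))"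
    using assms by (intro nn_integral_FTC_atLeast) (auto intro!: derivative_eq_intros)
  moreover have "(\<integral>\<^sup>+y. ennreal (exp (- (a * y)) * indicator {0..} y) \<partial>lborel)
      = (\<integral>\<^sup>+y. ennreal (exp (- (a * y))) * indicator {0..} y \<partial>lborel)"
    by (intro nn_integral_cong) (auto split: split_indicator)
  ultimately show "(\<integral>\<^sup>+y. ennreal (exp (- (a * y)) * indicator {0..} y) \<partial>lborel) < \<infinity>" by simp
qed auto

lemma pow_kernel_integrable:
  fixes s :: real
  assumes "0 < s" "s < 1"
  shows "integrable lborel (\<lambda>y. exp (s * y) / (1 + exp y))"
proof -
  \<comment> \<open>The kernel decays like exp(-(1 - s) y) to the right and like exp(s y) to the
    left. The reflection is written \<open>0 + (-1) * y\<close> to match the affine change of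
    variables.\<close>
  let ?g = "\<lambda>y. exp (- ((1 - s) * y)) * indicator {0..} y + exp (- (s * (0 + (-1) * y))) * indicator {0..} (0 + (-1) * y) :: real"
  have "integrable lborel ?g"
    using lborel_integrable_real_affine[OF integrable_exp_atLeast[of s], of "-1" 0] integrable_exp_atLeast[of "1 - s"] assms
    by (intro Bochner_Integration.integrable_add) auto
  then show ?thesis
  proof (rule Bochner_Integration.integrable_bound)
    have "exp (s * y) / (1 + exp y) \<le> ?g y" for y :: real
    proof (cases "0 \<le> y")
      case True
      have "exp (s * y) / (1 + exp y) \<le> exp (s * y) / exp y"
        by (intro divide_left_mono) (auto intro!: mult_pos_pos add_pos_pos)
      also have "\<dots> = exp (- ((1 - s) * y))" by (simp add: exp_diff[symmetric] algebra_simps)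
      also have "\<dots> \<le> ?g y" using True by (simp add: indicator_def)
      finally show ?thesis .
    next
      case False
      have "exp (s * y) / (1 + exp y) \<le> exp (s * y) / 1"
        by (intro divide_left_mono) (auto intro!: mult_pos_pos add_pos_pos)
      also have "\<dots> \<le> ?g y" using False by (simp add: indicator_def)
      finally show ?thesis .
    qed
    then show "AE y in lborel. norm (exp (s * y) / (1 + exp y)) \<le> norm (?g y)"
      by (intro AE_I2) (force simp: abs_of_nonneg add_nonneg_nonneg)
  qed auto
qed

lemma pow_const_pos:
  assumes "0 < s" "s < 1"
  shows "0 < pow_const s"
proof -
  \<comment> \<open>On [0,1] the kernel is at least this constant.\<close>
  have i: "integrable lborel (\<lambda>y::real. indicator {0..1} y * (1 / (1 + exp 1)) :: real)"
    by (intro integrable_mult_left) auto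
  have "(\<integral>y. indicator {0..1::real} y * (1 / (1 + exp 1)) \<partial>lborel) \<le> pow_const s"
    unfolding pow_const_def
  proof (rule Bochner_Integration.integral_mono[OF i pow_kernel_integrable[OF assms]])
    fix y :: real
    show "indicator {0..1} y * (1 / (1 + exp 1)) \<le> exp (s * y) / (1 + exp y)"
      using assms by (auto simp: indicator_def intro!: frac_le add_pos_pos)
  qed
  moreover have "(\<integral>y. indicator {0..1::real} y * (1 / (1 + exp 1)) \<partial>lborel) = 1 / (1 + exp 1 :: real)"
    by simp
  moreover have "0 < 1 / (1 + exp 1 :: real)" by (simp add: add_pos_pos)
  ultimately show ?thesis by linarith
qed

text \<open>In the variable y = ln t the quotient p / q acts by translation: shifting y by ln(p / q)
  pulls the powers out and leaves \<open>pow_const\<close>. If p or q is 0, both sides vanish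
  because \<open>0 powr s = 0\<close>.\<close>

lemma powr_integral_representation:
  assumes s: "0 < s" "s < 1" and pq: "0 \<le> p" "0 \<le> q"
  shows "has_bochner_integral lborel (\<lambda>y. p * q / (p + exp y * q) * exp (s * y))
    (pow_const s * (p powr s * q powr (1 - s)))"
proof (cases "p = 0 \<or> q = 0")
  case True
  then show ?thesis by (auto simp: has_bochner_integral_zero)
next
  case False
  then have pos: "0 < p" "0 < q" using pq by auto
  have "has_bochner_integral lborel (\<lambda>y. (p powr s * q powr (1 - s)) * (exp (s * y) / (1 + exp y)))
      ((p powr s * q powr (1 - s)) * pow_const s)"
    unfolding pow_const_def
    by (intro has_bochner_integral_mult_right has_bochner_integral_integrable pow_kernel_integrable s)
  moreover have "(p powr s * q powr (1 - s)) * (exp (s * y) / (1 + exp y))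
      = p * q / (p + exp (ln (p / q) + 1 * y) * q) * exp (s * (ln (p / q) + 1 * y))" for y
  proof -
    have e: "exp (ln (p / q) + 1 * y) * q = p * exp y" using pos by (simp add: exp_add)
    have f: "exp (s * (ln (p / q) + 1 * y)) = p powr s / q powr s * exp (s * y)"
      using pos by (simp add: powr_def distrib_left exp_add ln_div right_diff_distrib exp_diff)
    have g: "q powr (1 - s) = q / q powr s" using pos by (simp add: powr_diff)
    have h: "p + p * exp y = p * (1 + exp y)" by (simp add: distrib_left)
    have n: "1 + exp y \<noteq> 0" using exp_gt_zero[of y] by linarith
    show ?thesis unfolding e f g h using pos n by (simp add: ac_simps)
  qed
  ultimately have "has_bochner_integral lborel
      (\<lambda>y. p * q / (p + exp (ln (p / q) + 1 * y) * q) * exp (s * (ln (p / q) + 1 * y)))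
      ((p powr s * q powr (1 - s)) * pow_const s)" by simp
  then show ?thesis
    by (subst lborel_has_bochner_integral_real_affine_iff[of 1 _ _ "ln (p / q)"]) (simp_all add: mult.commute)
qed

text \<open>Since p^2 / (p + t q) = p - t p q / (p + t q), this is the scalar form of Tr A minus
  \<open>parsum\<close>. It is p / q times the previous formula at s - 1.\<close>

lemma powr_integral_representation':
  assumes s: "1 < s" "s < 2" and pq: "0 \<le> p" "0 < q"
  shows "has_bochner_integral lborel (\<lambda>y. p\<^sup>2 / (p + exp y * q) * exp ((s - 1) * y))
    (pow_const (s - 1) * (p powr s * q powr (1 - s)))"
proof -
  have "has_bochner_integral lborel (\<lambda>y. p / q * (p * q / (p + exp y * q) * exp ((s - 1) * y)))
    (p / q * (pow_const (s - 1) * (p powr (s - 1) * q powr (1 - (s - 1)))))"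
    using assms by (intro has_bochner_integral_mult_right powr_integral_representation) auto
  moreover have "p / q * (p powr (s - 1) * q powr (1 - (s - 1))) = p powr s * q powr (1 - s)"
  proof -
    have "q powr (1 - (s - 1)) = q * q powr (1 - s)"
      using pq powr_add[of q 1 "1 - s"] by simp
    moreover have "p * p powr (s - 1) = p powr s"
      using pq powr_add[of p 1 "s - 1"] by (cases "p = 0") auto
    ultimately show ?thesis using pq by simp
  qed
  then have "p / q * (pow_const (s - 1) * (p powr (s - 1) * q powr (1 - (s - 1))))
      = pow_const (s - 1) * (p powr s * q powr (1 - s))" by (metis mult.left_commute)
  moreover have "(\<lambda>y. p / q * (p * q / (p + exp y * q) * exp ((s - 1) * y)))
      = (\<lambda>y. p\<^sup>2 / (p + exp y * q) * exp ((s - 1) * y))"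
    using pq by (auto simp: power2_eq_square)
  ultimately show ?thesis by simp
qed

text \<open>With x = p / (t q) the claim becomes x / (x + 1) <= x^(s-1), true because the left side
  is at most min(x, 1) and 0 < s - 1 < 1.\<close>

lemma square_div_le_powr:
  fixes p q t s :: real
  assumes "0 \<le> p" "0 < q" "0 < t" "1 < s" "s < 2"
  shows "p\<^sup>2 / (p + t * q) \<le> t powr (1 - s) * (p powr s * q powr (1 - s))"
proof (cases "p = 0")
  case False
  then have p: "0 < p" using assms by simp
  define x where "x = p / (t * q)"
  have x: "0 < x" using p assms by (simp add: x_def)
  have "x / (x + 1) \<le> x powr (s - 1)"
  proof (cases "x \<le> 1")
    case True
    have "x / (x + 1) \<le> x / 1" using x by (intro divide_left_mono) auto
    also have "x / 1 = x powr 1" using x by simp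
    also have "x powr 1 \<le> x powr (s - 1)" using x True assms by (intro powr_mono') auto
    finally show ?thesis .
  next
    case False
    have "x / (x + 1) \<le> 1" using x by simp
    also have "1 \<le> x powr (s - 1)" using False assms by (intro ge_one_powr_ge_zero) auto
    finally show ?thesis .
  qed
  then have "p * (x / (x + 1)) \<le> p * x powr (s - 1)" using p by (intro mult_left_mono) auto
  moreover have "p * (x / (x + 1)) = p\<^sup>2 / (p + t * q)"
    using p assms by (simp add: x_def power2_eq_square divide_simps)
  moreover have "p * x powr (s - 1) = t powr (1 - s) * (p powr s * q powr (1 - s))"
  proof -
    have "x powr (s - 1) = p powr (s - 1) * (t powr (1 - s) * q powr (1 - s))"
      using p assms powr_minus_divide[of "t * q" "s - 1"] by (simp add: x_def powr_divide powr_mult)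
    moreover have "p * p powr (s - 1) = p powr s" using p powr_add[of p 1 "s - 1"] by simp
    ultimately show ?thesis by (metis mult.assoc mult.left_commute)
  qed
  ultimately show ?thesis by simp
qed simp

lemma nonpos_if_le_powr:
  fixes x c s :: real
  assumes "1 < s" "\<And>t. 0 < t \<Longrightarrow> x \<le> t powr (1 - s) * c"
  shows "x \<le> 0"
proof -
  have "((\<lambda>t::real. t powr (1 - s) * c) \<longlongrightarrow> 0 * c) at_top"
    using assms by (intro tendsto_intros tendsto_neg_powr filterlim_ident) auto
  then show ?thesis
    using assms(2) by (intro tendsto_lowerbound[of _ 0 at_top x])
      (auto intro!: eventually_mono[OF eventually_gt_at_top[of "0::real"]])
qed

subsection \<open>Trace functionals of a pair of positive matrices\<close>

text \<open>For the two averaged states, \<open>psi_n\<close> is the logarithm of this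
  quantity.\<close>

definition qtr :: "complex mat \<Rightarrow> complex mat \<Rightarrow> real \<Rightarrow> real" where
  "qtr A B s = Re (mtrace (mpow A s * mpow B (1 - s)))"

text \<open>For positive matrices this is the inclusion of supp A in supp B, since
  \<open>mpow B 0\<close> is the support projection. As a single scalar equation it can be reached
  by a limiting argument for pairs whose supports are not known explicitly.\<close>

definition dominated :: "complex mat \<Rightarrow> complex mat \<Rightarrow> bool" where
  "dominated A B \<longleftrightarrow> Re (mtrace (A * mpow B 0)) = Re (mtrace A)"

text \<open>The weights are the Nussbaum--Szkola weights: squared overlaps of the two eigenbases.\<close>

lemma overlap_representation:
  assumes A: "psd N A" and B: "psd N B"
  obtains w p q :: "nat \<times> nat \<Rightarrow> real" and I where "finite I"
    "\<forall>k. 0 \<le> w k" "\<forall>k. 0 \<le> p k" "\<forall>k. 0 \<le> q k"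
    "\<forall>s s'. Re (mtrace (mpow A s * mpow B s')) = (\<Sum>k\<in>I. w k * (p k powr s * q k powr s'))"
    "\<forall>t>0. parsum N t A B = (\<Sum>k\<in>I. w k * (t * (p k * q k / (p k + t * q k))))"
    "Re (mtrace A) = (\<Sum>k\<in>I. w k * p k)"
proof -
  obtain U p where U: "unitary N U" "\<forall>i. 0 \<le> p i" "A = cdiag N U p" using psd_cdiagE[OF A] by blast
  obtain V q where V: "unitary N V" "\<forall>i. 0 \<le> q i" "B = cdiag N V q" using psd_cdiagE[OF B] by blast
  define w where "w k = (cmod ((mat_adjoint U * V) $$ k))\<^sup>2" for k
  let ?I = "{..<N} \<times> {..<N}"
  have pairs: "(\<Sum>i<N. \<Sum>j<N. (cmod ((mat_adjoint U * V) $$ (i,j)))\<^sup>2 * F (p i) (q j))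
      = (\<Sum>k\<in>?I. w k * F (p (fst k)) (q (snd k)))" for F :: "real \<Rightarrow> real \<Rightarrow> real"
    by (simp add: sum.cartesian_product w_def case_prod_beta del: index_mult_mat(1))
  have 1: "Re (mtrace (mpow A s * mpow B s')) = (\<Sum>k\<in>?I. w k * (p (fst k) powr s * q (snd k) powr s'))" for s s'
    unfolding U(3) V(3) mpow_cdiag[OF U(1) U(2)[rule_format]] mpow_cdiag[OF V(1) V(2)[rule_format]]
      mtrace_cdiag_mult[OF U(1) V(1)] Re_complex_of_real
    by (rule pairs)
  have 2: "parsum N t A B = (\<Sum>k\<in>?I. w k * (t * (p (fst k) * q (snd k) / (p (fst k) + t * q (snd k)))))"
    if "0 < t" for t
    unfolding U(3) V(3) parsum_attained(2)[OF U(1) V(1) that U(2)[rule_format] V(2)[rule_format]]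
    by (rule pairs)
  have "Re (mtrace A) = Re (mtrace (cdiag N U p * cdiag N V (\<lambda>_. 1)))"
    using psd_carrier[OF A] by (simp add: cdiag_one[OF V(1)] U(3))
  also have "\<dots> = (\<Sum>k\<in>?I. w k * p (fst k))"
    unfolding mtrace_cdiag_mult[OF U(1) V(1)] Re_complex_of_real
    using pairs[of "\<lambda>a b. a * 1"] by simp
  finally have 3: "Re (mtrace A) = (\<Sum>k\<in>?I. w k * p (fst k))" .
  show ?thesis
  proof (rule that[where I="?I" and w=w and p="\<lambda>k. p (fst k)" and q="\<lambda>k. q (snd k)"])
    show "\<forall>s s'. Re (mtrace (mpow A s * mpow B s')) = (\<Sum>k\<in>?I. w k * (p (fst k) powr s * q (snd k) powr s'))"
      by (intro allI 1)
    show "\<forall>t>0. parsum N t A B = (\<Sum>k\<in>?I. w k * (t * (p (fst k) * q (snd k) / (p (fst k) + t * q (snd k)))))"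
      by (intro allI impI 2)
    show "Re (mtrace A) = (\<Sum>k\<in>?I. w k * p (fst k))" by (rule 3)
    show "\<forall>k. 0 \<le> p (fst k)" "\<forall>k. 0 \<le> q (snd k)" using U(2) V(2) by simp_all
    show "finite ?I" by simp
    show "\<forall>k. 0 \<le> w k" unfolding w_def by (intro allI zero_le_power2)
  qed
qed

text \<open>The weight is exp((s - 1) y) rather than exp(s y) because \<open>parsum\<close> already
  contains a factor t = exp y.\<close>

lemma qtr_integral:
  assumes A: "psd N A" and B: "psd N B" and s: "0 < s" "s < 1"
  shows "has_bochner_integral lborel (\<lambda>y. parsum N (exp y) A B * exp ((s - 1) * y)) (pow_const s * qtr A B s)"
proof -
  obtain w p q :: "nat \<times> nat \<Rightarrow> real" and I where I: "finite I"
    "\<forall>k. 0 \<le> w k" "\<forall>k. 0 \<le> p k" "\<forall>k. 0 \<le> q k"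
    "\<forall>s s'. Re (mtrace (mpow A s * mpow B s')) = (\<Sum>k\<in>I. w k * (p k powr s * q k powr s'))"
    "\<forall>t>0. parsum N t A B = (\<Sum>k\<in>I. w k * (t * (p k * q k / (p k + t * q k))))"
    "Re (mtrace A) = (\<Sum>k\<in>I. w k * p k)"
    by (rule overlap_representation[OF A B])
  have "has_bochner_integral lborel (\<lambda>y. \<Sum>k\<in>I. w k * (p k * q k / (p k + exp y * q k) * exp (s * y)))
      (\<Sum>k\<in>I. w k * (pow_const s * (p k powr s * q k powr (1 - s))))"
    using I by (intro has_bochner_integral_sum has_bochner_integral_mult_right powr_integral_representation s) auto
  moreover have "parsum N (exp y) A B * exp ((s - 1) * y)
      = (\<Sum>k\<in>I. w k * (p k * q k / (p k + exp y * q k) * exp (s * y)))" for y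
  proof -
    have e: "exp (s * y) = exp y * exp ((s - 1) * y)" by (simp add: exp_add[symmetric] algebra_simps)
    show ?thesis unfolding I(6)[rule_format, OF exp_gt_zero] e sum_distrib_right
      by (intro sum.cong refl) simp
  qed
  moreover have "(\<Sum>k\<in>I. w k * (pow_const s * (p k powr s * q k powr (1 - s)))) = pow_const s * qtr A B s"
    unfolding qtr_def I(5)[rule_format] sum_distrib_left by (intro sum.cong refl) simp
  ultimately show ?thesis by simp
qed

lemma qtr_mono:
  assumes psd: "psd N A" "psd N B" "psd M A'" "psd M B'" and s: "0 < s" "s < 1"
    and le: "\<And>t. 0 < t \<Longrightarrow> parsum N t A B \<le> parsum M t A' B'"
  shows "qtr A B s \<le> qtr A' B' s"
proof -
  note i = qtr_integral[OF psd(1,2) s] and i' = qtr_integral[OF psd(3,4) s]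
  have "pow_const s * qtr A B s \<le> pow_const s * qtr A' B' s"
    unfolding has_bochner_integral_integral_eq[OF i, symmetric] has_bochner_integral_integral_eq[OF i', symmetric]
    using i i' by (intro Bochner_Integration.integral_mono) (auto simp: has_bochner_integral_iff intro!: mult_right_mono le)
  then show ?thesis using pow_const_pos[OF s] by simp
qed

text \<open>A vanishing sum of nonnegative terms gives w k p k = 0 whenever q k = 0. Such indices
  contribute nothing and are discarded, which makes negative powers of q harmless.\<close>

lemma dominated_overlap:
  assumes A: "psd N A" and B: "psd N B" and dom: "dominated A B"
  obtains w p q :: "nat \<times> nat \<Rightarrow> real" and I where "finite I"
    "\<forall>k. 0 \<le> w k" "\<forall>k. 0 \<le> p k" "\<forall>k\<in>I. 0 < q k"
    "\<forall>s s'. s \<noteq> 0 \<longrightarrow> Re (mtrace (mpow A s * mpow B s')) = (\<Sum>k\<in>I. w k * (p k powr s * q k powr s'))"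
    "\<forall>t>0. Re (mtrace A) - parsum N t A B = (\<Sum>k\<in>I. w k * ((p k)\<^sup>2 / (p k + t * q k)))"
    "Re (mtrace A) = (\<Sum>k\<in>I. w k * p k)"
proof -
  obtain w p q :: "nat \<times> nat \<Rightarrow> real" and J where J: "finite J"
    "\<forall>k. 0 \<le> w k" "\<forall>k. 0 \<le> p k" "\<forall>k. 0 \<le> q k"
    "\<forall>s s'. Re (mtrace (mpow A s * mpow B s')) = (\<Sum>k\<in>J. w k * (p k powr s * q k powr s'))"
    "\<forall>t>0. parsum N t A B = (\<Sum>k\<in>J. w k * (t * (p k * q k / (p k + t * q k))))"
    "Re (mtrace A) = (\<Sum>k\<in>J. w k * p k)"
    by (rule overlap_representation[OF A B])
  define I where "I = {k \<in> J. 0 < q k}"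
  have "(\<Sum>k\<in>J. w k * (p k * (1 - q k powr 0))) = 0"
  proof -
    have "(\<Sum>k\<in>J. w k * (p k * q k powr 0)) = Re (mtrace A)"
      using dom J(5)[rule_format, of 1 0] J(3) by (simp add: dominated_def mpow_one[OF A])
    then show ?thesis by (simp add: J(7) right_diff_distrib sum_subtractf)
  qed
  then have z: "w k * (p k * (1 - q k powr 0)) = 0" if "k \<in> J" for k
    using sum_nonneg_eq_0_iff[of J "\<lambda>k. w k * (p k * (1 - q k powr 0))"] J(1-4) that by fastforce
  have wp: "w k = 0 \<or> p k = 0" if "k \<in> J - I" for k
  proof -
    have "q k = 0" using that J(4) by (auto simp: I_def less_le)
    then show ?thesis using z[of k] that by auto
  qed
  have red: "(\<Sum>k\<in>J. w k * f k) = (\<Sum>k\<in>I. w k * f k)" if "\<And>k. p k = 0 \<Longrightarrow> f k = 0" for f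
    using J(1) wp that by (intro sum.mono_neutral_right) (auto simp: I_def)
  show ?thesis
  proof (rule that[of I w p q])
    show "\<forall>s s'. s \<noteq> 0 \<longrightarrow> Re (mtrace (mpow A s * mpow B s')) = (\<Sum>k\<in>I. w k * (p k powr s * q k powr s'))"
      using J(5) red[of "\<lambda>k. p k powr _ * q k powr _"] by simp
    show "Re (mtrace A) = (\<Sum>k\<in>I. w k * p k)" using J(7) red[of p] by simp
    show "\<forall>t>0. Re (mtrace A) - parsum N t A B = (\<Sum>k\<in>I. w k * ((p k)\<^sup>2 / (p k + t * q k)))"
    proof (intro allI impI)
      fix t :: real assume t: "0 < t"
      have "Re (mtrace A) - parsum N t A B = (\<Sum>k\<in>J. w k * (p k - t * (p k * q k / (p k + t * q k))))"
        using t J(6,7) by (simp add: right_diff_distrib sum_subtractf)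
      also have "\<dots> = (\<Sum>k\<in>I. w k * (p k - t * (p k * q k / (p k + t * q k))))"
        by (rule red) simp
      also have "\<dots> = (\<Sum>k\<in>I. w k * ((p k)\<^sup>2 / (p k + t * q k)))"
      proof (intro sum.cong refl)
        fix k assume "k \<in> I"
        then have "0 < p k + t * q k" using t J(3)[rule_format, of k] by (auto simp: I_def intro!: add_nonneg_pos)
        then show "w k * (p k - t * (p k * q k / (p k + t * q k))) = w k * ((p k)\<^sup>2 / (p k + t * q k))"
          by (simp add: field_simps power2_eq_square)
      qed
      finally show "Re (mtrace A) - parsum N t A B = (\<Sum>k\<in>I. w k * ((p k)\<^sup>2 / (p k + t * q k)))" .
    qed
  qed (use J in \<open>auto simp: I_def\<close>)
qed

text \<open>\<open>square_div_le_powr\<close> in each summand. The bound serves twice: to pass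
  domination to coarser pairs and to limit the performance of tests.\<close>

lemma trace_minus_parsum_le:
  assumes A: "psd N A" and B: "psd N B" and dom: "dominated A B" and s: "1 < s" "s < 2" and t: "0 < t"
  shows "Re (mtrace A) - parsum N t A B \<le> t powr (1 - s) * qtr A B s"
proof -
  obtain w p q :: "nat \<times> nat \<Rightarrow> real" and I where I: "finite I"
    "\<forall>k. 0 \<le> w k" "\<forall>k. 0 \<le> p k" "\<forall>k\<in>I. 0 < q k"
    "\<forall>s s'. s \<noteq> 0 \<longrightarrow> Re (mtrace (mpow A s * mpow B s')) = (\<Sum>k\<in>I. w k * (p k powr s * q k powr s'))"
    "\<forall>t>0. Re (mtrace A) - parsum N t A B = (\<Sum>k\<in>I. w k * ((p k)\<^sup>2 / (p k + t * q k)))"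
    "Re (mtrace A) = (\<Sum>k\<in>I. w k * p k)"
    by (rule dominated_overlap[OF A B dom])
  have "Re (mtrace A) - parsum N t A B \<le> (\<Sum>k\<in>I. w k * (t powr (1 - s) * (p k powr s * q k powr (1 - s))))"
    unfolding I(6)[rule_format, OF t]
    using I(2-4) s t by (intro sum_mono mult_left_mono square_div_le_powr) auto
  also have "\<dots> = t powr (1 - s) * qtr A B s"
    using s I(5) by (simp add: qtr_def sum_distrib_left mult.left_commute)
  finally show ?thesis .
qed

text \<open>The defect z of the coarser pair is at most its trace minus \<open>parsum\<close>, for
  every t; this is at most the same difference for the finer pair, which is O(t^(-1/2)). Letting t
  grow gives z = 0.\<close>

lemma dominated_coarse:
  assumes psd: "psd N A" "psd N B" "psd M A'" "psd M B'" and dom: "dominated A B"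
    and tr: "Re (mtrace A) = Re (mtrace A')"
    and le: "\<And>t. 0 < t \<Longrightarrow> parsum N t A B \<le> parsum M t A' B'"
  shows "dominated A' B'"
proof -
  obtain w p q :: "nat \<times> nat \<Rightarrow> real" and J where J: "finite J"
    "\<forall>k. 0 \<le> w k" "\<forall>k. 0 \<le> p k" "\<forall>k. 0 \<le> q k"
    "\<forall>s s'. Re (mtrace (mpow A' s * mpow B' s')) = (\<Sum>k\<in>J. w k * (p k powr s * q k powr s'))"
    "\<forall>t>0. parsum M t A' B' = (\<Sum>k\<in>J. w k * (t * (p k * q k / (p k + t * q k))))"
    "Re (mtrace A') = (\<Sum>k\<in>J. w k * p k)"
    by (rule overlap_representation[OF psd(3,4)])
  define z where "z = (\<Sum>k\<in>J. w k * (p k * (1 - q k powr 0)))"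
  \<comment> \<open>3/2 stands for any exponent strictly between 1 and 2.\<close>
  have "z \<le> t powr (1 - 3/2) * qtr A B (3/2)" if t: "0 < t" for t
  proof -
    have "z \<le> (\<Sum>k\<in>J. w k * (p k - t * (p k * q k / (p k + t * q k))))"
      unfolding z_def
    proof (intro sum_mono mult_left_mono)
      fix k
      have nn: "0 \<le> p k" "0 \<le> q k" using J(3,4) by blast+
      have "t * (p k * q k / (p k + t * q k)) \<le> p k * (q k powr 0)"
      proof (cases "q k = 0")
        case False
        then have "0 < q k" using nn by simp
        then have "0 < p k + t * q k" "t * (p k * q k) \<le> p k * (p k + t * q k)"
          using nn t by (auto simp: algebra_simps intro!: add_nonneg_pos)
        then show ?thesis using False by (simp add: divide_le_eq)
      qed simp
      then show "p k * (1 - q k powr 0) \<le> p k - t * (p k * q k / (p k + t * q k))"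
        unfolding right_diff_distrib by simp
    qed (use J in auto)
    also have "\<dots> = Re (mtrace A') - parsum M t A' B'"
      using t J(6,7) by (simp add: right_diff_distrib sum_subtractf)
    also have "\<dots> \<le> Re (mtrace A) - parsum N t A B" using tr le[OF t] by simp
    also have "\<dots> \<le> t powr (1 - 3/2) * qtr A B (3/2)"
      by (rule trace_minus_parsum_le[OF psd(1,2) dom _ _ t]) auto
    finally show ?thesis .
  qed
  then have "z \<le> 0" by (intro nonpos_if_le_powr[of "3/2"]) auto
  moreover have "0 \<le> z" unfolding z_def using J by (intro sum_nonneg mult_nonneg_nonneg) auto
  moreover have "z = Re (mtrace A') - Re (mtrace (A' * mpow B' 0))"
    using J(5)[rule_format, of 1 0] J(3) 
    by (simp add: z_def J(7) mpow_one[OF psd(3)] right_diff_distrib sum_subtractf)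
  ultimately show ?thesis by (simp add: dominated_def)
qed

lemma qtr_integral':
  assumes A: "psd N A" and B: "psd N B" and dom: "dominated A B" and s: "1 < s" "s < 2"
  shows "has_bochner_integral lborel (\<lambda>y. (Re (mtrace A) - parsum N (exp y) A B) * exp ((s - 1) * y))
    (pow_const (s - 1) * qtr A B s)"
proof -
  obtain w p q :: "nat \<times> nat \<Rightarrow> real" and I where I: "finite I"
    "\<forall>k. 0 \<le> w k" "\<forall>k. 0 \<le> p k" "\<forall>k\<in>I. 0 < q k"
    "\<forall>s s'. s \<noteq> 0 \<longrightarrow> Re (mtrace (mpow A s * mpow B s')) = (\<Sum>k\<in>I. w k * (p k powr s * q k powr s'))"
    "\<forall>t>0. Re (mtrace A) - parsum N t A B = (\<Sum>k\<in>I. w k * ((p k)\<^sup>2 / (p k + t * q k)))"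
    "Re (mtrace A) = (\<Sum>k\<in>I. w k * p k)"
    by (rule dominated_overlap[OF A B dom])
  have "has_bochner_integral lborel (\<lambda>y. \<Sum>k\<in>I. w k * ((p k)\<^sup>2 / (p k + exp y * q k) * exp ((s - 1) * y)))
      (\<Sum>k\<in>I. w k * (pow_const (s - 1) * (p k powr s * q k powr (1 - s))))"
    using I by (intro has_bochner_integral_sum has_bochner_integral_mult_right powr_integral_representation' s) auto
  moreover have "(Re (mtrace A) - parsum N (exp y) A B) * exp ((s - 1) * y)
      = (\<Sum>k\<in>I. w k * ((p k)\<^sup>2 / (p k + exp y * q k) * exp ((s - 1) * y)))" for y
    unfolding I(6)[rule_format, OF exp_gt_zero] sum_distrib_right by (intro sum.cong refl) simp
  moreover have "(\<Sum>k\<in>I. w k * (pow_const (s - 1) * (p k powr s * q k powr (1 - s)))) = pow_const (s - 1) * qtr A B s"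
    using s I(5) by (simp add: qtr_def sum_distrib_left mult.left_commute)
  ultimately show ?thesis by simp
qed

text \<open>The order reverses because \<open>parsum\<close> is now subtracted from equal traces.
  Domination of the coarser pair has to be derived before its integral formula applies.\<close>

lemma qtr_antimono:
  assumes psd: "psd N A" "psd N B" "psd M A'" "psd M B'" and dom: "dominated A B"
    and s: "1 < s" "s < 2" and tr: "Re (mtrace A) = Re (mtrace A')"
    and le: "\<And>t. 0 < t \<Longrightarrow> parsum N t A B \<le> parsum M t A' B'"
  shows "qtr A' B' s \<le> qtr A B s"
proof -
  have dom': "dominated A' B'" by (rule dominated_coarse[OF psd dom tr le])
  note i = qtr_integral'[OF psd(1,2) dom s] and i' = qtr_integral'[OF psd(3,4) dom' s]
  have "pow_const (s - 1) * qtr A' B' s \<le> pow_const (s - 1) * qtr A B s"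
    unfolding has_bochner_integral_integral_eq[OF i, symmetric] has_bochner_integral_integral_eq[OF i', symmetric]
    using i i' tr by (intro Bochner_Integration.integral_mono) (auto simp: has_bochner_integral_iff intro!: mult_right_mono le)
  then show ?thesis using pow_const_pos[of "s - 1"] s by simp
qed


section \<open>Positivity and logarithmic convexity in the exponent\<close>

lemma qtr_one: "psd N A \<Longrightarrow> qtr A B 1 = Re (mtrace (A * mpow B 0))"
  by (simp add: qtr_def mpow_one)

lemma qtr_pos:
  assumes A: "psd N A" and B: "psd N B" and dom: "dominated A B" and tr: "0 < Re (mtrace A)" and s: "s \<noteq> 0"
  shows "0 < qtr A B s"
proof -
  obtain w p q :: "nat \<times> nat \<Rightarrow> real" and I where I: "finite I"
    "\<forall>k. 0 \<le> w k" "\<forall>k. 0 \<le> p k" "\<forall>k\<in>I. 0 < q k"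
    "\<forall>s s'. s \<noteq> 0 \<longrightarrow> Re (mtrace (mpow A s * mpow B s')) = (\<Sum>k\<in>I. w k * (p k powr s * q k powr s'))"
    "\<forall>t>0. Re (mtrace A) - parsum N t A B = (\<Sum>k\<in>I. w k * ((p k)\<^sup>2 / (p k + t * q k)))"
    "Re (mtrace A) = (\<Sum>k\<in>I. w k * p k)"
    by (rule dominated_overlap[OF A B dom])
  have "\<exists>k\<in>I. w k * p k \<noteq> 0" using tr I(7) by (metis (no_types, lifting) less_irrefl sum.neutral)
  then obtain k where k: "k \<in> I" "w k * p k \<noteq> 0" by blast
  then have "0 < w k" "0 < p k" "0 < q k" using I(2,3)[rule_format, of k] I(4) by auto
  then have "0 < w k * (p k powr s * q k powr (1 - s))" by simp
  then show ?thesis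
    using I(5) s unfolding qtr_def
    by (simp, intro sum_pos2[OF I(1) k(1)]) (use I in auto)
qed

lemma exp_convex_combination_le:
  fixes u v c :: real
  assumes "0 \<le> c" "c \<le> 1"
  shows "exp ((1 - c) * u + c * v) \<le> (1 - c) * exp u + c * exp v"
  using convex_onD[OF exp_convex, of c u v] assms by simp

text \<open>A Hoelder argument: each summand with p k > 0 is w k times exp of an affine function of
  s. After division by exp L, the weighted geometric mean of the two endpoint values, convexity of
  exp in each summand bounds the total by 1.\<close>

lemma ln_qtr_convex:
  assumes A: "psd N A" and B: "psd N B" and dom: "dominated A B" and tr: "0 < Re (mtrace A)"
  shows "convex_on {0<..} (\<lambda>s. ln (qtr A B s))"
proof (rule convex_onI)
  show "convex {0::real<..}" by simp
  fix c x y :: real assume c: "0 < c" "c < 1" and xy: "x \<in> {0<..}" "y \<in> {0<..}"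
  obtain w p q :: "nat \<times> nat \<Rightarrow> real" and I where I: "finite I"
    "\<forall>k. 0 \<le> w k" "\<forall>k. 0 \<le> p k" "\<forall>k\<in>I. 0 < q k"
    "\<forall>s s'. s \<noteq> 0 \<longrightarrow> Re (mtrace (mpow A s * mpow B s')) = (\<Sum>k\<in>I. w k * (p k powr s * q k powr s'))"
    "\<forall>t>0. Re (mtrace A) - parsum N t A B = (\<Sum>k\<in>I. w k * ((p k)\<^sup>2 / (p k + t * q k)))"
    "Re (mtrace A) = (\<Sum>k\<in>I. w k * p k)"
    by (rule dominated_overlap[OF A B dom])
  let ?z = "(1 - c) *\<^sub>R x + c *\<^sub>R y"
  have z: "0 < ?z" using c xy by (simp add: add_pos_pos)
  have qs: "qtr A B s = (\<Sum>k\<in>I. w k * (p k powr s * q k powr (1 - s)))" if "0 < s" for s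
    using I(5) that by (simp add: qtr_def)
  have pos: "0 < qtr A B s" if "0 < s" for s using qtr_pos[OF A B dom tr] that by simp
  define F where "F = qtr A B x"
  define G where "G = qtr A B y"
  have FG: "0 < F" "0 < G" using pos xy by (auto simp: F_def G_def)
  define L where "L = (1 - c) * ln F + c * ln G"
  have "qtr A B ?z * exp (- L)
      \<le> (\<Sum>k\<in>I. (1 - c) * (w k * (p k powr x * q k powr (1 - x)) / F) + c * (w k * (p k powr y * q k powr (1 - y)) / G))"
    unfolding qs[OF z] sum_distrib_right
  proof (rule sum_mono)
    fix k assume k: "k \<in> I"
    show "w k * (p k powr ?z * q k powr (1 - ?z)) * exp (- L)
      \<le> (1 - c) * (w k * (p k powr x * q k powr (1 - x)) / F) + c * (w k * (p k powr y * q k powr (1 - y)) / G)"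
    proof (cases "p k = 0")
      case False
      then have pk: "0 < p k" and qk: "0 < q k" using I(3)[rule_format, of k] I(4) k by auto
      define u where "u s = s * ln (p k) + (1 - s) * ln (q k)" for s
      have e: "p k powr s * q k powr (1 - s) = exp (u s)" for s
        using pk qk by (simp add: powr_def u_def exp_add)
      have "exp (u ?z) * exp (- L) = exp ((1 - c) * (u x - ln F) + c * (u y - ln G))"
        unfolding exp_add[symmetric] by (simp add: u_def L_def algebra_simps)
      also have "\<dots> \<le> (1 - c) * exp (u x - ln F) + c * exp (u y - ln G)"
        using c by (intro exp_convex_combination_le) auto
      also have "\<dots> = (1 - c) * (exp (u x) / F) + c * (exp (u y) / G)"
        using FG by (simp add: exp_diff)
      finally have "w k * (exp (u ?z) * exp (- L)) \<le> w k * ((1 - c) * (exp (u x) / F) + c * (exp (u y) / G))"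
        using I(2)[rule_format, of k] by (intro mult_left_mono)
      then show ?thesis unfolding e by (simp add: algebra_simps)
    qed simp
  qed
  also have "\<dots> = (1 - c) * (F / F) + c * (G / G)"
    using xy by (simp add: sum.distrib sum_distrib_left[symmetric] sum_divide_distrib[symmetric] F_def G_def qs)
  also have "\<dots> = 1" using FG by simp
  finally have "qtr A B ?z \<le> exp L" by (simp add: exp_minus divide_simps)
  then have "ln (qtr A B ?z) \<le> L" using pos[OF z] ln_le_cancel_iff[of "qtr A B ?z" "exp L"] by simp
  then show "ln (qtr A B ?z) \<le> (1 - c) * ln (qtr A B x) + c * ln (qtr A B y)" by (simp add: L_def F_def G_def)
qed

text \<open>The trial bound \<open>parsum_le_test\<close> and the power bound
  \<open>trace_minus_parsum_le\<close> are combined at t = a / b; the denominator a + t b is then 2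
  a, the source of the factor 2. If b were 0, letting t grow would force a <= 0.\<close>

lemma test_converse:
  assumes A: "psd N A" and B: "psd N B" and dom: "dominated A B"
    and T: "psd N T" "psd N (1\<^sub>m N - T)" and s: "1 < s" "s < 2"
  defines "a \<equiv> Re (mtrace (A * T))" and "b \<equiv> Re (mtrace (B * T))"
  assumes a: "0 < a"
  shows "0 < b" and "a powr s * b powr (1 - s) \<le> 2 * qtr A B s"
proof -
  have b0: "0 \<le> b" unfolding b_def by (rule mtrace_psd_mult_nonneg[OF B T(1)])
  have main: "a\<^sup>2 / (a + t * b) \<le> t powr (1 - s) * qtr A B s" if "0 < t" for t
    using parsum_le_test[OF A B T that] trace_minus_parsum_le[OF A B dom s that]
    unfolding a_def b_def by linarith
  show b: "0 < b"
  proof (rule ccontr)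
    assume "\<not> 0 < b"
    then have "b = 0" using b0 by simp
    then have "a \<le> t powr (1 - s) * qtr A B s" if "0 < t" for t
      using main[OF that] a by (simp add: power2_eq_square)
    then show False using nonpos_if_le_powr[OF s(1)] a by fastforce
  qed
  have "a\<^sup>2 / (a + a / b * b) \<le> (a / b) powr (1 - s) * qtr A B s" using a b by (intro main) simp
  moreover have "a\<^sup>2 / (a + a / b * b) = a / 2" using a b by (simp add: power2_eq_square)
  ultimately have "a \<le> 2 * ((a / b) powr (1 - s) * qtr A B s)" by linarith
  then have "a \<le> 2 * qtr A B s * (a / b) powr (1 - s)" by (simp add: ac_simps)
  then have "a * (a / b) powr (s - 1) \<le> 2 * qtr A B s * (a / b) powr (1 - s) * (a / b) powr (s - 1)"
    by (intro mult_right_mono) auto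
  also have "\<dots> = 2 * qtr A B s * ((a / b) powr (1 - s) * (a / b) powr (s - 1))" by simp
  also have "(a / b) powr (1 - s) * (a / b) powr (s - 1) = 1" using a b by (simp flip: powr_add)
  also have "a * (a / b) powr (s - 1) = a powr s * b powr (1 - s)"
  proof -
    have "a * a powr (s - 1) = a powr s" using a powr_add[of a 1 "s - 1"] by simp
    moreover have "b powr (1 - s) = 1 / b powr (s - 1)" using powr_minus_divide[of b "s - 1"] by simp
    ultimately show ?thesis using a b by (simp add: powr_divide)
  qed
  finally show "a powr s * b powr (1 - s) \<le> 2 * qtr A B s" by simp
qed

subsection \<open>Operator monotonicity and the optimal test\<close>

lemma mpow_mpow:
  assumes "psd N A"
  shows "mpow (mpow A a) b = mpow A (a * b)"
proof -
  obtain U p where U: "unitary N U" "\<forall>i. 0 \<le> p i" "A = cdiag N U p" using psd_cdiagE[OF assms] by blast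
  show ?thesis unfolding U(3) using U mpow_cdiag[OF U(1), of p] mpow_cdiag[OF U(1), of "\<lambda>i. p i powr a" b]
    by (simp add: powr_powr)
qed

text \<open>By \<open>psdI_mtrace\<close> it is enough to test against D >= 0. Writing D as the
  power 1 - s of another positive matrix turns both traces into \<open>qtr\<close>, which
  \<open>parsum_mono\<close> compares.\<close>

lemma loewner_heinz:
  assumes A: "psd N A" and C: "psd N C" and CA: "psd N (C - A)" and s: "0 < s" "s < 1"
  shows "psd N (mpow C s - mpow A s)"
proof (rule psdI_mtrace)
  note pA = psd_mpow[OF A, of s] and pC = psd_mpow[OF C, of s]
  show "mpow C s - mpow A s \<in> carrier_mat N N" using psd_carrier[OF pA] by simp
  show "mat_adjoint (mpow C s - mpow A s) = mpow C s - mpow A s"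
    using mat_adjoint_minus[OF psd_carrier[OF pC] psd_carrier[OF pA]] psd_adjoint[OF pA] psd_adjoint[OF pC] by simp
  fix D assume D: "psd N D"
  let ?B = "mpow D (1 / (1 - s))"
  have B: "psd N ?B" by (rule psd_mpow[OF D])
  have BD: "mpow ?B (1 - s) = D" using mpow_mpow[OF D] s mpow_one[OF D] by simp
  have "qtr A ?B s \<le> qtr C ?B s"
    by (rule qtr_mono[OF A B C B s]) (rule parsum_mono[OF A B C CA])
  then have "Re (mtrace (mpow A s * D)) \<le> Re (mtrace (mpow C s * D))" by (simp add: qtr_def BD)
  then show "0 \<le> Re (mtrace ((mpow C s - mpow A s) * D))"
    using psd_carrier[OF pA] psd_carrier[OF pC] psd_carrier[OF D]
    by (simp add: minus_mult_distrib_mat[where nr=N and n=N and nc=N] mtrace_minus[of _ N])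
qed

lemma Re_mtrace_minus_mult:
  assumes "A \<in> carrier_mat N N" "B \<in> carrier_mat N N" "C \<in> carrier_mat N N"
  shows "Re (mtrace ((A - B) * C)) = Re (mtrace (A * C)) - Re (mtrace (B * C))"
    "Re (mtrace (C * (A - B))) = Re (mtrace (C * A)) - Re (mtrace (C * B))"
  using assms by (auto simp: minus_mult_distrib_mat[where nr=N and n=N and nc=N]
      mult_minus_distrib_mat[where nr=N and n=N and nc=N] mtrace_minus[of _ N])

text \<open>Ozawa's proof of the inequality of Audenaert et al.: with \<open>C = B + (A - B)\<^sub>+ = A + (A - B)\<^sub>-\<close>,
  which dominates both \<open>A\<close> and \<open>B\<close>, operator monotonicity is applied three times.\<close>

lemma audenaert_inequality:
  assumes A: "psd N A" and B: "psd N B" and s: "0 < s" "s < 1"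
    and M: "psd N P" "psd N M" "A - B = P - M"
  shows "Re (mtrace A) - Re (mtrace P) \<le> qtr A B s"
proof -
  note cA = psd_carrier[OF A] and cB = psd_carrier[OF B] and cP = psd_carrier[OF M(1)] and cM = psd_carrier[OF M(2)]
  define C where "C = B + P"
  have C: "psd N C" unfolding C_def by (rule psd_add[OF B M(1)])
  note cC = psd_carrier[OF C]
  have CA: "C - A = M"
  proof (rule eq_matI)
    fix i j assume "i < dim_row M" "j < dim_col M"
    then have ij: "i < N" "j < N" using cM by auto
    have "(A - B) $$ (i,j) = (P - M) $$ (i,j)" by (simp add: M(3))
    then show "(C - A) $$ (i,j) = M $$ (i,j)" using ij cA cB cP cM by (simp add: C_def algebra_simps)
  qed (use cA cM in auto)
  have CB: "C - B = P" unfolding C_def using cB cP by (intro eq_matI) auto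
  define r where "r = 1 - s"
  have r: "0 < r" "r < 1" using s by (auto simp: r_def)
  have pw: "psd N (mpow X a)" "mpow X a \<in> carrier_mat N N" if "psd N X" for X a
    using psd_mpow[OF that] psd_carrier by auto
  have CAp: "psd N (C - A)" and CBp: "psd N (C - B)" unfolding CA CB by (rule M)+
  have one: "mpow X s * mpow X r = X" if "psd N X" for X
    using mpow_mult_mpow[OF that, of s r] mpow_one[OF that] by (simp add: r_def)
  \<comment> \<open>Adding the three inequalities cancels the mixed traces Tr A^s C^r and Tr C^s B^r
    and leaves 0 <= Tr C - Tr B - Tr A + Tr A^s B^r.\<close>
  have 1: "0 \<le> Re (mtrace (mpow A s * (mpow C r - mpow A r)))"
    using mtrace_psd_mult_nonneg[OF pw(1)[OF A] loewner_heinz[OF A C CAp r]] .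
  have 2: "0 \<le> Re (mtrace ((mpow C s - mpow A s) * (mpow C r - mpow B r)))"
    using mtrace_psd_mult_nonneg[OF loewner_heinz[OF A C CAp s] loewner_heinz[OF B C CBp r]] .
  have 3: "0 \<le> Re (mtrace ((mpow C s - mpow B s) * mpow B r))"
    using mtrace_psd_mult_nonneg[OF loewner_heinz[OF B C CBp s] pw(1)[OF B]] .
  have "Re (mtrace C) - Re (mtrace B) = Re (mtrace P)"
    unfolding C_def using cB cP by (simp add: mtrace_add[of _ N])
  then show ?thesis
    using 1 2 3 pw(2)[OF A] pw(2)[OF B] pw(2)[OF C]
    by (simp add: Re_mtrace_minus_mult[of _ N] one A B C qtr_def r_def[symmetric])
qed

text \<open>T projects onto the positive part of A - B, so the two error terms add up to Tr A - Tr
  P, which \<open>audenaert_inequality\<close> bounds. As a function of A - B, T commutes with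
  whatever commutes with A and B.\<close>

lemma neyman_pearson_test:
  assumes A: "psd N A" and B: "psd N B" and s: "0 < s" "s < 1"
  obtains T where "psd N T" "psd N (1\<^sub>m N - T)"
    "\<forall>M\<in>carrier_mat N N. M * A = A * M \<longrightarrow> M * B = B * M \<longrightarrow> M * T = T * M"
    "Re (mtrace (A * (1\<^sub>m N - T))) + Re (mtrace (B * T)) \<le> qtr A B s"
proof -
  note cA = psd_carrier[OF A] and cB = psd_carrier[OF B]
  have "mat_adjoint (A - B) = A - B"
    using mat_adjoint_minus[OF cA cB] psd_adjoint[OF A] psd_adjoint[OF B] by simp
  then obtain U h where U: "unitary N U" and H: "A - B = cdiag N U h"
    using hermitian_cdiagE[of "A - B" N] cB by auto
  define T where "T = cdiag N U (\<lambda>i. if h i > 0 then 1 else 0)"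
  define P where "P = cdiag N U (\<lambda>i. max (h i) 0)"
  define M where "M = cdiag N U (\<lambda>i. max (- h i) 0)"
  have T: "psd N T" unfolding T_def by (rule psd_cdiag[OF U]) simp
  have T': "psd N (1\<^sub>m N - T)"
    unfolding T_def cdiag_one[OF U, symmetric] cdiag_minus[OF U] by (rule psd_cdiag[OF U]) simp
  have P: "psd N P" unfolding P_def by (rule psd_cdiag[OF U]) simp
  have M: "psd N M" unfolding M_def by (rule psd_cdiag[OF U]) simp
  have "A - B = P - M" unfolding H P_def M_def cdiag_minus[OF U] by (rule cdiag_cong) (simp add: max_def)
  from audenaert_inequality[OF A B s P M this] have le: "Re (mtrace A) - Re (mtrace P) \<le> qtr A B s" .
  have "(A - B) * T = P" unfolding H P_def T_def cdiag_mult[OF U] by (rule cdiag_cong) (simp add: max_def)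
  then have "Re (mtrace P) = Re (mtrace (A * T)) - Re (mtrace (B * T))"
    using Re_mtrace_minus_mult(1)[OF cA cB psd_carrier[OF T]] by simp
  moreover have "Re (mtrace (A * (1\<^sub>m N - T))) = Re (mtrace A) - Re (mtrace (A * T))"
    using Re_mtrace_minus_mult(2)[of "1\<^sub>m N" N T A] cA psd_carrier[OF T] by simp
  ultimately have bound: "Re (mtrace (A * (1\<^sub>m N - T))) + Re (mtrace (B * T)) \<le> qtr A B s" using le by simp
  have comm: "K * T = T * K" if K: "K \<in> carrier_mat N N" "K * A = A * K" "K * B = B * K" for K
  proof -
    have "K * (A - B) = (A - B) * K"
      using K cA cB by (simp add: minus_mult_distrib_mat[where nr=N and n=N and nc=N]
          mult_minus_distrib_mat[where nr=N and n=N and nc=N])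
    then show ?thesis unfolding T_def H by (intro cdiag_commute[OF U K(1), of h "\<lambda>x. if x > 0 then 1 else 0"])
  qed
  show ?thesis by (rule that[OF T T' _ bound]) (use comm in blast)
qed


subsection \<open>Kronecker products\<close>

lemma sum_lessThan_mult:
  fixes f :: "nat \<Rightarrow> 'a::comm_monoid_add"
  shows "(\<Sum>i<a * b. f i) = (\<Sum>i<a. \<Sum>j<b. f (i * b + j))"
proof -
  have "(\<Sum>i<a * b. f i) = (\<Sum>i<a. sum f {i * b..<i * b + b})" by (simp add: sum.nat_group)
  also have "\<dots> = (\<Sum>i<a. \<Sum>j<b. f (i * b + j))"
    by (rule sum.cong[OF refl]) (simp add: sum.atLeastLessThan_shift_0[of f] lessThan_atLeast0 add.commute)
  finally show ?thesis .
qed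

lemma mult_add_less: "i * b + k < a * b" if "i < a" "k < b" for i k a b :: nat
proof -
  have "i * b + k < Suc i * b" using that by simp
  also have "\<dots> \<le> a * b" using that by (intro mult_le_mono1) simp
  finally show ?thesis .
qed

lemma kron_dims [simp]:
  "dim_row (kron A B) = dim_row A * dim_row B" "dim_col (kron A B) = dim_col A * dim_col B"
  by (simp_all add: kron_def)

lemma kron_carrier [simp]:
  "A \<in> carrier_mat a c \<Longrightarrow> B \<in> carrier_mat b d \<Longrightarrow> kron A B \<in> carrier_mat (a * b) (c * d)"
  by (intro carrier_matI) auto

lemma kron_index [simp]:
  assumes "i < dim_row A" "k < dim_row B" "j < dim_col A" "l < dim_col B"
  shows "kron A B $$ (i * dim_row B + k, j * dim_col B + l) = A $$ (i,j) * B $$ (k,l)"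
  using assms by (simp add: kron_def mult_add_less)

lemma kron_index_carrier:
  assumes "A \<in> carrier_mat a c" "B \<in> carrier_mat b d" "i < a" "k < b" "j < c" "l < d"
  shows "kron A B $$ (i * b + k, j * d + l) = A $$ (i,j) * B $$ (k,l)"
  using assms kron_index[of i A k B j l] by auto

lemma less_mult_split:
  fixes x a b :: nat
  assumes "x < a * b"
  obtains i k where "x = i * b + k" "i < a" "k < b"
proof -
  have "0 < b" using assms by (cases b) auto
  then show ?thesis using assms that[of "x div b" "x mod b"] by (simp add: less_mult_imp_div_less)
qed

text \<open>Entries are compared at split indices, which hides the \<open>div\<close> and
  \<open>mod\<close> in the definition of \<open>kron\<close>.\<close>

lemma eq_kronI:
  assumes "X \<in> carrier_mat (a * b) (c * d)" "Y \<in> carrier_mat (a * b) (c * d)"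
    "\<And>i k j l. i < a \<Longrightarrow> k < b \<Longrightarrow> j < c \<Longrightarrow> l < d \<Longrightarrow> X $$ (i * b + k, j * d + l) = Y $$ (i * b + k, j * d + l)"
  shows "X = Y"
proof (rule eq_matI)
  fix x y assume "x < dim_row Y" "y < dim_col Y"
  then have "x < a * b" "y < c * d" using assms(2) by auto
  then show "X $$ (x,y) = Y $$ (x,y)"
    using assms(3) by (elim less_mult_split) auto
qed (use assms in auto)

lemma kron_mult:
  assumes A: "A \<in> carrier_mat a b" "C \<in> carrier_mat b c" and B: "B \<in> carrier_mat a' b'" "D \<in> carrier_mat b' c'"
  shows "kron A B * kron C D = kron (A * C) (B * D)"
proof (rule eq_kronI[of _ a a' c c'])
  fix i k j l assume ij: "i < a" "k < a'" "j < c" "l < c'"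
  have "(kron A B * kron C D) $$ (i * a' + k, j * c' + l)
      = (\<Sum>x<b * b'. kron A B $$ (i * a' + k, x) * kron C D $$ (x, j * c' + l))"
    using assms ij by (intro index_mult_mat_sum[of _ "a * a'" "b * b'" _ "c * c'"]) (auto intro: mult_add_less)
  also have "\<dots> = (\<Sum>x<b. \<Sum>y<b'. (A $$ (i,x) * B $$ (k,y)) * (C $$ (x,j) * D $$ (y,l)))"
    unfolding sum_lessThan_mult using assms ij
    by (intro sum.cong refl) (simp add: kron_index_carrier[OF A(1) B(1)] kron_index_carrier[OF A(2) B(2)])
  also have "\<dots> = (\<Sum>x<b. A $$ (i,x) * C $$ (x,j)) * (\<Sum>y<b'. B $$ (k,y) * D $$ (y,l))"
    unfolding sum_product by (intro sum.cong refl) (simp add: ac_simps)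
  also have "\<dots> = kron (A * C) (B * D) $$ (i * a' + k, j * c' + l)"
    using assms ij
    by (subst kron_index_carrier[of _ a c _ a' c'])
      (simp_all add: index_mult_mat_sum[of _ a b _ c] index_mult_mat_sum[of _ a' b' _ c'] del: index_mult_mat(1))
  finally show "(kron A B * kron C D) $$ (i * a' + k, j * c' + l) = kron (A * C) (B * D) $$ (i * a' + k, j * c' + l)" .
qed (use assms in auto)

lemma kron_adjoint:
  "mat_adjoint (kron A B) = kron (mat_adjoint A) (mat_adjoint B)"
  by (rule eq_kronI[of _ "dim_col A" "dim_col B" "dim_row A" "dim_row B"])
    (auto simp: mult_add_less kron_index_carrier[of "mat_adjoint A" "dim_col A" "dim_row A" "mat_adjoint B" "dim_col B" "dim_row B"])

lemma kron_one: "kron (1\<^sub>m a) (1\<^sub>m b) = 1\<^sub>m (a * b)"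
proof (rule eq_kronI[of _ a b a b])
  fix i k j l assume ij: "i < a" "k < b" "j < a" "l < b"
  have "i * b + k = j * b + l \<longleftrightarrow> i = j \<and> k = l"
  proof
    assume e: "i * b + k = j * b + l"
    then have "(i * b + k) div b = (j * b + l) div b" "(i * b + k) mod b = (j * b + l) mod b" by auto
    then show "i = j \<and> k = l" using ij by simp
  qed simp
  then show "kron (1\<^sub>m a) (1\<^sub>m b) $$ (i * b + k, j * b + l) = 1\<^sub>m (a * b) $$ (i * b + k, j * b + l)"
    using ij by (simp add: kron_index_carrier[of _ a a _ b b] mult_add_less)
qed auto

lemma kron_diag:
  "kron (mat_diag a f) (mat_diag b g) = mat_diag (a * b) (\<lambda>i. f (i div b) * g (i mod b))"
proof (rule eq_kronI[of _ a b a b])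
  fix i k j l assume ij: "i < a" "k < b" "j < a" "l < b"
  have "i * b + k = j * b + l \<longleftrightarrow> i = j \<and> k = l"
  proof
    assume e: "i * b + k = j * b + l"
    then have "(i * b + k) div b = (j * b + l) div b" "(i * b + k) mod b = (j * b + l) mod b" by auto
    then show "i = j \<and> k = l" using ij by simp
  qed simp
  then show "kron (mat_diag a f) (mat_diag b g) $$ (i * b + k, j * b + l)
      = mat_diag (a * b) (\<lambda>i. f (i div b) * g (i mod b)) $$ (i * b + k, j * b + l)"
    using ij by (auto simp: kron_index_carrier[of _ a a _ b b] mult_add_less mat_diag_def)
qed auto

lemma kron_unitary:
  assumes "unitary a U" "unitary b V"
  shows "unitary (a * b) (kron U V)"
proof -
  note u = unitaryD[OF assms(1)] and v = unitaryD[OF assms(2)]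
  show ?thesis unfolding unitary_def kron_adjoint
    using u v kron_mult[of U a a "mat_adjoint U" a V b b "mat_adjoint V" b]
      kron_mult[of "mat_adjoint U" a a U a "mat_adjoint V" b b V b]
    by (simp add: kron_one)
qed

lemma kron_cdiag:
  assumes "unitary a U" "unitary b V"
  shows "kron (cdiag a U f) (cdiag b V g) = cdiag (a * b) (kron U V) (\<lambda>i. f (i div b) * g (i mod b))"
proof -
  note u = unitaryD[OF assms(1)] and v = unitaryD[OF assms(2)]
  let ?D = "\<lambda>n f. mat_diag n (\<lambda>i. complex_of_real (f i))"
  have "?D (a * b) (\<lambda>i. f (i div b) * g (i mod b)) = kron (?D a f) (?D b g)"
    by (simp add: kron_diag)
  then show ?thesis unfolding cdiag_def kron_adjoint
    using u v by (simp add: kron_mult[of _ a a _ a _ b b _ b])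
qed

lemma kron_eigenvalue_nonneg:
  fixes p q :: "nat \<Rightarrow> real"
  shows "\<forall>i. 0 \<le> p i \<Longrightarrow> \<forall>i. 0 \<le> q i \<Longrightarrow> 0 \<le> p (i div b) * q (i mod b)"
  by simp

lemma psd_kron:
  assumes "psd a A" "psd b B"
  shows "psd (a * b) (kron A B)"
proof -
  obtain U p where U: "unitary a U" "\<forall>i. 0 \<le> p i" "A = cdiag a U p" using psd_cdiagE[OF assms(1)] by blast
  obtain V q where V: "unitary b V" "\<forall>i. 0 \<le> q i" "B = cdiag b V q" using psd_cdiagE[OF assms(2)] by blast
  show ?thesis unfolding U(3) V(3) kron_cdiag[OF U(1) V(1)]
    by (rule psd_cdiag[OF kron_unitary[OF U(1) V(1)] kron_eigenvalue_nonneg[OF U(2) V(2)]])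
qed

lemma mpow_kron:
  assumes "psd a A" "psd b B"
  shows "mpow (kron A B) s = kron (mpow A s) (mpow B s)"
proof -
  obtain U p where U: "unitary a U" "\<forall>i. 0 \<le> p i" "A = cdiag a U p" using psd_cdiagE[OF assms(1)] by blast
  obtain V q where V: "unitary b V" "\<forall>i. 0 \<le> q i" "B = cdiag b V q" using psd_cdiagE[OF assms(2)] by blast
  show ?thesis unfolding U(3) V(3) kron_cdiag[OF U(1) V(1)]
      mpow_cdiag[OF U(1) U(2)[rule_format]] mpow_cdiag[OF V(1) V(2)[rule_format]]
      mpow_cdiag[OF kron_unitary[OF U(1) V(1)] kron_eigenvalue_nonneg[OF U(2) V(2)]]
    using U(2) V(2) by (simp add: powr_mult)
qed

lemma mtrace_kron:
  assumes "A \<in> carrier_mat a a" "B \<in> carrier_mat b b"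
  shows "mtrace (kron A B) = mtrace A * mtrace B"
proof -
  have "mtrace (kron A B) = (\<Sum>i<a. \<Sum>k<b. A $$ (i,i) * B $$ (k,k))"
    using assms by (simp add: mtrace_def sum_lessThan_mult kron_index_carrier[OF assms])
  then show ?thesis using assms by (simp add: mtrace_def sum_product)
qed

lemma kron_assoc: "kron (kron A B) C = kron A (kron B C)"
proof (rule eq_kronI[of _ "dim_row A * dim_row B" "dim_row C" "dim_col A * dim_col B" "dim_col C"])
  fix x l y n assume "x < dim_row A * dim_row B" and l: "l < dim_row C"
    and "y < dim_col A * dim_col B" and n: "n < dim_col C"
  then obtain i k j m where x: "x = i * dim_row B + k" "i < dim_row A" "k < dim_row B"
    and y: "y = j * dim_col B + m" "j < dim_col A" "m < dim_col B"
    by (metis less_mult_split)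
  have "kron (kron A B) C $$ (x * dim_row C + l, y * dim_col C + n) = A $$ (i,j) * B $$ (k,m) * C $$ (l,n)"
    using x y l n by (simp add: mult_add_less)
  moreover have "kron A (kron B C) $$ (i * dim_row (kron B C) + (k * dim_row C + l), j * dim_col (kron B C) + (m * dim_col C + n))
      = A $$ (i,j) * (B $$ (k,m) * C $$ (l,n))"
    using x y l n by (subst kron_index) (simp_all add: mult_add_less)
  moreover have "x * dim_row C + l = i * dim_row (kron B C) + (k * dim_row C + l)"
    "y * dim_col C + n = j * dim_col (kron B C) + (m * dim_col C + n)"
    using x y by (simp_all add: algebra_simps)
  ultimately show "kron (kron A B) C $$ (x * dim_row C + l, y * dim_col C + n)
      = kron A (kron B C) $$ (x * dim_row C + l, y * dim_col C + n)" by (simp only: mult.assoc)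
qed (auto intro!: carrier_matI)

lemma kron_one_right: "kron A (1\<^sub>m 1) = A"
  by (rule eq_matI) (auto simp: kron_def)

lemma mtrace_psd_mult_real:
  assumes "psd N A" "psd N B"
  shows "mtrace (A * B) = complex_of_real (Re (mtrace (A * B)))"
proof -
  obtain U p where U: "unitary N U" "\<forall>i. 0 \<le> p i" "A = cdiag N U p" using psd_cdiagE[OF assms(1)] by blast
  obtain V q where V: "unitary N V" "\<forall>i. 0 \<le> q i" "B = cdiag N V q" using psd_cdiagE[OF assms(2)] by blast
  show ?thesis unfolding U(3) V(3) mtrace_cdiag_mult[OF U(1) V(1)] Re_complex_of_real ..
qed

text \<open>Taking real parts is multiplicative here because a product of two positive matrices has
  a real trace.\<close>

lemma Re_mtrace_kron_mult:
  assumes "psd a A" "psd a C" "psd b B" "psd b D"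
  shows "Re (mtrace (kron A B * kron C D)) = Re (mtrace (A * C)) * Re (mtrace (B * D))"
proof -
  note c = assms[THEN psd_carrier]
  have "mtrace (kron A B * kron C D) = mtrace (A * C) * mtrace (B * D)"
    using c by (simp add: kron_mult[of _ a a _ a _ b b _ b] mtrace_kron[of _ a _ b])
  also have "\<dots> = complex_of_real (Re (mtrace (A * C)) * Re (mtrace (B * D)))"
    using mtrace_psd_mult_real[OF assms(1,2)] mtrace_psd_mult_real[OF assms(3,4)] by simp
  finally show ?thesis by simp
qed

lemma qtr_kron:
  assumes "psd a A" "psd a C" "psd b B" "psd b D"
  shows "qtr (kron A B) (kron C D) s = qtr A C s * qtr B D s"
  unfolding qtr_def mpow_kron[OF assms(1,3)] mpow_kron[OF assms(2,4)]
  by (rule Re_mtrace_kron_mult[OF psd_mpow[OF assms(1)] psd_mpow[OF assms(2)]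
        psd_mpow[OF assms(3)] psd_mpow[OF assms(4)]])

lemma psd_one: "psd n (1\<^sub>m n)"
  using psd_gram[of "1\<^sub>m n" n n] by simp

lemma dominated_kron:
  assumes "psd a A" "psd a C" "psd b B" "psd b D" "dominated A C" "dominated B D"
  shows "dominated (kron A B) (kron C D)"
proof -
  have "Re (mtrace (kron A B)) = Re (mtrace A) * Re (mtrace B)"
    using Re_mtrace_kron_mult[of a A "1\<^sub>m a" b B "1\<^sub>m b"] assms(1,3)[THEN psd_carrier] assms
    by (simp add: kron_one psd_one)
  then show ?thesis
    using assms(5,6) Re_mtrace_kron_mult[OF assms(1) psd_mpow[OF assms(2)] assms(3) psd_mpow[OF assms(4)]]
    by (simp add: dominated_def mpow_kron[OF assms(2,4)])
qed

text \<open>R is the partial trace of S weighted with B. It turns a trace over the product into one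
  over a single factor, where \<open>mtrace_E_mult\<close> can average that factor alone.\<close>

lemma partial_trace_left:
  assumes B: "B \<in> carrier_mat b b" and S: "S \<in> carrier_mat (a * b) (a * b)"
  obtains R where "R \<in> carrier_mat a a" "\<forall>E\<in>carrier_mat a a. mtrace (kron E B * S) = mtrace (E * R)"
proof
  define R where "R = mat a a (\<lambda>(j,i). \<Sum>k<b. \<Sum>l<b. B $$ (k,l) * S $$ (j * b + l, i * b + k))"
  show "R \<in> carrier_mat a a" by (simp add: R_def)
  show "\<forall>E\<in>carrier_mat a a. mtrace (kron E B * S) = mtrace (E * R)"
  proof
    fix E :: "complex mat" assume E: "E \<in> carrier_mat a a"
    have "mtrace (kron E B * S) = (\<Sum>i<a. \<Sum>k<b. \<Sum>j<a. \<Sum>l<b. (E $$ (i,j) * B $$ (k,l)) * S $$ (j * b + l, i * b + k))"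
      using E B S by (simp add: mtrace_mult_index[of _ "a * b"] sum_lessThan_mult kron_index_carrier[OF E B] del: index_mult_mat(1))
    also have "\<dots> = (\<Sum>i<a. \<Sum>j<a. \<Sum>k<b. \<Sum>l<b. (E $$ (i,j) * B $$ (k,l)) * S $$ (j * b + l, i * b + k))"
      by (intro sum.cong refl sum.swap)
    also have "\<dots> = (\<Sum>i<a. \<Sum>j<a. E $$ (i,j) * R $$ (j,i))"
      by (intro sum.cong refl) (simp add: R_def sum_distrib_left mult.assoc)
    also have "\<dots> = mtrace (E * R)" using E by (simp add: mtrace_mult_index[of _ a] R_def del: index_mult_mat(1))
    finally show "mtrace (kron E B * S) = mtrace (E * R)" .
  qed
qed

lemma partial_trace_right:
  assumes A: "A \<in> carrier_mat a a" and S: "S \<in> carrier_mat (a * b) (a * b)"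
  obtains R where "R \<in> carrier_mat b b" "\<forall>E\<in>carrier_mat b b. mtrace (kron A E * S) = mtrace (E * R)"
proof
  define R where "R = mat b b (\<lambda>(l,k). \<Sum>i<a. \<Sum>j<a. A $$ (i,j) * S $$ (j * b + l, i * b + k))"
  show "R \<in> carrier_mat b b" by (simp add: R_def)
  show "\<forall>E\<in>carrier_mat b b. mtrace (kron A E * S) = mtrace (E * R)"
  proof
    fix E :: "complex mat" assume E: "E \<in> carrier_mat b b"
    have "mtrace (kron A E * S) = (\<Sum>i<a. \<Sum>k<b. \<Sum>j<a. \<Sum>l<b. (A $$ (i,j) * E $$ (k,l)) * S $$ (j * b + l, i * b + k))"
      using E A S by (simp add: mtrace_mult_index[of _ "a * b"] sum_lessThan_mult kron_index_carrier[OF A E] del: index_mult_mat(1))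
    also have "\<dots> = (\<Sum>k<b. \<Sum>i<a. \<Sum>j<a. \<Sum>l<b. (A $$ (i,j) * E $$ (k,l)) * S $$ (j * b + l, i * b + k))"
      by (rule sum.swap)
    also have "\<dots> = (\<Sum>k<b. \<Sum>i<a. \<Sum>l<b. \<Sum>j<a. (A $$ (i,j) * E $$ (k,l)) * S $$ (j * b + l, i * b + k))"
      by (intro sum.cong refl sum.swap)
    also have "\<dots> = (\<Sum>k<b. \<Sum>l<b. \<Sum>i<a. \<Sum>j<a. (A $$ (i,j) * E $$ (k,l)) * S $$ (j * b + l, i * b + k))"
      by (intro sum.cong refl sum.swap)
    also have "\<dots> = (\<Sum>k<b. \<Sum>l<b. E $$ (k,l) * R $$ (l,k))"
      by (intro sum.cong refl) (simp add: R_def sum_distrib_left ac_simps)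
    also have "\<dots> = mtrace (E * R)" using E by (simp add: mtrace_mult_index[of _ b] R_def del: index_mult_mat(1))
    finally show "mtrace (kron A E * S) = mtrace (E * R)" .
  qed
qed

subsection \<open>Tensor powers\<close>

lemma tpow_carrier [simp]: "A \<in> carrier_mat d d \<Longrightarrow> tpow A n \<in> carrier_mat (d ^ n) (d ^ n)"
proof (induction n)
  case (Suc n)
  then show ?case using kron_carrier[of "tpow A n" "d ^ n" "d ^ n" A d d] by (simp add: mult.commute)
qed simp

lemma tpow_add: "tpow A (m + n) = kron (tpow A m) (tpow A n)"
  by (induction n) (simp_all add: kron_one_right[simplified] kron_assoc[symmetric])

lemma tpow_mult:
  assumes "A \<in> carrier_mat d d" "B \<in> carrier_mat d d"
  shows "tpow (A * B) n = tpow A n * tpow B n"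
proof (induction n)
  case (Suc n)
  then show ?case using assms
    by (simp add: kron_mult[of "tpow A n" "d ^ n" "d ^ n" "tpow B n" "d ^ n" A d d B d])
qed simp

lemma tpow_adjoint: "mat_adjoint (tpow A n) = tpow (mat_adjoint A) n"
  by (induction n) (simp_all add: kron_adjoint)

lemma tpow_unitary: "unitary d U \<Longrightarrow> unitary (d ^ n) (tpow U n)"
proof (induction n)
  case (Suc n)
  then show ?case using kron_unitary[of "d ^ n" "tpow U n" d U] by (simp add: mult.commute)
qed simp

lemma psd_tpow: "psd d A \<Longrightarrow> psd (d ^ n) (tpow A n)"
proof (induction n)
  case (Suc n)
  then show ?case using psd_kron[of "d ^ n" "tpow A n" d A] by (simp add: mult.commute)
qed (simp add: psd_one)

lemma mtrace_tpow: "A \<in> carrier_mat d d \<Longrightarrow> mtrace (tpow A n) = mtrace A ^ n"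
proof (induction n)
  case 0
  then show ?case by (simp add: mtrace_def)
next
  case (Suc n)
  then show ?case using mtrace_kron[of "tpow A n" "d ^ n" A d] by simp
qed

lemma dominated_one: "dominated (1\<^sub>m 1) (1\<^sub>m 1)"
proof -
  have "mpow (1\<^sub>m 1) 0 = 1\<^sub>m 1"
    using mpow_cdiag[of 1 "1\<^sub>m 1" "\<lambda>_. 1" 0] by (simp add: cdiag_one)
  then show ?thesis by (simp add: dominated_def)
qed

lemma qtr_tpow:
  assumes "psd d A" "psd d B"
  shows "qtr (tpow A n) (tpow B n) s = qtr A B s ^ n"
proof (induction n)
  case 0
  have "mpow (1\<^sub>m 1) s = 1\<^sub>m 1" for s
    using mpow_cdiag[of 1 "1\<^sub>m 1" "\<lambda>_. 1" s] by (simp add: cdiag_one)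
  then show ?case by (simp add: qtr_def mtrace_def)
next
  case (Suc n)
  then show ?case using qtr_kron[OF psd_tpow[OF assms(1)] psd_tpow[OF assms(2)] assms] by simp
qed

lemma dominated_tpow:
  assumes "psd d A" "psd d B" "dominated A B"
  shows "dominated (tpow A n) (tpow B n)"
proof (induction n)
  case (Suc n)
  then show ?case
    using dominated_kron[OF psd_tpow[OF assms(1)] psd_tpow[OF assms(2)] assms(1,2) _ assms(3)] by simp
qed (simp add: dominated_one[simplified])


subsection \<open>Group averages\<close>

lemma conj_invariant_mtrace:
  assumes V: "unitary N V" and X: "X \<in> carrier_mat N N" and S: "S \<in> carrier_mat N N" and VS: "V * S = S * V"
  shows "mtrace (V * X * mat_adjoint V * S) = mtrace (X * S)"
proof -
  note v = unitaryD[OF V]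
  have "mat_adjoint V * S * V = S"
  proof -
    have "mat_adjoint V * S * V = mat_adjoint V * (V * S)" unfolding VS using v S by (simp add: mult_mat_assoc_dim)
    then show ?thesis using unitary_cancel(2)[OF V S] by simp
  qed
  have "mtrace (V * X * mat_adjoint V * S) = mtrace (V * (X * (mat_adjoint V * S)))"
    using v X S by (simp add: mult_mat_assoc_dim)
  also have "\<dots> = mtrace ((X * (mat_adjoint V * S)) * V)"
    using v X S by (intro mtrace_mult_commute[of _ N N]) auto
  also have "(X * (mat_adjoint V * S)) * V = X * (mat_adjoint V * S * V)" using v X S by (simp add: mult_mat_assoc_dim)
  also have "\<dots> = X * S" by (simp only: \<open>mat_adjoint V * S * V = S\<close>)
  finally show ?thesis .
qed

locale compact_unitary_rep =
  fixes \<mu> :: "'g::{topological_group_add,t2_space} measure" and d :: nat and u :: "'g \<Rightarrow> complex mat"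
  assumes compact_UNIV: "compact (UNIV :: 'g set)"
    and haar: "haar_prob \<mu>"
    and rep: "unitary_rep d u"
begin

sublocale prob_space \<mu>
  using haar by (simp add: haar_prob_def)

lemma sets_eq: "sets \<mu> = sets borel"
  using haar by (simp add: haar_prob_def)

lemma continuous_integrable:
  fixes f :: "'g \<Rightarrow> complex"
  assumes "continuous_on UNIV f"
  shows "integrable \<mu> f"
proof -
  have "bounded (range f)" by (rule compact_imp_bounded[OF compact_continuous_image[OF assms compact_UNIV]])
  then obtain B where "\<And>x. norm (f x) \<le> B" unfolding bounded_iff by auto
  moreover have "f \<in> borel_measurable \<mu>"
    using borel_measurable_continuous_onI[OF assms] measurable_cong_sets[OF sets_eq refl] by blast
  ultimately show ?thesis by (intro integrable_const_bound[of _ B]) auto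
qed

lemma integral_left_translate:
  fixes f :: "'g \<Rightarrow> complex"
  assumes f: "continuous_on UNIV f"
  shows "(\<integral>g. f (h + g) \<partial>\<mu>) = (\<integral>g. f g \<partial>\<mu>)"
proof -
  have cont: "continuous_on UNIV (\<lambda>x. h + x)" by (intro continuous_intros)
  then have meas: "(\<lambda>x. h + x) \<in> measurable \<mu> \<mu>"
    using borel_measurable_continuous_onI[OF cont] measurable_cong_sets[OF sets_eq sets_eq] by blast
  have "distr \<mu> \<mu> (\<lambda>x. h + x) = \<mu>"
  proof (rule measure_eqI)
    fix A assume "A \<in> sets (distr \<mu> \<mu> ((+) h))"
    then have A: "A \<in> sets \<mu>" by simp
    have "emeasure (distr \<mu> \<mu> ((+) h)) A = emeasure \<mu> ((\<lambda>x. h + x) -` A \<inter> space \<mu>)"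
      by (rule emeasure_distr[OF meas A])
    also have "space \<mu> = UNIV" using sets_eq_imp_space_eq[OF sets_eq] by simp
    \<comment> \<open>Invariance in \<open>haar_prob\<close> is about images, a pushforward is about
      preimages; the preimage under translation by h is the image under translation by -h.\<close>
    also have "(\<lambda>x. h + x) -` A \<inter> UNIV = (\<lambda>x. - h + x) ` A"
    proof (intro Set.set_eqI iffI)
      fix x assume "x \<in> (\<lambda>x. h + x) -` A \<inter> UNIV"
      then show "x \<in> (\<lambda>x. - h + x) ` A" by (intro image_eqI[of _ _ "h + x"]) (auto simp: add.assoc[symmetric])
    qed (auto simp: add.assoc[symmetric])
    also have "emeasure \<mu> ((\<lambda>x. - h + x) ` A) = emeasure \<mu> A"
      using haar A sets_eq by (auto simp: haar_prob_def)
    finally show "emeasure (distr \<mu> \<mu> ((+) h)) A = emeasure \<mu> A" .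
  qed simp
  moreover have "integral\<^sup>L (distr \<mu> \<mu> (\<lambda>x. h + x)) f = (\<integral>g. f (h + g) \<partial>\<mu>)"
    using continuous_integrable[OF f] by (intro integral_distr[OF meas]) auto
  ultimately show ?thesis by simp
qed

definition U :: "nat \<Rightarrow> 'g \<Rightarrow> complex mat" where "U n g = tpow (u g) n"

lemma u_unitary: "unitary d (u g)" and u_add: "u (g + h) = u g * u h" and u_zero: "u 0 = 1\<^sub>m d"
  and u_cont: "i < d \<Longrightarrow> j < d \<Longrightarrow> continuous_on UNIV (\<lambda>g. u g $$ (i,j))"
  using rep by (auto simp: unitary_rep_def)

lemma u_adjoint: "mat_adjoint (u g) = u (- g)"
proof -
  note c = unitaryD[OF u_unitary[of g]] and c' = unitaryD[OF u_unitary[of "- g"]]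
  have "u (- g) * u g = 1\<^sub>m d" using u_add[of "- g" g] u_zero by simp
  then have "mat_adjoint (u g) = (u (- g) * u g) * mat_adjoint (u g)" using c by simp
  also have "\<dots> = u (- g) * (u g * mat_adjoint (u g))" using c c' by (simp add: mult_mat_assoc_dim)
  also have "\<dots> = u (- g)" using c c' by simp
  finally show ?thesis .
qed

lemma U_unitary: "unitary (d ^ n) (U n g)"
  unfolding U_def by (rule tpow_unitary[OF u_unitary])

lemma U_dims [simp]: "dim_row (U n g) = d ^ n" "dim_col (U n g) = d ^ n" "U n g \<in> carrier_mat (d ^ n) (d ^ n)"
  using unitaryD[OF U_unitary] by auto

lemma U_add: "U n (g + h) = U n g * U n h"
  unfolding U_def u_add by (rule tpow_mult[of _ d]) (use unitaryD[OF u_unitary] in auto)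

lemma U_adjoint: "mat_adjoint (U n g) = U n (- g)"
  by (simp add: U_def tpow_adjoint u_adjoint)

lemma U_plus: "U (m + n) g = kron (U m g) (U n g)"
  by (simp add: U_def tpow_add)

lemma U_cont: "i < d ^ n \<Longrightarrow> j < d ^ n \<Longrightarrow> continuous_on UNIV (\<lambda>g. U n g $$ (i,j))"
proof (induction n arbitrary: i j)
  case 0
  then show ?case by (simp add: U_def)
next
  case (Suc n)
  have "i < d ^ n * d" "j < d ^ n * d" using Suc.prems by (auto simp: mult.commute)
  then obtain a b a' b' where i: "i = a * d + b" "a < d ^ n" "b < d" and j: "j = a' * d + b'" "a' < d ^ n" "b' < d"
    by (metis less_mult_split)
  have "U (Suc n) g $$ (i,j) = U n g $$ (a,a') * u g $$ (b,b')" for g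
    using unitaryD[OF u_unitary[of g]] i j unfolding i(1) j(1)
    by (simp add: U_def kron_index_carrier[of "tpow (u g) n" "d ^ n" "d ^ n" "u g" d d])
  then show ?case using Suc.IH i j u_cont by (auto intro!: continuous_intros)
qed

definition E :: "nat \<Rightarrow> complex mat \<Rightarrow> complex mat" where "E n X = twirl d \<mu> u n X"

lemma E_carrier [simp]: "E n X \<in> carrier_mat (d ^ n) (d ^ n)"
  by (simp add: E_def twirl_def)

lemma E_dims [simp]: "dim_row (E n X) = d ^ n" "dim_col (E n X) = d ^ n"
  by (simp_all add: E_def twirl_def)

lemma conj_index:
  assumes "X \<in> carrier_mat (d ^ n) (d ^ n)" "i < d ^ n" "j < d ^ n"
  shows "(U n g * X * mat_adjoint (U n g)) $$ (i,j)
    = (\<Sum>l<d ^ n. (\<Sum>k<d ^ n. U n g $$ (i,k) * X $$ (k,l)) * cnj (U n g $$ (j,l)))"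
  using assms by (simp add: index_mult_mat_sum[of _ "d ^ n" "d ^ n" _ "d ^ n"] del: index_mult_mat(1))

lemma conj_cont:
  assumes "X \<in> carrier_mat (d ^ n) (d ^ n)" "i < d ^ n" "j < d ^ n"
  shows "continuous_on UNIV (\<lambda>g. (U n g * X * mat_adjoint (U n g)) $$ (i,j))"
  unfolding conj_index[OF assms] using assms by (auto intro!: continuous_intros U_cont)

lemma E_index:
  "i < d ^ n \<Longrightarrow> j < d ^ n \<Longrightarrow> E n X $$ (i,j) = (\<integral>g. (U n g * X * mat_adjoint (U n g)) $$ (i,j) \<partial>\<mu>)"
  by (simp add: E_def twirl_def U_def)

lemma mtrace_E_mult:
  assumes X: "X \<in> carrier_mat (d ^ n) (d ^ n)" and R: "R \<in> carrier_mat (d ^ n) (d ^ n)"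
  shows "mtrace (E n X * R) = (\<integral>g. mtrace (U n g * X * mat_adjoint (U n g) * R) \<partial>\<mu>)"
    and "integrable \<mu> (\<lambda>g. mtrace (U n g * X * mat_adjoint (U n g) * R))"
proof -
  let ?N = "d ^ n"
  have int: "integrable \<mu> (\<lambda>g. (U n g * X * mat_adjoint (U n g)) $$ (i,k) * R $$ (k,i))" if "i < ?N" "k < ?N" for i k
    using continuous_integrable[OF conj_cont[OF X that]] by simp
  have e: "mtrace (U n g * X * mat_adjoint (U n g) * R)
      = (\<Sum>i<?N. \<Sum>k<?N. (U n g * X * mat_adjoint (U n g)) $$ (i,k) * R $$ (k,i))" for g
    using X R by (simp add: mtrace_mult_index[of _ ?N] del: index_mult_mat(1))
  show "integrable \<mu> (\<lambda>g. mtrace (U n g * X * mat_adjoint (U n g) * R))"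
    unfolding e by (intro Bochner_Integration.integrable_sum int) auto
  have "mtrace (E n X * R) = (\<Sum>i<?N. \<Sum>k<?N. (\<integral>g. (U n g * X * mat_adjoint (U n g)) $$ (i,k) \<partial>\<mu>) * R $$ (k,i))"
    using R by (simp add: mtrace_mult_index[of _ ?N] E_index del: index_mult_mat(1))
  also have "\<dots> = (\<Sum>i<?N. \<Sum>k<?N. (\<integral>g. (U n g * X * mat_adjoint (U n g)) $$ (i,k) * R $$ (k,i) \<partial>\<mu>))"
    by (intro sum.cong refl) (simp del: index_mult_mat(1))
  also have "\<dots> = (\<Sum>i<?N. (\<integral>g. (\<Sum>k<?N. (U n g * X * mat_adjoint (U n g)) $$ (i,k) * R $$ (k,i)) \<partial>\<mu>))"
    by (intro sum.cong refl Bochner_Integration.integral_sum[symmetric] int) auto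
  also have "\<dots> = (\<integral>g. (\<Sum>i<?N. \<Sum>k<?N. (U n g * X * mat_adjoint (U n g)) $$ (i,k) * R $$ (k,i)) \<partial>\<mu>)"
    by (intro Bochner_Integration.integral_sum[symmetric] Bochner_Integration.integrable_sum int) auto
  finally show "mtrace (E n X * R) = (\<integral>g. mtrace (U n g * X * mat_adjoint (U n g) * R) \<partial>\<mu>)" unfolding e .
qed

lemma mtrace_E_commutant:
  assumes X: "X \<in> carrier_mat (d ^ n) (d ^ n)" and S: "S \<in> carrier_mat (d ^ n) (d ^ n)"
    and comm: "\<And>g. U n g * S = S * U n g"
  shows "mtrace (E n X * S) = mtrace (X * S)"
  unfolding mtrace_E_mult(1)[OF X S] conj_invariant_mtrace[OF U_unitary X S comm] by (simp add: prob_space)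

text \<open>Conjugation by the group element h shifts the integration variable from g to h + g, and
  left invariance removes the shift. The computation is entrywise because \<open>twirl\<close>
  integrates each entry separately.\<close>

lemma E_commute:
  assumes X: "X \<in> carrier_mat (d ^ n) (d ^ n)"
  shows "U n h * E n X = E n X * U n h"
proof -
  let ?N = "d ^ n"
  let ?F = "\<lambda>g. U n g * X * mat_adjoint (U n g)"
  note v = unitaryD[OF U_unitary[of n h]]
  have F: "?F g \<in> carrier_mat ?N ?N" for g using X by simp
  have shift: "?F (h + g) = U n h * ?F g * mat_adjoint (U n h)" for g
    using X by (simp add: U_add mat_adjoint_mult mult_mat_assoc_dim)
  have entry: "(U n h * Y * mat_adjoint (U n h)) $$ (i,j)
      = (\<Sum>l<?N. \<Sum>k<?N. U n h $$ (i,k) * cnj (U n h $$ (j,l)) * Y $$ (k,l))"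
    if "Y \<in> carrier_mat ?N ?N" "i < ?N" "j < ?N" for Y i j
    unfolding conj_index[OF that] by (simp add: sum_distrib_right sum_distrib_left ac_simps)
  have "U n h * E n X * mat_adjoint (U n h) = E n X"
  proof (rule eq_matI)
    fix i j assume "i < dim_row (E n X)" "j < dim_col (E n X)"
    then have ij: "i < ?N" "j < ?N" using E_carrier[of n X] by auto
    have int: "integrable \<mu> (\<lambda>g. c * ?F g $$ (k,l))" if "k < ?N" "l < ?N" for c k l
      using continuous_integrable[OF conj_cont[OF X that]] by simp
    have "(U n h * E n X * mat_adjoint (U n h)) $$ (i,j)
        = (\<Sum>l<?N. \<Sum>k<?N. \<integral>g. U n h $$ (i,k) * cnj (U n h $$ (j,l)) * ?F g $$ (k,l) \<partial>\<mu>)"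
      unfolding entry[OF E_carrier ij] by (intro sum.cong refl) (simp add: E_index del: index_mult_mat(1))
    also have "\<dots> = (\<Sum>l<?N. \<integral>g. (\<Sum>k<?N. U n h $$ (i,k) * cnj (U n h $$ (j,l)) * ?F g $$ (k,l)) \<partial>\<mu>)"
      by (intro sum.cong refl Bochner_Integration.integral_sum[symmetric] int) auto
    also have "\<dots> = (\<integral>g. (\<Sum>l<?N. \<Sum>k<?N. U n h $$ (i,k) * cnj (U n h $$ (j,l)) * ?F g $$ (k,l)) \<partial>\<mu>)"
      by (intro Bochner_Integration.integral_sum[symmetric] Bochner_Integration.integrable_sum int) auto
    also have "\<dots> = (\<integral>g. ?F (h + g) $$ (i,j) \<partial>\<mu>)"
      unfolding shift entry[OF F ij] ..
    also have "\<dots> = E n X $$ (i,j)"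
      unfolding E_index[OF ij] by (rule integral_left_translate[OF conj_cont[OF X ij]])
    finally show "(U n h * E n X * mat_adjoint (U n h)) $$ (i,j) = E n X $$ (i,j)" .
  qed (use E_carrier[of n X] in auto)
  then have "E n X * U n h = (U n h * E n X * mat_adjoint (U n h)) * U n h" by simp
  also have "\<dots> = U n h * (E n X * (mat_adjoint (U n h) * U n h))"
    using E_carrier[of n X] v(1-3) by (simp add: mult_mat_assoc_dim)
  also have "\<dots> = U n h * E n X" using v E_carrier[of n X] by simp
  finally show ?thesis by simp
qed

lemma mtrace_E: "X \<in> carrier_mat (d ^ n) (d ^ n) \<Longrightarrow> mtrace (E n X) = mtrace X"
  using mtrace_E_commutant[of X n "1\<^sub>m (d ^ n)"] right_mult_one_mat[OF E_carrier, of n X]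
  by simp

text \<open>Tested against B >= 0, the average becomes an integral of nonnegative numbers, one for
  each conjugate of X.\<close>

lemma psd_E:
  assumes X: "psd (d ^ n) X"
  shows "psd (d ^ n) (E n X)"
proof (rule psdI_mtrace)
  let ?N = "d ^ n"
  note c = psd_carrier[OF X]
  have pc: "psd ?N (U n g * X * mat_adjoint (U n g))" for g
  proof -
    obtain V p where V: "unitary ?N V" "\<forall>i. 0 \<le> p i" "X = cdiag ?N V p" using psd_cdiagE[OF X] by blast
    have "U n g * X * mat_adjoint (U n g) = cdiag ?N (U n g * V) p"
      unfolding V(3) cdiag_def using unitaryD[OF V(1)] by (simp add: mat_adjoint_mult mult_mat_assoc_dim)
    then show ?thesis using psd_cdiag[OF unitary_mult[OF U_unitary V(1)]] V(2) by simp
  qed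
  show "E n X \<in> carrier_mat ?N ?N" by simp
  show "mat_adjoint (E n X) = E n X"
  proof (rule eq_matI)
    fix i j assume "i < dim_row (E n X)" "j < dim_col (E n X)"
    then have ij: "i < ?N" "j < ?N" using E_carrier[of n X] by auto
    have "mat_adjoint (E n X) $$ (i,j) = cnj (E n X $$ (j,i))" using ij E_carrier[of n X] by simp
    also have "\<dots> = (\<integral>g. cnj ((U n g * X * mat_adjoint (U n g)) $$ (j,i)) \<partial>\<mu>)"
      unfolding E_index[OF ij(2,1)] 
      by (rule integral_bounded_linear[OF bounded_linear_cnj continuous_integrable[OF conj_cont[OF c ij(2,1)]], symmetric])
    also have "(\<lambda>g. cnj ((U n g * X * mat_adjoint (U n g)) $$ (j,i))) = (\<lambda>g. (U n g * X * mat_adjoint (U n g)) $$ (i,j))"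
    proof
      fix g
      show "cnj ((U n g * X * mat_adjoint (U n g)) $$ (j,i)) = (U n g * X * mat_adjoint (U n g)) $$ (i,j)"
        using mat_adjoint_index[of i "U n g * X * mat_adjoint (U n g)" j] ij psd_adjoint[OF pc[of g]]
        by (simp del: index_mult_mat(1) mat_adjoint_index)
    qed
    also have "(\<integral>g. (U n g * X * mat_adjoint (U n g)) $$ (i,j) \<partial>\<mu>) = E n X $$ (i,j)" by (rule E_index[OF ij, symmetric])
    finally show "mat_adjoint (E n X) $$ (i,j) = E n X $$ (i,j)" .
  qed (use E_carrier[of n X] in auto)
  fix B assume B: "psd ?N B"
  have "Re (mtrace (E n X * B)) = (\<integral>g. Re (mtrace (U n g * X * mat_adjoint (U n g) * B)) \<partial>\<mu>)"
    using mtrace_E_mult[OF c psd_carrier[OF B]] by simp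
  also have "\<dots> \<ge> 0" by (intro integral_nonneg_AE AE_I2 mtrace_psd_mult_nonneg[OF pc B])
  finally show "0 \<le> Re (mtrace (E n X * B))" .
qed

text \<open>The factors are averaged one at a time, the group element of the other factor being 0.
  Commutation of S with independent pairs g, h makes each of these steps possible.\<close>

lemma mtrace_kron_E:
  assumes X: "X \<in> carrier_mat (d ^ m) (d ^ m)" and Y: "Y \<in> carrier_mat (d ^ n) (d ^ n)"
    and S: "S \<in> carrier_mat (d ^ m * d ^ n) (d ^ m * d ^ n)"
    and comm: "\<And>g h. kron (U m g) (U n h) * S = S * kron (U m g) (U n h)"
  shows "mtrace (kron (E m X) (E n Y) * S) = mtrace (kron X Y * S)"
proof -
  have U0: "U n 0 = 1\<^sub>m (d ^ n)" for n
  proof -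
    have "U n 0 = U n 0 * (U n 0 * mat_adjoint (U n 0))" using unitaryD[OF U_unitary[of n 0]] by simp
    also have "\<dots> = U n (0 + 0) * mat_adjoint (U n 0)" unfolding U_add by (simp add: mult_mat_assoc_dim)
    also have "\<dots> = 1\<^sub>m (d ^ n)" using unitaryD[OF U_unitary[of n 0]] by simp
    finally show ?thesis .
  qed
  note kc = kron_mult[where a="d ^ m" and b="d ^ m" and c="d ^ m" and a'="d ^ n" and b'="d ^ n" and c'="d ^ n"]
  have ku: "unitary (d ^ m * d ^ n) (kron (U m g) (U n h))" for g h by (rule kron_unitary[OF U_unitary U_unitary])
  have left: "mtrace (kron (E m X) Z * S) = mtrace (kron X Z * S)" if Z: "Z \<in> carrier_mat (d ^ n) (d ^ n)" for Z
  proof -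
    obtain R where R: "R \<in> carrier_mat (d ^ m) (d ^ m)"
      "\<forall>E\<in>carrier_mat (d ^ m) (d ^ m). mtrace (kron E Z * S) = mtrace (E * R)"
      using partial_trace_left[OF Z S] by blast
    have "mtrace (U m g * X * mat_adjoint (U m g) * R) = mtrace (X * R)" for g
    proof -
      have "mtrace (U m g * X * mat_adjoint (U m g) * R) = mtrace (kron (U m g * X * mat_adjoint (U m g)) Z * S)"
        using R(2) X by simp
      also have "kron (U m g * X * mat_adjoint (U m g)) Z = kron (U m g) (U n 0) * kron X Z * mat_adjoint (kron (U m g) (U n 0))"
        using X Z by (simp add: kron_adjoint kc U0)
      also have "mtrace (\<dots> * S) = mtrace (kron X Z * S)"
        using X Z by (intro conj_invariant_mtrace[OF ku _ S comm]) simp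
      finally show ?thesis using R(2) X by simp
    qed
    then show ?thesis using R X mtrace_E_mult(1)[OF X R(1)] by (simp add: prob_space)
  qed
  have right: "mtrace (kron X (E n Y) * S) = mtrace (kron X Y * S)"
  proof -
    obtain R where R: "R \<in> carrier_mat (d ^ n) (d ^ n)"
      "\<forall>E\<in>carrier_mat (d ^ n) (d ^ n). mtrace (kron X E * S) = mtrace (E * R)"
      using partial_trace_right[OF X S] by blast
    have "mtrace (U n g * Y * mat_adjoint (U n g) * R) = mtrace (Y * R)" for g
    proof -
      have "mtrace (U n g * Y * mat_adjoint (U n g) * R) = mtrace (kron X (U n g * Y * mat_adjoint (U n g)) * S)"
        using R(2) Y by simp
      also have "kron X (U n g * Y * mat_adjoint (U n g)) = kron (U m 0) (U n g) * kron X Y * mat_adjoint (kron (U m 0) (U n g))"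
        using X Y by (simp add: kron_adjoint kc U0)
      also have "mtrace (\<dots> * S) = mtrace (kron X Y * S)"
        using X Y by (intro conj_invariant_mtrace[OF ku _ S comm]) simp
      finally show ?thesis using R(2) Y by simp
    qed
    then show ?thesis using R Y mtrace_E_mult(1)[OF Y R(1)] by (simp add: prob_space)
  qed
  show ?thesis using left[OF E_carrier] right by simp
qed

text \<open>\<open>\<A>\<^sub>m \<otimes> \<A>\<^sub>n \<subseteq> \<A>\<^sub>m\<^sub>+\<^sub>n\<close>, so the product of two averages is a coarse graining of the joint average.\<close>

lemma parsum_E_add:
  assumes r: "psd d r" "psd d r'" and t: "0 < t"
  shows "parsum (d ^ (m + n)) t (E (m + n) (tpow r (m + n))) (E (m + n) (tpow r' (m + n)))
    \<le> parsum (d ^ (m + n)) t (kron (E m (tpow r m)) (E n (tpow r n))) (kron (E m (tpow r' m)) (E n (tpow r' n)))"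
proof -
  let ?V = "{kron (U m g) (U n h) |g h. True}"
  have N: "d ^ (m + n) = d ^ m * d ^ n" by (rule power_add)
  have p: "psd (d ^ (m + n)) (E (m + n) (tpow x (m + n)))"
    "psd (d ^ (m + n)) (kron (E m (tpow x m)) (E n (tpow x n)))" if "psd d x" for x
    using psd_E[OF psd_tpow[OF that]] psd_kron[OF psd_E[OF psd_tpow[OF that]] psd_E[OF psd_tpow[OF that]]]
    by (simp_all only: N) (simp only: N[symmetric])
  have c: "tpow x k \<in> carrier_mat (d ^ k) (d ^ k)" if "psd d x" for x k
    using psd_carrier[OF that] by simp
  have comm: "kron (U m g) (U n h) * kron (E m (tpow x m)) (E n (tpow x n))
      = kron (E m (tpow x m)) (E n (tpow x n)) * kron (U m g) (U n h)" if "psd d x" for x g h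
    using kron_mult[OF U_dims(3) E_carrier U_dims(3) E_carrier] kron_mult[OF E_carrier U_dims(3) E_carrier U_dims(3)]
      E_commute[OF c[OF that]] by simp
  have tr: "mtrace (kron (E m (tpow x m)) (E n (tpow x n)) * S) = mtrace (E (m + n) (tpow x (m + n)) * S)"
    if x: "psd d x" and S: "S \<in> carrier_mat (d ^ (m + n)) (d ^ (m + n))"
      and SV: "\<And>M. M \<in> ?V \<Longrightarrow> M * S = S * M" for x S
  proof -
    have SV': "kron (U m g) (U n h) * S = S * kron (U m g) (U n h)" for g h by (rule SV) blast
    have "mtrace (kron (E m (tpow x m)) (E n (tpow x n)) * S) = mtrace (kron (tpow x m) (tpow x n) * S)"
      by (rule mtrace_kron_E[OF c[OF x] c[OF x] S[unfolded N] SV'])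
    also have "\<dots> = mtrace (E (m + n) (tpow x (m + n)) * S)"
      unfolding tpow_add[symmetric]
      by (rule mtrace_E_commutant[OF c[OF x] S, symmetric]) (simp add: U_plus SV')
    finally show ?thesis .
  qed
  show ?thesis
  proof (rule parsum_coarse_graining[where \<V>="?V", OF p(1)[OF r(1)] p(1)[OF r(2)] p(2)[OF r(1)] p(2)[OF r(2)] t])
    show "?V \<subseteq> carrier_mat (d ^ (m + n)) (d ^ (m + n))" unfolding N by auto
    show "mat_adjoint M \<in> ?V" if "M \<in> ?V" for M using that by (force simp: kron_adjoint U_adjoint)
  qed (use comm r tr in auto)
qed

text \<open>Compares the averages with the original tensor powers, where \<open>qtr\<close> is
  multiplicative and domination is inherited from the single copy. Domination of the averages and a
  linear bound on psi_n follow.\<close>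

lemma parsum_tpow_le_E:
  assumes r: "psd d r" "psd d r'" and t: "0 < t"
  shows "parsum (d ^ n) t (tpow r n) (tpow r' n) \<le> parsum (d ^ n) t (E n (tpow r n)) (E n (tpow r' n))"
proof -
  have c: "tpow x k \<in> carrier_mat (d ^ k) (d ^ k)" if "psd d x" for x k
    using psd_carrier[OF that] by simp
  show ?thesis
  proof (rule parsum_coarse_graining[where \<V>="range (U n)",
        OF psd_tpow[OF r(1)] psd_tpow[OF r(2)] psd_E[OF psd_tpow[OF r(1)]] psd_E[OF psd_tpow[OF r(2)]] t])
    show "mat_adjoint M \<in> range (U n)" if "M \<in> range (U n)" for M using that by (auto simp: U_adjoint)
  qed (use E_commute[OF c] mtrace_E_commutant[OF c] r in auto)
qed

end


subsection \<open>Subadditive sequences and convex functions\<close>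

text \<open>Fekete's argument: fix k whose quotient is close to the infimum L and divide n by k with
  remainder; the remainder costs a bounded amount, which vanishes after division by n.\<close>

lemma subadditive_convergent:
  fixes a :: "nat \<Rightarrow> real"
  assumes sub: "\<And>m n. a (m + n) \<le> a m + a n" and bound: "\<And>n. - (C * real n) \<le> a n"
  shows "convergent (\<lambda>n. a n / real n)"
proof -
  let ?S = "(\<lambda>n. a n / real n) ` {1..}"
  define L where "L = Inf ?S"
  have bdd: "bdd_below ?S"
  proof (rule bdd_belowI[of _ "- C"])
    fix x assume "x \<in> ?S"
    then obtain n where n: "1 \<le> n" "x = a n / real n" by auto
    then show "- C \<le> x" using bound[of n] by (simp add: le_divide_eq)
  qed
  have lower: "L \<le> a n / real n" if "1 \<le> n" for n
    unfolding L_def by (rule cInf_lower[OF _ bdd]) (use that in auto)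
  have mult: "a (q * k + r) \<le> real q * a k + a r" for q k r
  proof (induction q)
    case (Suc q)
    have "a (Suc q * k + r) \<le> a k + a (q * k + r)" using sub[of k "q * k + r"] by (simp add: add.assoc)
    then show ?case using Suc by (simp add: algebra_simps)
  qed simp
  have "(\<lambda>n. a n / real n) \<longlonglongrightarrow> L"
  proof (rule order_tendstoI)
    fix l assume "l < L"
    then show "\<forall>\<^sub>F n in sequentially. l < a n / real n"
      using lower by (intro eventually_sequentiallyI[of 1]) (meson less_le_trans)
  next
    fix v assume v: "L < v"
    then obtain k where k: "1 \<le> k" "a k / real k < v"
      using cInf_lessD[of ?S v] by (auto simp: L_def)
    \<comment> \<open>Bounds the value at any remainder r < k together with the correction r a(k) /
      k from replacing \<open>n div k\<close> by n / k.\<close>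
    define M where "M = (\<Sum>r<k. \<bar>a r\<bar>) + \<bar>a k\<bar>"
    have upper: "a n / real n \<le> a k / real k + M / real n" if n: "1 \<le> n" for n
    proof -
      let ?q = "n div k" and ?r = "n mod k"
      have r: "?r < k" using k by simp
      have "a n \<le> real ?q * a k + a ?r" using mult[of ?q k ?r] by simp
      also have "real ?q * a k = (real n - real ?r) * (a k / real k)"
      proof -
        have "real n = real ?q * real k + real ?r" by (metis div_mult_mod_eq of_nat_add of_nat_mult)
        then show ?thesis using k by simp
      qed
      also have "\<dots> = real n * (a k / real k) - real ?r * (a k / real k)" by (rule left_diff_distrib)
      also have "- (real ?r * (a k / real k)) \<le> \<bar>a k\<bar>"
      proof -
        have "- (real ?r * (a k / real k)) \<le> \<bar>real ?r * (a k / real k)\<bar>" by (rule abs_ge_minus_self)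
        also have "\<dots> = real ?r / real k * \<bar>a k\<bar>" by (simp add: abs_mult)
        also have "\<dots> \<le> 1 * \<bar>a k\<bar>" using r k by (intro mult_right_mono) auto
        finally show ?thesis by simp
      qed
      then have "real n * (a k / real k) - real ?r * (a k / real k) + a ?r \<le> real n * (a k / real k) + M"
        using member_le_sum[of ?r "{..<k}" "\<lambda>r. \<bar>a r\<bar>"] r by (simp add: M_def)
      finally have "a n \<le> real n * (a k / real k) + M" by simp
      then show ?thesis using n by (simp add: field_simps)
    qed
    have "(\<lambda>n. a k / real k + M / real n) \<longlonglongrightarrow> a k / real k + 0"
      by (intro tendsto_intros lim_const_over_n)
    then have "\<forall>\<^sub>F n in sequentially. a k / real k + M / real n < v" using k by (intro order_tendstoD(2)) auto
    then show "\<forall>\<^sub>F n in sequentially. a n / real n < v"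
      using eventually_ge_at_top[of 1] by eventually_elim (use upper in fastforce)
  qed
  then show ?thesis by (auto simp: convergent_def)
qed

text \<open>The point x may lie left of, between or right of y and z: the outer cases make slopes
  monotone on one side of x, the middle case bounds the slopes on one side by those on the
  other.\<close>

lemma convex_on_slope_mono:
  fixes f :: "real \<Rightarrow> real"
  assumes f: "convex_on I f" and I: "x \<in> I" "y \<in> I" "z \<in> I" and "y < z" "y \<noteq> x" "z \<noteq> x"
  shows "(f y - f x) / (y - x) \<le> (f z - f x) / (z - x)"
proof -
  have sw: "(f p - f q) / (p - q) = (f q - f p) / (q - p)" for p q
    by (metis minus_diff_eq minus_divide_divide)
  consider "x < y" | "y < x" "x < z" | "z < x" using assms by linarith
  then show ?thesis
  proof cases
    case 1
    then show ?thesis using convex_on_slope_le(1)[OF f I(1,3) 1 \<open>y < z\<close>] sw by metis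
  next
    case 2
    then show ?thesis
      using convex_on_slope_le[OF f I(2,3) 2] sw by (metis order_trans)
  next
    case 3
    then show ?thesis using convex_on_slope_le(2)[OF f I(2,1) \<open>y < z\<close> 3] by simp
  qed
qed

text \<open>Slopes decrease as y falls to x and are bounded below by any slope taken from the left,
  so their infimum is their limit.\<close>

lemma convex_on_right_derivative:
  fixes f :: "real \<Rightarrow> real"
  assumes f: "convex_on {a<..<b} f" and x: "a < x" "x < b"
  shows "\<exists>D. (f has_real_derivative D) (at x within {x..})"
proof -
  let ?g = "\<lambda>y. (f y - f x) / (y - x)"
  define D where "D = Inf (?g ` {x<..<b})"
  obtain w where w: "a < w" "w < x" using dense[OF x(1)] by auto
  have bdd: "bdd_below (?g ` {x<..<b})"
    using convex_on_slope_mono[OF f, of x w] w x by (intro bdd_belowI[of _ "?g w"]) auto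
  have ne: "?g ` {x<..<b} \<noteq> {}" using x by simp
  have "(?g \<longlongrightarrow> D) (at_right x)"
  proof (rule order_tendstoI)
    fix l assume l: "l < D"
    have "l < ?g y" if "y \<in> {x<..<b}" for y
      using cInf_lower[OF _ bdd, of "?g y"] that l by (auto simp: D_def)
    then show "\<forall>\<^sub>F y in at_right x. l < ?g y" unfolding eventually_at_right_field using x by auto
  next
    fix v assume "D < v"
    then obtain z where z: "z \<in> {x<..<b}" "?g z < v" using cInf_lessD[OF ne] unfolding D_def by blast
    have "?g y < v" if "x < y" "y < z" for y
      using convex_on_slope_mono[OF f, of x y z] that z x by (auto intro: le_less_trans)
    then show "\<forall>\<^sub>F y in at_right x. ?g y < v" unfolding eventually_at_right_field using z by auto
  qed
  then show ?thesis unfolding has_field_derivative_iff at_within_Ici_at_right by blast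
qed

lemma convex_on_left_derivative:
  fixes f :: "real \<Rightarrow> real"
  assumes f: "convex_on {a<..<b} f" and x: "a < x" "x < b"
  shows "\<exists>D. (f has_real_derivative D) (at x within {..x})"
proof -
  let ?g = "\<lambda>y. (f y - f x) / (y - x)"
  define D where "D = Sup (?g ` {a<..<x})"
  obtain w where w: "x < w" "w < b" using dense[OF x(2)] by auto
  have bdd: "bdd_above (?g ` {a<..<x})"
    using convex_on_slope_mono[OF f, of x _ w] w x by (intro bdd_aboveI[of _ "?g w"]) auto
  have ne: "?g ` {a<..<x} \<noteq> {}" using x by simp
  have "(?g \<longlongrightarrow> D) (at_left x)"
  proof (rule order_tendstoI)
    fix v assume v: "D < v"
    have "?g y < v" if "y \<in> {a<..<x}" for y
      using cSup_upper[OF _ bdd, of "?g y"] that v by (auto simp: D_def)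
    then show "\<forall>\<^sub>F y in at_left x. ?g y < v" unfolding eventually_at_left_field using x by auto
  next
    fix l assume "l < D"
    then obtain z where z: "z \<in> {a<..<x}" "l < ?g z" using less_cSupD[OF ne] unfolding D_def by blast
    have "l < ?g y" if "z < y" "y < x" for y
      using convex_on_slope_mono[OF f, of x z y] that z x by (auto intro: less_le_trans)
    then show "\<forall>\<^sub>F y in at_left x. l < ?g y" unfolding eventually_at_left_field using z by auto
  qed
  then show ?thesis unfolding has_field_derivative_iff at_within_Iic_at_left by blast
qed

subsection \<open>Hypothesis testing\<close>

lemma cdiag_smult:
  assumes "unitary N U"
  shows "complex_of_real c \<cdot>\<^sub>m cdiag N U f = cdiag N U (\<lambda>i. c * f i)"
proof -
  note u = unitaryD[OF assms]
  have "mat_diag N (\<lambda>i. complex_of_real (c * f i)) = complex_of_real c \<cdot>\<^sub>m mat_diag N (\<lambda>i. complex_of_real (f i))"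
    by (rule eq_matI) (auto simp: mat_diag_def)
  then show ?thesis unfolding cdiag_def using u
    by (simp add: mult_smult_distrib[of _ N N _ N] mult_smult_assoc_mat[of _ N N _ N])
qed

lemma psd_smult:
  assumes "psd N A" "0 \<le> c"
  shows "psd N (complex_of_real c \<cdot>\<^sub>m A)"
proof -
  obtain U p where U: "unitary N U" "\<forall>i. 0 \<le> p i" "A = cdiag N U p" using psd_cdiagE[OF assms(1)] by blast
  show ?thesis unfolding U(3) cdiag_smult[OF U(1)] by (rule psd_cdiag[OF U(1)]) (use U(2) assms in simp)
qed

lemma mpow_smult:
  assumes "psd N A" "0 < c"
  shows "mpow (complex_of_real c \<cdot>\<^sub>m A) s = complex_of_real (c powr s) \<cdot>\<^sub>m mpow A s"
proof -
  obtain U p where U: "unitary N U" "\<forall>i. 0 \<le> p i" "A = cdiag N U p" using psd_cdiagE[OF assms(1)] by blast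
  show ?thesis unfolding U(3) cdiag_smult[OF U(1)]
    using U assms(2) mpow_cdiag[OF U(1), of p] mpow_cdiag[OF U(1), of "\<lambda>i. c * p i"]
    by (simp add: cdiag_smult powr_mult)
qed

text \<open>Source of the exponent n a (1 - s) when the second state is scaled by exp(n a).\<close>

lemma qtr_smult_right:
  assumes "psd N A" "psd N B" "0 < c"
  shows "qtr A (complex_of_real c \<cdot>\<^sub>m B) s = c powr (1 - s) * qtr A B s"
proof -
  note a = psd_carrier[OF psd_mpow[OF assms(1), of s]] and b = psd_carrier[OF psd_mpow[OF assms(2), of "1 - s"]]
  show ?thesis unfolding qtr_def mpow_smult[OF assms(2,3)] mult_smult_distrib[OF a b]
    using a b by (simp add: mtrace_smult[of _ N])
qed

text \<open>With supp X for \<open>mpow X 0\<close>: Tr A = Tr A supp A <= Tr A supp B <= Tr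
  A.\<close>

lemma dominatedI:
  assumes A: "psd N A" and B: "psd N B" and le: "psd N (mpow B 0 - mpow A 0)"
  shows "dominated A B"
proof -
  obtain U q where U: "unitary N U" "\<forall>i. 0 \<le> q i" "B = cdiag N U q" using psd_cdiagE[OF B] by blast
  have c: "A \<in> carrier_mat N N" "mpow B 0 \<in> carrier_mat N N" "mpow A 0 \<in> carrier_mat N N"
    using psd_carrier psd_mpow A B by auto
  have "1\<^sub>m N - mpow B 0 = cdiag N U (\<lambda>i. 1 - q i powr 0)"
    unfolding U(3) mpow_cdiag[OF U(1) U(2)[rule_format]] cdiag_one[OF U(1), symmetric] cdiag_minus[OF U(1)] ..
  then have "psd N (1\<^sub>m N - mpow B 0)" using psd_cdiag[OF U(1), of "\<lambda>i. 1 - q i powr 0"] by simp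
  then have 1: "Re (mtrace (A * mpow B 0)) \<le> Re (mtrace A)"
    using mtrace_psd_mult_nonneg[OF A] Re_mtrace_minus_mult(2)[of "1\<^sub>m N" N "mpow B 0" A] c by fastforce
  have "A * mpow A 0 = A" using mpow_mult_mpow[OF A, of 1 0] mpow_one[OF A] by simp
  then have 2: "Re (mtrace A) \<le> Re (mtrace (A * mpow B 0))"
    using mtrace_psd_mult_nonneg[OF A le] Re_mtrace_minus_mult(2)[OF c(2,3,1)] by simp
  show ?thesis using 1 2 by (simp add: dominated_def)
qed

section \<open>The averaged states and the functions psi_n\<close>

locale hypothesis_test = compact_unitary_rep \<mu> d u
  for \<mu> :: "'g::{topological_group_add,t2_space} measure" and d u +
  fixes r0 r1 :: "complex mat"
  assumes st0: "state_mat d r0" and st1: "state_mat d r1" and dom: "dominated r0 r1"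
begin

definition \<rho> :: "nat \<Rightarrow> complex mat" where "\<rho> n = E n (tpow r0 n)"
definition \<sigma> :: "nat \<Rightarrow> complex mat" where "\<sigma> n = E n (tpow r1 n)"

abbreviation \<psi>\<^sub>n :: "nat \<Rightarrow> real \<Rightarrow> real" where "\<psi>\<^sub>n \<equiv> psi_n d \<mu> u r0 r1"
abbreviation \<psi> :: "real \<Rightarrow> real" where "\<psi> \<equiv> psi d \<mu> u r0 r1"

lemma psd_r: "psd d r0" "psd d r1" and mtrace_r: "mtrace r0 = 1" "mtrace r1 = 1"
  using st0 st1 by (auto simp: state_mat_def)

lemma r_carrier [simp]: "r0 \<in> carrier_mat d d" "r1 \<in> carrier_mat d d"
  using psd_r psd_carrier by auto

lemma psd_\<rho>\<sigma>: "psd (d ^ n) (\<rho> n)" "psd (d ^ n) (\<sigma> n)"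
  unfolding \<rho>_def \<sigma>_def by (intro psd_E psd_tpow psd_r)+

lemma mtrace_\<rho>: "mtrace (\<rho> n) = 1"
  unfolding \<rho>_def by (simp add: mtrace_E mtrace_tpow[of _ d] mtrace_r)

lemma dominated_\<rho>\<sigma>: "dominated (\<rho> n) (\<sigma> n)"
  unfolding \<rho>_def \<sigma>_def
  by (rule dominated_coarse[OF psd_tpow[OF psd_r(1)] psd_tpow[OF psd_r(2)] psd_E[OF psd_tpow[OF psd_r(1)]]
        psd_E[OF psd_tpow[OF psd_r(2)]] dominated_tpow[OF psd_r dom] _ parsum_tpow_le_E[OF psd_r]])
    (simp_all add: mtrace_E)

lemma \<psi>\<^sub>n_eq: "\<psi>\<^sub>n n s = ln (qtr (\<rho> n) (\<sigma> n) s)"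
  by (simp add: psi_n_def qtr_def \<rho>_def \<sigma>_def E_def)

lemma qtr_\<rho>\<sigma>_pos: "s \<noteq> 0 \<Longrightarrow> 0 < qtr (\<rho> n) (\<sigma> n) s"
  by (rule qtr_pos[OF psd_\<rho>\<sigma> dominated_\<rho>\<sigma>]) (simp_all add: mtrace_\<rho>)

lemma \<psi>\<^sub>n_one: "\<psi>\<^sub>n n 1 = 0"
  using dominated_\<rho>\<sigma>[of n] by (simp add: \<psi>\<^sub>n_eq qtr_one[OF psd_\<rho>\<sigma>(1)] dominated_def mtrace_\<rho>)

lemma \<psi>\<^sub>n_convex: "convex_on {0<..} (\<psi>\<^sub>n n)"
proof -
  have "\<psi>\<^sub>n n = (\<lambda>s. ln (qtr (\<rho> n) (\<sigma> n) s))" by (rule ext) (rule \<psi>\<^sub>n_eq)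
  then show ?thesis using ln_qtr_convex[OF psd_\<rho>\<sigma>(1)[of n] psd_\<rho>\<sigma>(2)[of n] dominated_\<rho>\<sigma>] by (simp add: mtrace_\<rho>)
qed

section \<open>Existence and convexity of the limit psi\<close>

lemma qtr_add_eq:
  "qtr (kron (\<rho> m) (\<rho> n)) (kron (\<sigma> m) (\<sigma> n)) s = qtr (\<rho> m) (\<sigma> m) s * qtr (\<rho> n) (\<sigma> n) s"
  by (rule qtr_kron[OF psd_\<rho>\<sigma> psd_\<rho>\<sigma>])

lemma psd_kron_\<rho>\<sigma>: "psd (d ^ (m + n)) (kron (\<rho> m) (\<rho> n))" "psd (d ^ (m + n)) (kron (\<sigma> m) (\<sigma> n))"
  unfolding power_add by (rule psd_kron[OF psd_\<rho>\<sigma>(1) psd_\<rho>\<sigma>(1)], rule psd_kron[OF psd_\<rho>\<sigma>(2) psd_\<rho>\<sigma>(2)])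

lemma parsum_\<rho>\<sigma>_add:
  "0 < t \<Longrightarrow> parsum (d ^ (m + n)) t (\<rho> (m + n)) (\<sigma> (m + n)) \<le> parsum (d ^ (m + n)) t (kron (\<rho> m) (\<rho> n)) (kron (\<sigma> m) (\<sigma> n))"
  unfolding \<rho>_def \<sigma>_def by (rule parsum_E_add[OF psd_r])

lemma \<psi>\<^sub>n_subadditive:
  assumes s: "0 < s" "s < 1"
  shows "\<psi>\<^sub>n (m + n) s \<le> \<psi>\<^sub>n m s + \<psi>\<^sub>n n s"
proof -
  have "qtr (\<rho> (m + n)) (\<sigma> (m + n)) s \<le> qtr (\<rho> m) (\<sigma> m) s * qtr (\<rho> n) (\<sigma> n) s"
    unfolding qtr_add_eq[symmetric] by (rule qtr_mono[OF psd_\<rho>\<sigma> psd_kron_\<rho>\<sigma> s parsum_\<rho>\<sigma>_add])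
  then show ?thesis using s qtr_\<rho>\<sigma>_pos[of s] by (simp add: \<psi>\<^sub>n_eq ln_mult_pos[symmetric])
qed

lemma \<psi>\<^sub>n_superadditive:
  assumes s: "1 < s" "s < 2"
  shows "\<psi>\<^sub>n m s + \<psi>\<^sub>n n s \<le> \<psi>\<^sub>n (m + n) s"
proof -
  have "mtrace (kron (\<rho> m) (\<rho> n)) = 1"
    using mtrace_kron[OF psd_carrier[OF psd_\<rho>\<sigma>(1)[of m]] psd_carrier[OF psd_\<rho>\<sigma>(1)[of n]]] by (simp add: mtrace_\<rho>)
  then have "qtr (\<rho> m) (\<sigma> m) s * qtr (\<rho> n) (\<sigma> n) s \<le> qtr (\<rho> (m + n)) (\<sigma> (m + n)) s"
    unfolding qtr_add_eq[symmetric]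
    by (intro qtr_antimono[OF psd_\<rho>\<sigma> psd_kron_\<rho>\<sigma> dominated_\<rho>\<sigma> s _ parsum_\<rho>\<sigma>_add]) (simp_all add: mtrace_\<rho>)
  then show ?thesis using s qtr_\<rho>\<sigma>_pos[of s] by (simp add: \<psi>\<^sub>n_eq ln_mult_pos[symmetric])
qed

text \<open>For 1 < s < 2 averaging lowers \<open>qtr\<close>, and on the original tensor powers
  \<open>qtr\<close> is an n-th power.\<close>

lemma \<psi>\<^sub>n_upper:
  assumes s: "1 < s" "s < 2"
  shows "\<psi>\<^sub>n n s \<le> ln (qtr r0 r1 s) * real n"
proof -
  have "qtr (\<rho> n) (\<sigma> n) s \<le> qtr (tpow r0 n) (tpow r1 n) s"
    unfolding \<rho>_def \<sigma>_def
    by (rule qtr_antimono[OF psd_tpow[OF psd_r(1)] psd_tpow[OF psd_r(2)] psd_E[OF psd_tpow[OF psd_r(1)]]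
        psd_E[OF psd_tpow[OF psd_r(2)]] dominated_tpow[OF psd_r dom] s _ parsum_tpow_le_E[OF psd_r]])
      (simp_all add: mtrace_E)
  also have "\<dots> = qtr r0 r1 s ^ n" by (rule qtr_tpow[OF psd_r])
  finally have "\<psi>\<^sub>n n s \<le> ln (qtr r0 r1 s ^ n)" using s qtr_\<rho>\<sigma>_pos[of s n] by (simp add: \<psi>\<^sub>n_eq)
  moreover have "0 < qtr r0 r1 s" using qtr_pos[OF psd_r dom] s mtrace_r by simp
  ultimately show ?thesis by (simp add: ln_realpow mult.commute)
qed

text \<open>The midpoint of s and 2 - s is 1, where psi_n vanishes, so convexity turns the upper
  bound above 1 into a lower bound below 1.\<close>

lemma \<psi>\<^sub>n_lower:
  assumes s: "0 < s" "s < 1"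
  shows "- (ln (qtr r0 r1 (2 - s)) * real n) \<le> \<psi>\<^sub>n n s"
proof -
  have "\<psi>\<^sub>n n ((1 - 1/2) *\<^sub>R s + (1/2) *\<^sub>R (2 - s)) \<le> (1 - 1/2) * \<psi>\<^sub>n n s + 1/2 * \<psi>\<^sub>n n (2 - s)"
    by (rule convex_onD[OF \<psi>\<^sub>n_convex]) (use s in auto)
  moreover have "(1 - 1/2) *\<^sub>R s + (1/2) *\<^sub>R (2 - s) = 1" by (simp add: field_simps)
  ultimately have "0 \<le> \<psi>\<^sub>n n s + \<psi>\<^sub>n n (2 - s)" using \<psi>\<^sub>n_one[of n] by simp
  then show ?thesis using \<psi>\<^sub>n_upper[of "2 - s" n] s by simp
qed

text \<open>\<open>psi\<close> is defined through \<open>lim\<close>, which carries information only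
  once convergence is known. Fekete applies to psi_n below 1 and to its negative above 1.\<close>

lemma \<psi>_tendsto:
  assumes s: "0 < s" "s < 2"
  shows "(\<lambda>n. \<psi>\<^sub>n n s / real n) \<longlonglongrightarrow> \<psi> s"
proof -
  consider "s < 1" | "s = 1" | "1 < s" by linarith
  then have "convergent (\<lambda>n. \<psi>\<^sub>n n s / real n)"
  proof cases
    case 1
    then show ?thesis using \<psi>\<^sub>n_subadditive[OF s(1)] \<psi>\<^sub>n_lower[OF s(1)] by (intro subadditive_convergent) auto
  next
    case 2
    then show ?thesis by (simp add: \<psi>\<^sub>n_one convergent_const)
  next
    case 3
    have "convergent (\<lambda>n. - \<psi>\<^sub>n n s / real n)"
      using \<psi>\<^sub>n_superadditive[OF 3 s(2)] \<psi>\<^sub>n_upper[OF 3 s(2)]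
      by (intro subadditive_convergent[where C="ln (qtr r0 r1 s)"]) (auto simp: algebra_simps)
    then show ?thesis using convergent_minus_iff[of "\<lambda>n. \<psi>\<^sub>n n s / real n"] by simp
  qed
  then show ?thesis by (simp add: psi_def convergent_LIMSEQ_iff)
qed

lemma \<psi>_one: "\<psi> 1 = 0"
  using LIMSEQ_unique[OF \<psi>_tendsto[of 1]] by (simp add: \<psi>\<^sub>n_one)

lemma \<psi>_convex: "convex_on {0<..<2} \<psi>"
proof (rule convex_onI)
  show "convex {0<..<2::real}" by simp
  fix t x y :: real assume t: "0 < t" "t < 1" and xy: "x \<in> {0<..<2}" "y \<in> {0<..<2}"
  let ?z = "(1 - t) *\<^sub>R x + t *\<^sub>R y"
  have "?z \<in> {0<..<2}"
    using convexD_alt[of "{0<..<2::real}" x y t] t xy by simp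
  then have z: "0 < ?z" "?z < 2" by simp_all
  have "\<psi>\<^sub>n n ?z / real n \<le> (1 - t) * (\<psi>\<^sub>n n x / real n) + t * (\<psi>\<^sub>n n y / real n)" for n
    using divide_right_mono[OF convex_onD[OF \<psi>\<^sub>n_convex, of t x y n], of "real n"] t xy
    by (simp add: add_divide_distrib)
  then show "\<psi> ?z \<le> (1 - t) * \<psi> x + t * \<psi> y"
    using xy by (intro LIMSEQ_le[OF \<psi>_tendsto[OF z] tendsto_add[OF tendsto_mult_left[OF \<psi>_tendsto] tendsto_mult_left[OF \<psi>_tendsto]]])
      auto
qed

section \<open>Error probabilities of invariant tests\<close>

lemma commutant_U:
  assumes "T \<in> commutant d u n"
  shows "T \<in> carrier_mat (d ^ n) (d ^ n)" "U n g * T = T * U n g"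
  using assms by (auto simp: commutant_def U_def)

text \<open>A test in the commutant has the same expectation in a state and in its average, so both
  errors may be computed with the averaged states.\<close>

lemma beta_eq:
  assumes T: "T \<in> commutant d u n"
  shows "beta0 d r0 n T = 1 - Re (mtrace (\<rho> n * T))" "beta1 r1 n T = Re (mtrace (\<sigma> n * T))"
proof -
  note c = commutant_U[OF T]
  have t: "tpow r0 n \<in> carrier_mat (d ^ n) (d ^ n)" "tpow r1 n \<in> carrier_mat (d ^ n) (d ^ n)" by simp_all
  show "beta1 r1 n T = Re (mtrace (\<sigma> n * T))"
    by (simp add: beta1_def \<sigma>_def mtrace_E_commutant[OF t(2) c])
  show "beta0 d r0 n T = 1 - Re (mtrace (\<rho> n * T))"
    unfolding beta0_def \<rho>_def mtrace_E_commutant[OF t(1) c]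
    using Re_mtrace_minus_mult(2)[OF one_carrier_mat c(1) t(1)] t(1)
    by (simp add: mtrace_tpow[of _ d] mtrace_r)
qed

text \<open>The logarithm of \<open>test_converse\<close>, where a is at least 1 - \<epsilon>.
  Positivity of the second error makes \<open>elog\<close> a finite logarithm.\<close>

lemma beta1_converse:
  assumes T: "admissible d u r0 \<epsilon> T" and \<epsilon>: "\<epsilon> < 1" and s: "1 < s" "s < 2"
  shows "0 < beta1 r1 n (T n)"
    and "(s * ln (1 - \<epsilon>) - ln 2 - \<psi>\<^sub>n n s) / (s - 1) \<le> ln (beta1 r1 n (T n))"
proof -
  have Tc: "T n \<in> commutant d u n" and Tp: "psd (d ^ n) (T n)" "psd (d ^ n) (1\<^sub>m (d ^ n) - T n)"
    and b0: "beta0 d r0 n (T n) \<le> \<epsilon>" using T by (auto simp: admissible_def)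
  define a where "a = Re (mtrace (\<rho> n * T n))"
  define b where "b = Re (mtrace (\<sigma> n * T n))"
  have a: "1 - \<epsilon> \<le> a" using b0 unfolding beta_eq(1)[OF Tc] a_def by simp
  then have a0: "0 < a" using \<epsilon> by simp
  have b: "0 < b" and le: "a powr s * b powr (1 - s) \<le> 2 * qtr (\<rho> n) (\<sigma> n) s"
    using test_converse[OF psd_\<rho>\<sigma> dominated_\<rho>\<sigma> Tp s] a0 by (auto simp: a_def b_def)
  show "0 < beta1 r1 n (T n)" unfolding beta_eq(2)[OF Tc] using b by (simp add: b_def)
  have q: "0 < qtr (\<rho> n) (\<sigma> n) s" using qtr_\<rho>\<sigma>_pos s by simp
  have "ln (a powr s * b powr (1 - s)) \<le> ln (2 * qtr (\<rho> n) (\<sigma> n) s)" using le a0 b q by simp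
  then have "s * ln a + (1 - s) * ln b \<le> ln 2 + \<psi>\<^sub>n n s"
    using a0 b q by (simp add: \<psi>\<^sub>n_eq ln_mult_pos ln_powr)
  moreover have "s * ln (1 - \<epsilon>) \<le> s * ln a" using a \<epsilon> s by simp
  ultimately have "s * ln (1 - \<epsilon>) - ln 2 - \<psi>\<^sub>n n s \<le> ln b * (s - 1)" by (simp add: algebra_simps)
  then show "(s * ln (1 - \<epsilon>) - ln 2 - \<psi>\<^sub>n n s) / (s - 1) \<le> ln (beta1 r1 n (T n))"
    unfolding beta_eq(2)[OF Tc] b_def[symmetric] using s by (simp add: divide_le_eq)
qed

lemma s_lower_ge:
  assumes \<epsilon>: "\<epsilon> < 1" and s: "1 < s" "s < 2"
  shows "ereal (- (\<psi> s / (s - 1))) \<le> s_lower d u r0 r1 \<epsilon>"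
  unfolding s_lower_def
proof (rule INF_greatest)
  fix T assume "T \<in> {T. admissible d u r0 \<epsilon> T}"
  then have T: "admissible d u r0 \<epsilon> T" by simp
  \<comment> \<open>Everything depending on \<epsilon> sits in this constant and disappears after
    division by n, so the limiting bound is the same for all \<epsilon> < 1.\<close>
  define c where "c = s * ln (1 - \<epsilon>) - ln 2"
  let ?f = "\<lambda>n. (c / real n - \<psi>\<^sub>n n s / real n) / (s - 1)"
  have "(\<lambda>n. (c / real n - \<psi>\<^sub>n n s / real n) / (s - 1)) \<longlonglongrightarrow> (0 - \<psi> s) / (s - 1)"
    using s by (intro tendsto_intros lim_const_over_n \<psi>_tendsto) auto
  then have "(\<lambda>n. ereal (?f n)) \<longlonglongrightarrow> ereal (- (\<psi> s / (s - 1)))" by simp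
  then have "ereal (- (\<psi> s / (s - 1))) = liminf (\<lambda>n. ereal (?f n))"
    by (rule lim_imp_Liminf[OF sequentially_bot, symmetric])
  also have "\<dots> \<le> liminf (\<lambda>n. elog (beta1 r1 n (T n)) / ereal (real n))"
  proof (rule Liminf_mono, rule eventually_sequentiallyI[of 1])
    fix n :: nat assume n: "1 \<le> n"
    note b = beta1_converse[OF T \<epsilon> s, of n]
    have "?f n = (c - \<psi>\<^sub>n n s) / (s - 1) / real n" by (simp add: diff_divide_distrib mult.commute)
    also have "\<dots> \<le> ln (beta1 r1 n (T n)) / real n" using b(2) n unfolding c_def by (intro divide_right_mono) auto
    finally show "ereal (?f n) \<le> elog (beta1 r1 n (T n)) / ereal (real n)"
      using b(1) n by (simp add: elog_def)
  qed
  finally show "ereal (- (\<psi> s / (s - 1))) \<le> liminf (\<lambda>n. elog (beta1 r1 n (T n)) / ereal (real n))" .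
qed

text \<open>The Neyman-Pearson test for the first state against exp(n a) times the second. The bound
  on the weighted sum of the errors gives each one separately, because the other is
  nonnegative.\<close>

lemma optimal_test:
  assumes s: "0 < s" "s < 1"
  obtains T where "T \<in> commutant d u n" "psd (d ^ n) T" "psd (d ^ n) (1\<^sub>m (d ^ n) - T)"
    "beta0 d r0 n T \<le> exp (real n * a * (1 - s) + \<psi>\<^sub>n n s)"
    "0 \<le> beta1 r1 n T" "beta1 r1 n T \<le> exp (- (real n * a * s) + \<psi>\<^sub>n n s)"
proof -
  let ?N = "d ^ n"
  define c where "c = exp (real n * a)"
  have c: "0 < c" by (simp add: c_def)
  let ?B = "complex_of_real c \<cdot>\<^sub>m \<sigma> n"
  have B: "psd ?N ?B" using psd_smult[OF psd_\<rho>\<sigma>(2)] c by simp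
  obtain T where T: "psd ?N T" "psd ?N (1\<^sub>m ?N - T)"
    and comm: "\<forall>M\<in>carrier_mat ?N ?N. M * \<rho> n = \<rho> n * M \<longrightarrow> M * ?B = ?B * M \<longrightarrow> M * T = T * M"
    and le: "Re (mtrace (\<rho> n * (1\<^sub>m ?N - T))) + Re (mtrace (?B * T)) \<le> qtr (\<rho> n) ?B s"
    using neyman_pearson_test[OF psd_\<rho>\<sigma>(1) B s] by blast
  note cs = psd_carrier[OF psd_\<rho>\<sigma>(1)[of n]] psd_carrier[OF psd_\<rho>\<sigma>(2)[of n]] psd_carrier[OF T(1)]
  have "U n g * T = T * U n g" for g
  proof (rule comm[rule_format])
    show "U n g * \<rho> n = \<rho> n * U n g" unfolding \<rho>_def by (rule E_commute) simp
    have "U n g * \<sigma> n = \<sigma> n * U n g" unfolding \<sigma>_def by (rule E_commute) simp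
    then show "U n g * ?B = ?B * U n g"
      using cs(2) by (simp add: mult_smult_distrib[of _ ?N ?N _ ?N] mult_smult_assoc_mat[of _ ?N ?N _ ?N])
  qed simp
  then have Tc: "T \<in> commutant d u n" using cs(3) by (simp add: commutant_def U_def)
  have b1: "0 \<le> beta1 r1 n T" unfolding beta_eq(2)[OF Tc] by (rule mtrace_psd_mult_nonneg[OF psd_\<rho>\<sigma>(2) T(1)])
  have "Re (mtrace (\<rho> n * (1\<^sub>m ?N - T))) = beta0 d r0 n T"
    unfolding beta_eq(1)[OF Tc] using Re_mtrace_minus_mult(2)[OF one_carrier_mat cs(3,1)] cs(1) by (simp add: mtrace_\<rho>)
  moreover have "Re (mtrace (?B * T)) = c * beta1 r1 n T"
    unfolding beta_eq(2)[OF Tc] using cs by (simp add: mult_smult_assoc_mat[of _ ?N ?N _ ?N] mtrace_smult[of _ ?N])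
  moreover have "qtr (\<rho> n) ?B s = exp (real n * a * (1 - s) + \<psi>\<^sub>n n s)"
    unfolding qtr_smult_right[OF psd_\<rho>\<sigma> c] using qtr_\<rho>\<sigma>_pos[of s n] s
    by (simp add: c_def powr_def exp_add \<psi>\<^sub>n_eq mult.commute)
  ultimately have sum: "beta0 d r0 n T + c * beta1 r1 n T \<le> exp (real n * a * (1 - s) + \<psi>\<^sub>n n s)" using le by simp
  have b0: "0 \<le> beta0 d r0 n T"
    unfolding \<open>Re (mtrace (\<rho> n * (1\<^sub>m ?N - T))) = beta0 d r0 n T\<close>[symmetric]
    by (rule mtrace_psd_mult_nonneg[OF psd_\<rho>\<sigma>(1) T(2)])
  have "c * beta1 r1 n T \<le> exp (real n * a * (1 - s) + \<psi>\<^sub>n n s)" using sum b0 by simp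
  also have "\<dots> = c * exp (- (real n * a * s) + \<psi>\<^sub>n n s)"
    unfolding c_def exp_add[symmetric] by (simp add: algebra_simps)
  finally have "beta1 r1 n T \<le> exp (- (real n * a * s) + \<psi>\<^sub>n n s)" using c by simp
  moreover have "beta0 d r0 n T \<le> exp (real n * a * (1 - s) + \<psi>\<^sub>n n s)" using sum mult_nonneg_nonneg[OF less_imp_le[OF c] b1] by linarith
  ultimately show ?thesis using that Tc T b1 by blast
qed

text \<open>The slope condition says psi(s) / (s - 1) > a'. The gap between a and a' drives the
  first error to 0 exponentially, while the second still decays at least at rate a.\<close>

lemma s_upper_le:
  assumes \<epsilon>: "0 < \<epsilon>" and s: "0 < s" "s < 1" and a: "a < a'" and slope: "\<psi> s < - ((1 - s) * a')"
  shows "s_upper d u r0 r1 \<epsilon> \<le> ereal (- a)"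
proof -
  have "\<exists>T. T \<in> commutant d u n \<and> psd (d ^ n) T \<and> psd (d ^ n) (1\<^sub>m (d ^ n) - T) \<and>
    beta0 d r0 n T \<le> exp (real n * a * (1 - s) + \<psi>\<^sub>n n s) \<and>
    0 \<le> beta1 r1 n T \<and> beta1 r1 n T \<le> exp (- (real n * a * s) + \<psi>\<^sub>n n s)" for n
    by (rule optimal_test[OF s, of n a]) blast
  then obtain P where P: "\<And>n. P n \<in> commutant d u n \<and> psd (d ^ n) (P n) \<and> psd (d ^ n) (1\<^sub>m (d ^ n) - P n) \<and>
    beta0 d r0 n (P n) \<le> exp (real n * a * (1 - s) + \<psi>\<^sub>n n s) \<and>
    0 \<le> beta1 r1 n (P n) \<and> beta1 r1 n (P n) \<le> exp (- (real n * a * s) + \<psi>\<^sub>n n s)" by metis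
  let ?good = "\<lambda>n. exp (real n * a * (1 - s) + \<psi>\<^sub>n n s) \<le> \<epsilon>"
  \<comment> \<open>\<open>admissible\<close> constrains every n, so the finitely many n at which
    the bound still exceeds \<epsilon> receive the identity, whose first error is 0.\<close>
  define T where "T n = (if ?good n then P n else 1\<^sub>m (d ^ n))" for n
  have "psd (d ^ n) (1\<^sub>m (d ^ n) - 1\<^sub>m (d ^ n))" for n
    using psd_cdiag[OF unitary_one, of "d ^ n" "\<lambda>_. 1 - 1"] cdiag_minus[OF unitary_one, of "d ^ n" "\<lambda>_. 1" "\<lambda>_. 1"]
      cdiag_one[OF unitary_one, of "d ^ n"] by simp
  moreover have "1\<^sub>m (d ^ n) \<in> commutant d u n" for n
    using left_mult_one_mat[OF U_dims(3)[of n]] right_mult_one_mat[OF U_dims(3)[of n]]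
    by (simp add: commutant_def U_def)
  moreover have "beta0 d r0 n (1\<^sub>m (d ^ n)) = 0" for n
    using beta_eq(1)[OF \<open>1\<^sub>m (d ^ n) \<in> commutant d u n\<close>] psd_carrier[OF psd_\<rho>\<sigma>(1)[of n]] by (simp add: mtrace_\<rho>)
  moreover have "beta0 d r0 n (P n) \<le> \<epsilon>" if "?good n" for n
    using P[of n] that by linarith
  ultimately have adm: "admissible d u r0 \<epsilon> T"
    using P \<epsilon> unfolding admissible_def T_def by (simp add: psd_one)
  have ev: "\<forall>\<^sub>F n in sequentially. \<psi>\<^sub>n n s / real n < - ((1 - s) * a')"
    using order_tendstoD(2)[OF \<psi>_tendsto slope] s by simp
  \<comment> \<open>From m on, n (1 - s) (a' - a) is at least -ln \<epsilon>.\<close>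
  obtain m :: nat where m: "- ln \<epsilon> \<le> real m * ((1 - s) * (a' - a))"
    using reals_Archimedean3[of "(1 - s) * (a' - a)"] s a by (metis diff_gt_0_iff_gt less_imp_le mult_pos_pos)
  have "\<forall>\<^sub>F n in sequentially. elog (beta1 r1 n (T n)) / ereal (real n) \<le> ereal (- a)"
    using ev eventually_ge_at_top[of "max m 1"]
  proof eventually_elim
    case (elim n)
    then have n: "m \<le> n" "1 \<le> n" by auto
    have ps: "\<psi>\<^sub>n n s \<le> - (real n * ((1 - s) * a'))"
      using elim(1) n by (simp add: divide_less_eq mult.commute)
    have "real n * a * (1 - s) + \<psi>\<^sub>n n s \<le> - (real n * ((1 - s) * (a' - a)))"
      using ps by (simp add: algebra_simps)
    also have "\<dots> \<le> - (real m * ((1 - s) * (a' - a)))" using n s a by (simp add: mult_right_mono)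
    also have "\<dots> \<le> ln \<epsilon>" using m by simp
    finally have "?good n" using \<epsilon> by (metis exp_le_cancel_iff exp_ln)
    then have Tn: "T n = P n" by (simp add: T_def)
    \<comment> \<open>Here a' is weakened to a, so that the exponents n a s and n (1 - s) a add up
      to n a.\<close>
    have "- (real n * a * s) + \<psi>\<^sub>n n s \<le> - (real n * a * s) - real n * ((1 - s) * a)"
      using ps a s n by (smt (verit) mult_left_mono of_nat_0_le_iff)
    also have "\<dots> = - (real n * a)" by (simp add: algebra_simps)
    finally have "exp (- (real n * a * s) + \<psi>\<^sub>n n s) \<le> exp (- (real n * a))" by simp
    moreover have "beta1 r1 n (P n) \<le> exp (- (real n * a * s) + \<psi>\<^sub>n n s)" "0 \<le> beta1 r1 n (P n)"
      using P[of n] by blast+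
    ultimately have le: "beta1 r1 n (T n) \<le> exp (- (real n * a))" and ge: "0 \<le> beta1 r1 n (T n)"
      unfolding Tn by linarith+
    show ?case
    \<comment> \<open>If the second error is 0, \<open>elog\<close> is minus infinity and the bound
      is trivial.\<close>
    proof (cases "beta1 r1 n (T n) = 0")
      case True
      then show ?thesis using n by (simp add: elog_def)
    next
      case False
      then have "ln (beta1 r1 n (T n)) \<le> - (real n * a)"
        using le ge ln_le_cancel_iff[of "beta1 r1 n (T n)" "exp (- (real n * a))"] by simp
      then show ?thesis using False n by (simp add: elog_def divide_le_eq mult.commute)
    qed
  qed
  then have "limsup (\<lambda>n. elog (beta1 r1 n (T n)) / ereal (real n)) \<le> ereal (- a)" by (rule Limsup_bounded)
  then show ?thesis unfolding s_upper_def using adm by (intro INF_lower2[of T]) auto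
qed

end

theorem theorem4p5:
  fixes d :: nat and \<mu> :: "'g::{topological_group_add,t2_space} measure"
    and u :: "'g \<Rightarrow> complex mat" and r0 r1 :: "complex mat" and \<epsilon> :: real
  assumes G_compact: "compact (UNIV :: 'g set)"
    and haar: "haar_prob \<mu>"
    and rep: "unitary_rep d u"
    and st0: "state_mat d r0" and st1: "state_mat d r1"
    and supp1_inv: "mpow r1 0 \<in> commutant d u 1"
    and supp_le: "psd d (mpow r1 0 - mpow r0 0)"
    and eps: "0 < \<epsilon>" "\<epsilon> < 1"
  shows "\<exists>Dp Dm. (psi d \<mu> u r0 r1 has_real_derivative Dp) (at 1 within {1..}) \<and>
                (psi d \<mu> u r0 r1 has_real_derivative Dm) (at 1 within {..1}) \<and>
                ereal (- Dp) \<le> s_lower d u r0 r1 \<epsilon> \<and>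
                s_lower d u r0 r1 \<epsilon> \<le> s_upper d u r0 r1 \<epsilon> \<and>
                s_upper d u r0 r1 \<epsilon> \<le> ereal (- Dm)"
proof -
  have psd: "psd d r0" "psd d r1" using st0 st1 by (auto simp: state_mat_def)
  interpret hypothesis_test \<mu> d u r0 r1
    by unfold_locales (use G_compact haar rep st0 st1 dominatedI[OF psd supp_le] in auto)
  obtain Dp where Dp: "(\<psi> has_real_derivative Dp) (at 1 within {1..})"
    using convex_on_right_derivative[OF \<psi>_convex, of 1] by auto
  obtain Dm where Dm: "(\<psi> has_real_derivative Dm) (at 1 within {..1})"
    using convex_on_left_derivative[OF \<psi>_convex, of 1] by auto
  \<comment> \<open>Because psi(1) = 0, this is the difference quotient at 1.\<close>
  have "((\<lambda>s. \<psi> s / (s - 1)) \<longlongrightarrow> Dp) (at_right 1)"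
    using Dp by (simp add: has_field_derivative_iff at_within_Ici_at_right \<psi>_one)
  then have "((\<lambda>s. ereal (- (\<psi> s / (s - 1)))) \<longlongrightarrow> ereal (- Dp)) (at_right 1)"
    by (intro tendsto_intros)
  moreover have "\<forall>\<^sub>F s in at_right 1. ereal (- (\<psi> s / (s - 1))) \<le> s_lower d u r0 r1 \<epsilon>"
    unfolding eventually_at_right_field using s_lower_ge[OF eps(2)] by (intro exI[of _ 2]) auto
  ultimately have lower: "ereal (- Dp) \<le> s_lower d u r0 r1 \<epsilon>"
    by (rule tendsto_upperbound) simp
  have mid: "s_lower d u r0 r1 \<epsilon> \<le> s_upper d u r0 r1 \<epsilon>"
    unfolding s_lower_def s_upper_def
    by (rule INF_mono) (use Liminf_le_Limsup[OF sequentially_bot] in blast)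
  \<comment> \<open>The strict inequality leaves room for the intermediate rate a' that
    \<open>s_upper_le\<close> requires; \<open>dense_ge\<close> removes the gap afterwards.\<close>
  have upper': "s_upper d u r0 r1 \<epsilon> \<le> ereal (- a)" if a: "a < Dm" for a
  proof -
    obtain a' where a': "a < a'" "a' < Dm" using dense[OF a] by blast
    have "((\<lambda>s. \<psi> s / (s - 1)) \<longlongrightarrow> Dm) (at_left 1)"
      using Dm by (simp add: has_field_derivative_iff at_within_Iic_at_left \<psi>_one)
    from order_tendstoD(1)[OF this a'(2)] obtain b where b: "b < 1" "\<And>s. b < s \<Longrightarrow> s < 1 \<Longrightarrow> a' < \<psi> s / (s - 1)"
      unfolding eventually_at_left_field by blast
    obtain s where s: "max b 0 < s" "s < 1" using dense[of "max b 0" 1] b(1) by auto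
    then have "a' < \<psi> s / (s - 1)" using b(2) by simp
    then have "\<psi> s < a' * (s - 1)" using s by (simp add: less_divide_eq)
    then have "\<psi> s < - ((1 - s) * a')" by (simp add: algebra_simps)
    then show ?thesis using s_upper_le[OF eps(1) _ _ a'(1), of s] s by simp
  qed
  have upper: "s_upper d u r0 r1 \<epsilon> \<le> ereal (- Dm)"
  proof (rule dense_ge)
    fix x assume x: "ereal (- Dm) < x"
    show "s_upper d u r0 r1 \<epsilon> \<le> x"
    proof (cases x)
      case (real r)
      then show ?thesis using upper'[of "- r"] x by simp
    qed (use x in auto)
  qed
  show ?thesis using Dp Dm lower mid upper by blast
qed

end
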